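(* Let $\mathcal{M}$ be a regular matroid on the ground set $[m]$ with set of bases $\mathcal{B}$. There exists a counting algorithm which, given a cost vector $c\in\mathbb{Z}^m$ and a value $C\in\mathbb{Z}$, outputs the cardinality of the set $\{S\in\mathcal{B}:c(S)\le C\}$, and a sampling algorithm which, given a cost vector $c\in\mathbb{Z}^m$ and a value $C\in\mathbb{Z}$, outputs a uniformly random element of the set $\{S\in\mathcal{B}:c(S)\le C\}$. The running time of both algorithms is polynomial in $m$ and $\|c\|_1$.
   Context: $[m]=\{1,\dots,m\}$; $c(S)=\sum_{i\in S}c_i$, $\|c\|_1=\sum_i|c_i|$. A matroid is regular if it is representable by the rows of a totally unimodular matrix. The polynomial bound does not depend on the matroid. Running time counts exact arithmetic operations, and tosses of a coin with a computed bias in $[0,1]$, at unit cost. The sampling problem is considered only when the set $\{S\in\mathcal{B}:c(S)\le C\}$ is nonempty. *)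

theory Defs
  imports
    "Jordan_Normal_Form.DL_Submatrix"
    "Jordan_Normal_Form.VS_Connect"
    "HOL-Computational_Algebra.Polynomial"
    "HOL-Probability.Probability_Mass_Function"
begin

section \<open>Regular matroids on \<open>{1..m}\<close>\<close>

locale matroid =
  fixes E :: "'a set" and \<I> :: "'a set set"
  assumes finite_ground: "finite E"
    and indep_subset_ground: "X \<in> \<I> \<Longrightarrow> X \<subseteq> E"
    and indep_empty: "{} \<in> \<I>"
    and indep_downward: "X \<in> \<I> \<Longrightarrow> Y \<subseteq> X \<Longrightarrow> Y \<in> \<I>"
    and indep_augment: "X \<in> \<I> \<Longrightarrow> Y \<in> \<I> \<Longrightarrow> card X < card Y \<Longrightarrow> \<exists>y\<in>Y - X. insert y X \<in> \<I>"

definition bases :: "'a set set \<Rightarrow> 'a set set" where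
  "bases \<I> = {S \<in> \<I>. \<forall>T\<in>\<I>. S \<subseteq> T \<longrightarrow> S = T}"

definition totally_unimodular :: "real mat \<Rightarrow> bool" where
  "totally_unimodular A \<longleftrightarrow>
     (\<forall>I J. I \<subseteq> {..<dim_row A} \<longrightarrow> J \<subseteq> {..<dim_col A} \<longrightarrow> card I = card J \<longrightarrow>
        Determinant.det (submatrix A I J) \<in> {-1, 0, 1})"

text \<open>The element \<open>i \<in> {1..m}\<close> corresponds to the row of \<open>A\<close> with the (zero-based) index \<open>i - 1\<close>.
  Injectivity is required because a family containing two equal rows is linearly dependent, whereas
  the library's notion speaks about the set of rows.\<close>

definition rows_independent :: "real mat \<Rightarrow> nat set \<Rightarrow> bool" where
  "rows_independent A S \<longleftrightarrow>
     inj_on (\<lambda>i. Matrix.row A (i - 1)) S \<and>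
     \<not> module.lin_dep class_ring (module_vec TYPE(real) (dim_col A)) ((\<lambda>i. Matrix.row A (i - 1)) ` S)"

definition regular_matroid :: "nat \<Rightarrow> nat set set \<Rightarrow> bool" where
  "regular_matroid m \<I> \<longleftrightarrow> matroid {1..m} \<I> \<and>
     (\<exists>A. dim_row A = m \<and> totally_unimodular A \<and>
        (\<forall>S \<subseteq> {1..m}. S \<in> \<I> \<longleftrightarrow> rows_independent A S))"

definition cost :: "(nat \<Rightarrow> int) \<Rightarrow> nat set \<Rightarrow> int" where
  "cost c S = (\<Sum>i\<in>S. c i)"

definition bases_within :: "nat set set \<Rightarrow> (nat \<Rightarrow> int) \<Rightarrow> int \<Rightarrow> nat set set" where
  "bases_within \<I> c C = {S \<in> bases \<I>. cost c S \<le> C}"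

definition l1_norm :: "nat \<Rightarrow> (nat \<Rightarrow> int) \<Rightarrow> nat" where
  "l1_norm m c = nat (\<Sum>i=1..m. \<bar>c i\<bar>)"


section \<open>Algorithms with exact arithmetic and biased coins\<close>

text \<open>
  Algorithms are finite programs of an imperative language. The memory consists of arrays of
  rational numbers, indexed by natural numbers; a scalar variable is an array of which only cell 0
  is used. The only operations on numbers are exact field operations and comparisons (in
  particular there is no rounding and no division with remainder), and 0 and 1 are the only
  constants.
\<close>

type_synonym name = string
type_synonym state = "name \<Rightarrow> nat \<Rightarrow> rat"

datatype aexp =
    Zero
  | One
  | Cell name aexp
  | Add aexp aexp
  | Sub aexp aexp
  | Mul aexp aexp
  | Div aexp aexp

datatype bexp =
    Less aexp aexp
  | Neg bexp
  | Conj bexp bexp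

datatype com =
    Skip
  | Assign name aexp aexp
  | Toss name aexp aexp
  | Seq com com
  | Cond bexp com com
  | While bexp com

text \<open>\<open>Assign a i e\<close> writes the value of \<open>e\<close> into cell \<open>i\<close> of the array \<open>a\<close>; \<open>Toss a i e\<close> writes 1
  into that cell with probability \<open>e\<close>, and 0 otherwise.\<close>

fun aval :: "aexp \<Rightarrow> state \<Rightarrow> rat" where
  "aval Zero s = 0"
| "aval One s = 1"
| "aval (Cell a i) s = s a (nat \<lfloor>aval i s\<rfloor>)"
| "aval (Add e f) s = aval e s + aval f s"
| "aval (Sub e f) s = aval e s - aval f s"
| "aval (Mul e f) s = aval e s * aval f s"
| "aval (Div e f) s = aval e s / aval f s"

text \<open>Evaluation is legal only if all array indices are natural numbers (so that the floor in
  \<open>aval\<close> never rounds) and no division by zero occurs. A program that attempts an illegal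
  evaluation gets stuck.\<close>

fun alegal :: "aexp \<Rightarrow> state \<Rightarrow> bool" where
  "alegal Zero s \<longleftrightarrow> True"
| "alegal One s \<longleftrightarrow> True"
| "alegal (Cell a i) s \<longleftrightarrow> alegal i s \<and> aval i s \<in> \<nat>"
| "alegal (Add e f) s \<longleftrightarrow> alegal e s \<and> alegal f s"
| "alegal (Sub e f) s \<longleftrightarrow> alegal e s \<and> alegal f s"
| "alegal (Mul e f) s \<longleftrightarrow> alegal e s \<and> alegal f s"
| "alegal (Div e f) s \<longleftrightarrow> alegal e s \<and> alegal f s \<and> aval f s \<noteq> 0"

fun asize :: "aexp \<Rightarrow> nat" where
  "asize Zero = 1"
| "asize One = 1"
| "asize (Cell a i) = asize i + 1"
| "asize (Add e f) = asize e + asize f + 1"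
| "asize (Sub e f) = asize e + asize f + 1"
| "asize (Mul e f) = asize e + asize f + 1"
| "asize (Div e f) = asize e + asize f + 1"

fun bval :: "bexp \<Rightarrow> state \<Rightarrow> bool" where
  "bval (Less e f) s \<longleftrightarrow> aval e s < aval f s"
| "bval (Neg b) s \<longleftrightarrow> \<not> bval b s"
| "bval (Conj b d) s \<longleftrightarrow> bval b s \<and> bval d s"

fun blegal :: "bexp \<Rightarrow> state \<Rightarrow> bool" where
  "blegal (Less e f) s \<longleftrightarrow> alegal e s \<and> alegal f s"
| "blegal (Neg b) s \<longleftrightarrow> blegal b s"
| "blegal (Conj b d) s \<longleftrightarrow> blegal b s \<and> blegal d s"

fun bsize :: "bexp \<Rightarrow> nat" where
  "bsize (Less e f) = asize e + asize f + 1"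
| "bsize (Neg b) = bsize b + 1"
| "bsize (Conj b d) = bsize b + bsize d + 1"

fun csize :: "com \<Rightarrow> nat" where
  "csize Skip = 1"
| "csize (Assign a i e) = asize i + asize e + 1"
| "csize (Toss a i e) = asize i + asize e + 1"
| "csize (Seq c d) = csize c + csize d + 1"
| "csize (Cond b c d) = bsize b + csize c + csize d + 1"
| "csize (While b c) = bsize b + csize c + 1"

definition update :: "state \<Rightarrow> name \<Rightarrow> nat \<Rightarrow> rat \<Rightarrow> state" where
  "update s a k v = s(a := (s a)(k := v))"

definition tick :: "nat \<Rightarrow> (state \<times> nat) pmf \<Rightarrow> (state \<times> nat) pmf" where
  "tick k D = map_pmf (\<lambda>(s, t). (s, k + t)) D"

text \<open>\<open>exec c s D\<close>: started in the state \<open>s\<close>, the program \<open>c\<close> halts for every outcome of its coin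
  tosses, and \<open>D\<close> is the joint distribution of its final state and the number of unit-cost
  operations it has performed. Every read, write, arithmetic operation, comparison, toss and branch
  is charged.\<close>

inductive exec :: "com \<Rightarrow> state \<Rightarrow> (state \<times> nat) pmf \<Rightarrow> bool" where
  Skip: "exec Skip s (return_pmf (s, 1))"
| Assign: "alegal i s \<Longrightarrow> aval i s \<in> \<nat> \<Longrightarrow> alegal e s \<Longrightarrow>
    exec (Assign a i e) s
      (return_pmf (update s a (nat \<lfloor>aval i s\<rfloor>) (aval e s), asize i + asize e + 1))"
| Toss: "alegal i s \<Longrightarrow> aval i s \<in> \<nat> \<Longrightarrow> alegal e s \<Longrightarrow> 0 \<le> aval e s \<Longrightarrow> aval e s \<le> 1 \<Longrightarrow>
    exec (Toss a i e) s
      (map_pmf (\<lambda>r. (update s a (nat \<lfloor>aval i s\<rfloor>) (if r then 1 else 0), asize i + asize e + 1))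
        (bernoulli_pmf (real_of_rat (aval e s))))"
| Seq: "exec c s D \<Longrightarrow> (\<And>s' t. (s', t) \<in> set_pmf D \<Longrightarrow> exec d s' (F s')) \<Longrightarrow>
    exec (Seq c d) s (bind_pmf D (\<lambda>(s', t). tick (t + 1) (F s')))"
| CondTrue: "blegal b s \<Longrightarrow> bval b s \<Longrightarrow> exec c s D \<Longrightarrow>
    exec (Cond b c d) s (tick (bsize b + 1) D)"
| CondFalse: "blegal b s \<Longrightarrow> \<not> bval b s \<Longrightarrow> exec d s D \<Longrightarrow>
    exec (Cond b c d) s (tick (bsize b + 1) D)"
| WhileTrue: "blegal b s \<Longrightarrow> bval b s \<Longrightarrow> exec (Seq c (While b c)) s D \<Longrightarrow>
    exec (While b c) s (tick (bsize b + 1) D)"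
| WhileFalse: "blegal b s \<Longrightarrow> \<not> bval b s \<Longrightarrow>
    exec (While b c) s (return_pmf (s, bsize b + 1))"

text \<open>The input \<open>(c, C)\<close>; the memory is zero elsewhere. The number \<open>m\<close> itself is not part of the
  input, as the program may depend on the matroid.\<close>

definition input :: "nat \<Rightarrow> (nat \<Rightarrow> int) \<Rightarrow> int \<Rightarrow> state" where
  "input m c C = (\<lambda>a k.
     if a = ''c'' \<and> k \<in> {1..m} then of_int (c k)
     else if a = ''C'' \<and> k = 0 then of_int C
     else 0)"

definition out_number :: "state \<Rightarrow> rat" where
  "out_number s = s ''out'' 0"

definition out_set :: "nat \<Rightarrow> state \<Rightarrow> nat set" where
  "out_set m s = {k \<in> {1..m}. s ''out'' k = 1}"

text \<open>The running time of \<open>P\<close> consists of the operations performed and, in addition, of the length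
  of the program, as if it had to be read first. Since programs may depend on the matroid, a bound
  that is uniform in the matroid would otherwise admit programs containing tables of size
  exponential in \<open>m\<close>.\<close>

definition running_time :: "com \<Rightarrow> nat \<Rightarrow> nat" where
  "running_time P t = csize P + t"

definition counting_algorithm ::
  "nat \<Rightarrow> nat set set \<Rightarrow> ((nat \<Rightarrow> int) \<Rightarrow> nat) \<Rightarrow> com \<Rightarrow> bool" where
  "counting_algorithm m \<I> T P \<longleftrightarrow>
     (\<forall>c C. \<exists>s t. exec P (input m c C) (return_pmf (s, t)) \<and>
        out_number s = of_nat (card (bases_within \<I> c C)) \<and>
        running_time P t \<le> T c)"

definition sampling_algorithm ::
  "nat \<Rightarrow> nat set set \<Rightarrow> ((nat \<Rightarrow> int) \<Rightarrow> nat) \<Rightarrow> com \<Rightarrow> bool" where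
  "sampling_algorithm m \<I> T P \<longleftrightarrow>
     (\<forall>c C. bases_within \<I> c C \<noteq> {} \<longrightarrow>
        (\<exists>D. exec P (input m c C) D \<and>
          map_pmf (\<lambda>(s, t). out_set m s) D = pmf_of_set (bases_within \<I> c C) \<and>
          (\<forall>(s, t) \<in> set_pmf D. running_time P t \<le> T c)))"

text \<open>The value at \<open>(x, y)\<close> of a polynomial in two variables, given as a polynomial whose
  coefficients are polynomials.\<close>

definition poly2 :: "nat poly poly \<Rightarrow> nat \<Rightarrow> nat \<Rightarrow> nat" where
  "poly2 p x y = poly (poly p [:x:]) y"

end

(* Select columns of the totally unimodular matrix so that it becomes an m x r matrix A, r the
   rank of the matroid. For weights w > 0 put W = diag(w). By the Cauchy-Binet formula det(A^T W A)
   is the sum of the products w(S) over the bases S, because every r x r minor of A is -1, 0 or 1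
   and it vanishes exactly off the bases. The matrix A^T W A is positive definite, so Gaussian
   elimination needs no pivoting and evaluates this determinant with polynomially many operations.

   Counting uses a single evaluation at w_i = X^(-c_i) with the huge base X = 2^(m+1) + 1. After
   multiplication by X^C the result is the sum of X^(C - c(S)) over all bases S. The terms with
   c(S) > C add up to less than 1, the other ones are powers of X and hence congruent to 1 modulo
   X - 1. So the required cardinality is the floor of the result modulo X - 1 ("casting out nines"),
   which is found by subtracting powers of 2 greedily.

   Sampling decides the elements one after the other. The bases that extend the decisions made so
   far are counted by the same program after a penalty B has been added to the cost of each rejected
   element and subtracted from the cost of each chosen one. *)

theory Submission
  imports Defs
begin

section \<open>The Cauchy-Binet formula\<close>

text \<open>Powers of X are formed by repeated multiplication, so exponents must stay polynomial in
  m and \<open>l1_norm\<close>; the numbers themselves may be enormous, because exact arithmetic has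
  unit cost. This is why all costs can be packed into one rational number, and why only
  logarithmically many greedy subtractions are needed to unpack it. There are at most 2^m bases, and
  X - 1 = 2^(m+1) exceeds their number plus the contribution (below 1) of the too expensive ones, so
  reduction modulo X - 1 loses nothing. That X - 1 is a power of 2 makes it reachable by doubling
  and halving alone. Without the selection of columns, A^T W A would have rank r but possibly more
  than r rows, hence determinant 0. The selection must not turn an independent set into a dependent
  one: all rows are combinations of the rows of one basis, and the columns are chosen such that this
  basis has a nonzero minor, so a relation between rows that holds on the selected columns holds on
  all of them. The representing matrix is real while programs compute with rationals; as its entries
  are -1, 0 or 1, the selected part is copied verbatim.\<close>

abbreviation mdet :: "nat \<Rightarrow> (nat \<Rightarrow> nat \<Rightarrow> 'a::comm_ring_1) \<Rightarrow> 'a" where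
  "mdet r f \<equiv> Determinant.det (Matrix.mat r r (\<lambda>(i, j). f i j))"

lemma mdet_eq:
  "mdet r f = (\<Sum>p | p permutes {0..<r}. signof p * (\<Prod>i=0..<r. f i (p i)))"
proof -
  have "mdet r f = (\<Sum>p | p permutes {0..<r}. signof p *
      (\<Prod>i=0..<r. Matrix.mat r r (\<lambda>(i, j). f i j) $$ (i, p i)))"
    by (rule det_def') simp
  also have "\<dots> = (\<Sum>p | p permutes {0..<r}. signof p * (\<Prod>i=0..<r. f i (p i)))"
  proof (intro sum.cong refl arg_cong2[of _ _ _ _ "(*)"] prod.cong)
    fix p i assume "p \<in> {p. p permutes {0..<r}}" "i \<in> {0..<r}"
    then have "i < r" "p i < r" using permutes_in_image[of p "{0..<r}" i] by auto
    then show "Matrix.mat r r (\<lambda>(i, j). f i j) $$ (i, p i) = f i (p i)" by simp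
  qed
  finally show ?thesis .
qed

lemma mdet_cong: "(\<And>i j. i < r \<Longrightarrow> j < r \<Longrightarrow> f i j = g i j) \<Longrightarrow> mdet r f = mdet r g"
  by (rule arg_cong[of _ _ Determinant.det], rule eq_matI) auto

lemma mdet_permute_rows:
  assumes "p permutes {0..<r}"
  shows "mdet r (\<lambda>i. f (p i)) = signof p * mdet r f"
proof -
  have "mdet r (\<lambda>i. f (p i)) =
      Determinant.det (Matrix.mat r r (\<lambda>(i, j). Matrix.mat r r (\<lambda>(i, j). f i j) $$ (p i, j)))"
    using permutes_in_image[OF assms] by (intro mdet_cong) (auto simp: atLeast0LessThan)
  also have "\<dots> = signof p * mdet r f"
    by (rule Determinant.det_permute_rows) (use assms in auto)
  finally show ?thesis .
qed

lemma mdet_transpose: "mdet r (\<lambda>i j. f j i) = mdet r f"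
proof -
  have "Determinant.det (transpose_mat (Matrix.mat r r (\<lambda>(i, j). f i j))) = mdet r f"
    by (rule Determinant.det_transpose[of _ r]) simp
  also have "transpose_mat (Matrix.mat r r (\<lambda>(i, j). f i j)) = Matrix.mat r r (\<lambda>(i, j). f j i)"
    by (rule eq_matI) auto
  finally show ?thesis .
qed

lemma mdet_identical_rows:
  assumes "i < r" "j < r" "i \<noteq> j" "\<And>l. l < r \<Longrightarrow> f i l = f j l"
  shows "mdet r f = 0"
  by (rule Determinant.det_identical_rows[where i = i and j = j and n = r])
    (use assms in \<open>auto simp: Matrix.row_def\<close>)

text \<open>Expanding the products of sums turns the left side into a sum over choices f of one row
  per index, each weighted by the determinant of the chosen rows. Repeated rows contribute 0. The
  injective choices with image S are the rearrangements of \<open>en S\<close>, and summing their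
  signs against the products yields the same minor a second time. Any enumeration \<open>en\<close>
  will do, because the square removes its sign.\<close>

theorem Cauchy_Binet_weighted:
  fixes a :: "'b \<Rightarrow> nat \<Rightarrow> 'a::comm_ring_1"
  assumes R: "finite R"
    and en: "\<And>S. S \<subseteq> R \<Longrightarrow> card S = r \<Longrightarrow> bij_betw (en S) {0..<r} S"
  shows "mdet r (\<lambda>j l. \<Sum>i\<in>R. w i * a i j * a i l) =
    (\<Sum>S | S \<subseteq> R \<and> card S = r. (\<Prod>i\<in>S. w i) * (mdet r (\<lambda>j. a (en S j)))\<^sup>2)"
proof -
  define F where "F = PiE {0..<r} (\<lambda>_. R)"
  define h where "h f = (\<Prod>j=0..<r. w (f j) * a (f j) j) * mdet r (\<lambda>j. a (f j))" for f
  have finF: "finite F" unfolding F_def by (rule finite_PiE) (use R in auto)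
  have "mdet r (\<lambda>j l. \<Sum>i\<in>R. w i * a i j * a i l) =
      (\<Sum>p | p permutes {0..<r}. signof p *
        (\<Sum>f\<in>F. \<Prod>j=0..<r. w (f j) * a (f j) j * a (f j) (p j)))"
    unfolding mdet_eq F_def using R by (subst prod_sum_PiE) auto
  \<comment> \<open>With f outermost, the sum over p is the Leibniz formula for the matrix whose row
    j is row \<open>f j\<close> of a.\<close>
  also have "\<dots> = (\<Sum>f\<in>F. \<Sum>p | p permutes {0..<r}. signof p *
        (\<Prod>j=0..<r. w (f j) * a (f j) j * a (f j) (p j)))"
    unfolding sum_distrib_left by (rule sum.swap)
  also have "\<dots> = (\<Sum>f\<in>F. h f)"
    unfolding h_def mdet_eq sum_distrib_left
    by (intro sum.cong refl) (simp add: prod.distrib mult.commute mult.left_commute)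
  also have "\<dots> = (\<Sum>f\<in>{f\<in>F. inj_on f {0..<r}}. h f)"
  proof (rule sum.mono_neutral_right[OF finF])
    show "\<forall>f\<in>F - {f\<in>F. inj_on f {0..<r}}. h f = 0"
    proof
      fix f assume "f \<in> F - {f\<in>F. inj_on f {0..<r}}"
      then obtain i j where "i < r" "j < r" "i \<noteq> j" "f i = f j"
        by (auto simp: inj_on_def)
      then have "mdet r (\<lambda>j. a (f j)) = 0" by (intro mdet_identical_rows[of i r j]) auto
      then show "h f = 0" by (simp add: h_def)
    qed
  qed auto
  also have "\<dots> = (\<Sum>S | S \<subseteq> R \<and> card S = r.
      \<Sum>f\<in>{f\<in>{f\<in>F. inj_on f {0..<r}}. f ` {0..<r} = S}. h f)"
    by (rule sum.group[symmetric]) (use finF R in \<open>auto simp: F_def card_image\<close>)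
  also have "\<dots> = (\<Sum>S | S \<subseteq> R \<and> card S = r. (\<Prod>i\<in>S. w i) * (mdet r (\<lambda>j. a (en S j)))\<^sup>2)"
  proof (intro sum.cong refl)
    fix S assume "S \<in> {S. S \<subseteq> R \<and> card S = r}"
    then have S: "S \<subseteq> R" "card S = r" by auto
    define e where "e = en S"
    have e: "bij_betw e {0..<r} S" unfolding e_def by (rule en[OF S])
    then have einj: "inj_on e {0..<r}" and eim: "e ` {0..<r} = S" by (auto simp: bij_betw_def)
    let ?D = "mdet r (\<lambda>j. a (e j))"
    \<comment> \<open>Every such f is e after a permutation q. Outside {0..<r}, q has to be the
      identity for \<open>permutes\<close>, and f has to be undefined for
      \<open>PiE\<close>.\<close>
    have "(\<Sum>f\<in>{f\<in>{f\<in>F. inj_on f {0..<r}}. f ` {0..<r} = S}. h f) =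
        (\<Sum>q | q permutes {0..<r}. h (\<lambda>j\<in>{0..<r}. e (q j)))"
    proof (rule sum.reindex_bij_witness[where
          i = "\<lambda>q. \<lambda>j\<in>{0..<r}. e (q j)" and
          j = "\<lambda>f x. if x < r then inv_into {0..<r} e (f x) else x"], goal_cases)
      case (1 f)
      then have f: "f \<in> F" "f ` {0..<r} = S" by auto
      show ?case
      proof
        fix x show "(\<lambda>j\<in>{0..<r}. e (if j < r then inv_into {0..<r} e (f j) else j)) x = f x"
        proof (cases "x < r")
          case True
          then have "f x \<in> e ` {0..<r}" using f eim by auto
          with True show ?thesis by (simp add: f_inv_into_f)
        next
          case False
          then show ?thesis using f(1) by (auto simp: F_def PiE_def extensional_def)
        qed
      qed
    next
      case (2 f)
      then have f: "f \<in> F" "inj_on f {0..<r}" "f ` {0..<r} = S" by auto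
      have "bij_betw f {0..<r} S" using f by (auto simp: bij_betw_def)
      then have "bij_betw (inv_into {0..<r} e \<circ> f) {0..<r} {0..<r}"
        using bij_betw_inv_into[OF e] by (rule bij_betw_trans)
      then have "bij_betw (\<lambda>x. if x < r then inv_into {0..<r} e (f x) else x) {0..<r} {0..<r}"
        by (rule bij_betw_cong[THEN iffD1, rotated]) auto
      then show ?case by (auto intro!: bij_imp_permutes)
    next
      case (3 q)
      then have "q permutes {0..<r}" by simp
      show ?case
      proof
        fix x
        have "q x \<in> {0..<r}" if "x < r"
          using that permutes_in_image[OF \<open>q permutes _\<close>] by auto
        moreover have "q x = x" if "\<not> x < r"
          using that permutes_not_in[OF \<open>q permutes _\<close>] by auto
        ultimately show "(if x < r then inv_into {0..<r} e ((\<lambda>j\<in>{0..<r}. e (q j)) x) else x) = q x"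
          using einj by (simp add: inv_into_f_f)
      qed
    next
      case (4 q)
      then have q: "q permutes {0..<r}" by simp
      have im: "(\<lambda>j\<in>{0..<r}. e (q j)) ` {0..<r} = S"
        using permutes_image[OF q] eim by (simp add: image_image[of e q, symmetric])
      have "inj_on (e \<circ> q) {0..<r}"
        using permutes_image[OF q] permutes_inj_on[OF q] einj by (intro comp_inj_on) auto
      then have "inj_on (\<lambda>j\<in>{0..<r}. e (q j)) {0..<r}" by (auto simp: inj_on_def)
      then show ?case using im S by (auto simp: F_def)
    next
      case (5 f)
      then have f: "f \<in> F" "f ` {0..<r} = S" by auto
      have "(\<lambda>j\<in>{0..<r}. e (if j < r then inv_into {0..<r} e (f j) else j)) = f"
      proof
        fix x show "(\<lambda>j\<in>{0..<r}. e (if j < r then inv_into {0..<r} e (f j) else j)) x = f x"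
        proof (cases "x < r")
          case True
          then have "f x \<in> e ` {0..<r}" using f eim by auto
          with True show ?thesis by (simp add: f_inv_into_f)
        next
          case False
          then show ?thesis using f(1) by (auto simp: F_def PiE_def extensional_def)
        qed
      qed
      then show ?case by simp
    qed
    also have "\<dots> = (\<Sum>q | q permutes {0..<r}.
        (\<Prod>i\<in>S. w i) * ?D * (signof q * (\<Prod>j=0..<r. a (e (q j)) j)))"
    proof (intro sum.cong refl)
      fix q assume "q \<in> {q. q permutes {0..<r}}"
      then have q: "q permutes {0..<r}" by simp
      have "bij_betw (\<lambda>j. e (q j)) {0..<r} S"
        using bij_betw_trans[OF permutes_imp_bij[OF q] e] by (simp add: comp_def)
      then have "(\<Prod>j=0..<r. w (e (q j))) = (\<Prod>i\<in>S. w i)"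
        by (rule prod.reindex_bij_betw)
      moreover have "mdet r (\<lambda>j. a (e (q j))) = signof q * ?D"
        by (rule mdet_permute_rows[OF q])
      moreover have "mdet r (\<lambda>j. a ((\<lambda>j\<in>{0..<r}. e (q j)) j)) = mdet r (\<lambda>j. a (e (q j)))"
        by (rule mdet_cong) auto
      ultimately show "h (\<lambda>j\<in>{0..<r}. e (q j)) =
          (\<Prod>i\<in>S. w i) * ?D * (signof q * (\<Prod>j=0..<r. a (e (q j)) j))"
        by (simp add: h_def prod.distrib mult_ac)
    qed
    also have "\<dots> = (\<Prod>i\<in>S. w i) * ?D * mdet r (\<lambda>i j. a (e j) i)"
      unfolding mdet_eq[of r "\<lambda>i j. a (e j) i"] by (simp add: sum_distrib_left)
    also have "mdet r (\<lambda>i j. a (e j) i) = ?D" by (rule mdet_transpose)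
    finally show "(\<Sum>f\<in>{f\<in>{f\<in>F. inj_on f {0..<r}}. f ` {0..<r} = S}. h f) =
        (\<Prod>i\<in>S. w i) * (mdet r (\<lambda>j. a (en S j)))\<^sup>2"
      by (simp add: e_def power2_eq_square mult.assoc)
  qed
  finally show ?thesis .
qed

section \<open>Independent rows and Gaussian elimination\<close>

lemma bij_betw_permutes_factor:
  fixes r :: nat
  assumes e: "bij_betw e {0..<r} S" and f: "bij_betw f {0..<r} S"
  obtains p where "p permutes {0..<r}" "\<And>i. i < r \<Longrightarrow> f i = e (p i)"
proof
  let ?p = "\<lambda>x. if x < r then inv_into {0..<r} e (f x) else x"
  have "bij_betw (inv_into {0..<r} e \<circ> f) {0..<r} {0..<r}"
    using f bij_betw_inv_into[OF e] by (rule bij_betw_trans)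
  then have "bij_betw ?p {0..<r} {0..<r}"
    by (rule bij_betw_cong[THEN iffD1, rotated]) auto
  then show "?p permutes {0..<r}" by (rule bij_imp_permutes) auto
  fix i assume "i < r"
  then have "f i \<in> e ` {0..<r}" using e f unfolding bij_betw_def by fastforce
  with \<open>i < r\<close> show "f i = e (?p i)" by (simp add: f_inv_into_f)
qed

lemma bij_betw_pick:
  assumes "finite I"
  shows "bij_betw (pick I) {0..<card I} I"
proof -
  have "inj_on (pick I) {0..<card I}"
    by (rule linorder_inj_onI) (use pick_mono_le in \<open>force+\<close>)
  moreover have "pick I ` {0..<card I} \<subseteq> I" using pick_in_set_le by auto
  ultimately show ?thesis
    using assms by (metis bij_betw_def card_atLeastLessThan card_image card_subset_eq diff_zero)
qed

text \<open>\<open>submatrix\<close> lists rows and columns in increasing order. Other enumerations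
  differ from it by two permutations, which change at most the sign of the minor, and {-1, 0, 1} is
  closed under negation.\<close>

lemma totally_unimodular_det:
  assumes A: "totally_unimodular A"
    and f: "inj_on f {0..<r}" "\<And>i. i < r \<Longrightarrow> f i < dim_row A"
    and g: "inj_on g {0..<r}" "\<And>i. i < r \<Longrightarrow> g i < dim_col A"
  shows "mdet r (\<lambda>i j. A $$ (f i, g j)) \<in> {-1, 0, 1}"
proof -
  let ?I = "f ` {0..<r}" and ?J = "g ` {0..<r}"
  have card: "card ?I = r" "card ?J = r" using f g by (auto simp: card_image)
  have sub: "?I \<subseteq> {..<dim_row A}" "?J \<subseteq> {..<dim_col A}" using f g by auto
  have "bij_betw (pick ?I) {0..<r} ?I" using bij_betw_pick[of ?I] card by simp
  then obtain p where p: "p permutes {0..<r}" "\<And>i. i < r \<Longrightarrow> f i = pick ?I (p i)"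
    by (rule bij_betw_permutes_factor[OF _ inj_on_imp_bij_betw[OF f(1)]]) blast
  have "bij_betw (pick ?J) {0..<r} ?J" using bij_betw_pick[of ?J] card by simp
  then obtain q where q: "q permutes {0..<r}" "\<And>i. i < r \<Longrightarrow> g i = pick ?J (q i)"
    by (rule bij_betw_permutes_factor[OF _ inj_on_imp_bij_betw[OF g(1)]]) blast
  let ?b = "\<lambda>i j. A $$ (pick ?I i, pick ?J j)"
  have "{i. i < dim_row A \<and> i \<in> ?I} = ?I" "{j. j < dim_col A \<and> j \<in> ?J} = ?J"
    using sub by auto
  then have "submatrix A ?I ?J = Matrix.mat r r (\<lambda>(i, j). ?b i j)"
    by (simp add: submatrix_def card)
  then have *: "mdet r ?b \<in> {-1, 0, 1}"
    using A sub card unfolding totally_unimodular_def by metis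
  have "mdet r (\<lambda>i j. A $$ (f i, g j)) = mdet r (\<lambda>i j. ?b (p i) (q j))"
    by (rule mdet_cong) (simp add: p q)
  also have "\<dots> = signof p * mdet r (\<lambda>i j. ?b i (q j))"
    by (rule mdet_permute_rows[OF p(1)])
  also have "mdet r (\<lambda>i j. ?b i (q j)) = mdet r (\<lambda>i j. ?b j (q i))"
    by (rule mdet_transpose[symmetric])
  also have "\<dots> = signof q * mdet r (\<lambda>i j. ?b j i)"
    by (rule mdet_permute_rows[OF q(1)])
  also have "mdet r (\<lambda>i j. ?b j i) = mdet r ?b" by (rule mdet_transpose)
  finally show ?thesis using * by (auto simp: sign_def)
qed

text \<open>Restates independence with coefficients indexed by elements of S instead of row vectors,
  the form that fits determinants. Equal rows are covered on both sides: they violate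
  \<open>inj_on\<close>, and they give the relation with coefficients 1 and -1.\<close>

lemma rows_independent_iff:
  assumes fin: "finite S"
  shows "rows_independent A S \<longleftrightarrow>
    (\<forall>y. (\<forall>j<dim_col A. (\<Sum>i\<in>S. y i * A $$ (i - 1, j)) = 0) \<longrightarrow> (\<forall>i\<in>S. y i = 0))"
    (is "_ \<longleftrightarrow> ?R")
proof -
  let ?n = "dim_col A"
  let ?row = "\<lambda>i. Matrix.row A (i - 1)"
  interpret vs: vec_space "TYPE(real)" ?n .
  have rowc: "?row i \<in> carrier_vec ?n" for i by (simp add: Matrix.row_def)
  show ?thesis
  proof
    assume ind: "rows_independent A S"
    then have inj: "inj_on ?row S" and nd: "\<not> vs.lin_dep (?row ` S)"
      by (auto simp: rows_independent_def)
    show ?R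
    proof (intro allI impI ballI)
      fix y i assume y: "\<forall>j<?n. (\<Sum>i\<in>S. y i * A $$ (i - 1, j)) = 0" and i: "i \<in> S"
      define b where "b v = y (inv_into S ?row v)" for v
      have b: "b (?row i) = y i" if "i \<in> S" for i using inv_into_f_f[OF inj that] by (simp add: b_def)
      have "vs.lincomb b (?row ` S) = 0\<^sub>v ?n"
      proof (rule eq_vecI)
        have dim: "vs.lincomb b (?row ` S) \<in> carrier_vec ?n"
          by (rule vs.lincomb_closed) (use rowc in auto)
        then show "dim_vec (vs.lincomb b (?row ` S)) = dim_vec (0\<^sub>v ?n)" by simp
        fix j assume "j < dim_vec (0\<^sub>v ?n :: real Matrix.vec)"
        then have j: "j < ?n" by simp
        have rowj: "?row i $ j = A $$ (i - 1, j)" for i using j by (simp add: Matrix.row_def)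
        have "vs.lincomb b (?row ` S) $ j = (\<Sum>x\<in>?row ` S. b x * x $ j)"
          by (rule vs.lincomb_index) (use j rowc in auto)
        also have "\<dots> = (\<Sum>i\<in>S. y i * A $$ (i - 1, j))"
          using j by (subst sum.reindex[OF inj]) (auto intro!: sum.cong simp: b[unfolded One_nat_def] rowj[unfolded One_nat_def])
        finally show "vs.lincomb b (?row ` S) $ j = 0\<^sub>v ?n $ j" using y j by simp
      qed
      then have "b \<in> ?row ` S \<rightarrow> {0}"
        using vs.not_lindepD[OF nd, of "?row ` S" b] fin by simp
      then have "b (?row i) = 0" using i by blast
      then show "y i = 0" by (simp only: b[OF i])
    qed
  next
    assume R: ?R
    have inj: "inj_on ?row S"
    proof (rule inj_onI, rule ccontr)
      fix i k assume ik: "i \<in> S" "k \<in> S" "?row i = ?row k" "i \<noteq> k"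
      let ?y = "\<lambda>l. if l = i then 1 else if l = k then -1 else (0::real)"
      have "(\<Sum>l\<in>S. ?y l * A $$ (l - 1, j)) = 0" if "j < ?n" for j
      proof -
        have "(\<Sum>l\<in>S. ?y l * A $$ (l - 1, j)) = (\<Sum>l\<in>{i,k}. ?y l * A $$ (l - 1, j))"
          by (rule sum.mono_neutral_right) (use fin ik in auto)
        also have "\<dots> = ?row i $ j - ?row k $ j" using ik(4) that by (simp add: Matrix.row_def)
        finally show ?thesis using ik(3) by simp
      qed
      then have "\<forall>l\<in>S. ?y l = 0" by (intro R[THEN spec, THEN mp]) simp
      then have "?y i = 0" using ik(1) by (rule bspec)
      then show False by simp
    qed
    have "\<not> vs.lin_dep (?row ` S)"
    proof
      assume "vs.lin_dep (?row ` S)"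
      then obtain B b v where B: "finite B" "B \<subseteq> ?row ` S" "vs.lincomb b B = 0\<^sub>v ?n"
        "v \<in> B" "b v \<noteq> 0"
        unfolding vs.lin_dep_def by auto
      \<comment> \<open>\<open>lin_dep\<close> supplies a relation on a subset B only; it is
        extended by 0 to all of S.\<close>
      let ?y = "\<lambda>i. if ?row i \<in> B then b (?row i) else 0"
      have "(\<Sum>i\<in>S. ?y i * A $$ (i - 1, j)) = 0" if j: "j < ?n" for j
      proof -
        have "(\<Sum>i\<in>S. ?y i * A $$ (i - 1, j)) =
            (\<Sum>x\<in>?row ` S. (if x \<in> B then b x else 0) * x $ j)"
          using j by (subst sum.reindex[OF inj]) (auto intro!: sum.cong simp: Matrix.row_def)
        also have "\<dots> = (\<Sum>x\<in>B. b x * x $ j)"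
          by (rule sum.mono_neutral_cong_right) (use fin B in auto)
        also have "\<dots> = vs.lincomb b B $ j"
          by (rule vs.lincomb_index[symmetric]) (use j rowc B in auto)
        finally show ?thesis using j B by simp
      qed
      then have "\<forall>i\<in>S. ?y i = 0" by (intro R[THEN spec, THEN mp]) simp
      moreover obtain i where "i \<in> S" "v = ?row i" using B by blast
      ultimately show False using B by auto
    qed
    with inj show "rows_independent A S" by (simp add: rows_independent_def)
  qed
qed

text \<open>Induction on the number of rows, bordering a nonzero minor by the new row and a
  candidate column. The cofactors along the last column do not depend on that column. If every
  candidate gave determinant 0, they would form a relation between the rows whose last coefficient
  is, up to sign, the old nonzero minor.\<close>

lemma independent_rows_minor:
  fixes a :: "nat \<Rightarrow> nat \<Rightarrow> 'a::field"
  assumes "\<And>y. \<forall>j<n. (\<Sum>i<r. y i * a i j) = 0 \<Longrightarrow> \<forall>i<r. y i = 0"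
  shows "\<exists>g. (\<forall>j<r. g j < n) \<and> mdet r (\<lambda>i j. a i (g j)) \<noteq> 0"
  using assms
proof (induction r)
  case 0
  then show ?case by simp
next
  case (Suc r)
  have "\<forall>i<r. y i = 0" if y: "\<forall>j<n. (\<Sum>i<r. y i * a i j) = 0" for y
  proof -
    have "\<forall>i<Suc r. (y(r := 0)) i = 0" by (rule Suc.prems) (use y in auto)
    then show ?thesis by (metis fun_upd_other less_SucI nat_neq_iff)
  qed
  from Suc.IH[OF this] obtain g where
    g: "\<forall>j<r. g j < n" "mdet r (\<lambda>i j. a i (g j)) \<noteq> 0" by auto
  \<comment> \<open>The bordered matrix with column j of a in last position; \<open>y\<close>
    collects its cofactors along that position.\<close>
  define M where "M j = Matrix.mat (Suc r) (Suc r) (\<lambda>(i, l). a i ((g(r := j)) l))" for j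
  define y where "y i = cofactor (M 0) i r" for i
  have y: "cofactor (M j) i r = y i" if "i \<le> r" for i j
  proof -
    have "mat_delete (M j) i r = mat_delete (M 0) i r"
      by (rule eq_matI) (use that in \<open>auto simp: mat_delete_def M_def\<close>)
    then show ?thesis by (simp add: y_def cofactor_def)
  qed
  have det: "Determinant.det (M j) = (\<Sum>i<Suc r. y i * a i j)" for j
  proof -
    have "Determinant.det (M j) = (\<Sum>i<Suc r. M j $$ (i, r) * cofactor (M j) i r)"
      by (rule laplace_expansion_column) (auto simp: M_def)
    also have "\<dots> = (\<Sum>i<Suc r. y i * a i j)"
      by (intro sum.cong refl) (auto simp: y, auto simp: M_def)
    finally show ?thesis .
  qed
  have "mat_delete (M 0) r r = Matrix.mat r r (\<lambda>(i, j). a i (g j))"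
    by (rule eq_matI) (auto simp: mat_delete_def M_def)
  then have "y r \<noteq> 0" using g by (simp add: y_def cofactor_def)
  then have "\<not> (\<forall>j<n. (\<Sum>i<Suc r. y i * a i j) = 0)" using Suc.prems[of y] by blast
  then obtain j where j: "j < n" "Determinant.det (M j) \<noteq> 0" unfolding det by auto
  then show ?case using g unfolding M_def by (intro exI[of _ "g(r := j)"]) auto
qed

section \<open>Gaussian elimination without pivoting\<close>

lemma mdet_Schur_complement:
  fixes f :: "nat \<Rightarrow> nat \<Rightarrow> 'a::field"
  assumes p: "f 0 0 \<noteq> 0"
  shows "mdet (Suc n) f =
    f 0 0 * mdet n (\<lambda>i j. f (Suc i) (Suc j) - f (Suc i) 0 * f 0 (Suc j) / f 0 0)"
proof -
  let ?K = "Matrix.mat (Suc n) (Suc n) (\<lambda>(i, j). f i j)"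
  \<comment> \<open>The unit lower triangular matrix that clears column 0 below the pivot;
    multiplying by it preserves the determinant.\<close>
  define N where "N = Matrix.mat (Suc n) (Suc n)
    (\<lambda>(i, j). if i = j then 1 else if j = 0 then - f i 0 / f 0 0 else 0)"
  define U where "U = Matrix.mat (Suc n) (Suc n)
    (\<lambda>(i, j). if i = 0 then f 0 j else f i j - f i 0 * f 0 j / f 0 0)"
  have "Determinant.det N = prod_list (diag_mat N)"
    by (rule det_lower_triangular[where n = "Suc n"]) (auto simp: N_def)
  also have "diag_mat N = replicate (Suc n) 1"
    by (rule nth_equalityI) (auto simp: N_def diag_mat_def simp del: upt_Suc replicate_Suc)
  finally have detN: "Determinant.det N = 1" by simp
  have NK: "N * ?K = U"
  proof (rule eq_matI)
    fix i l assume "i < dim_row U" "l < dim_col U"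
    then have il: "i < Suc n" "l < Suc n" by (auto simp: U_def)
    have "(N * ?K) $$ (i, l) = (\<Sum>j<Suc n. N $$ (i, j) * f j l)"
      using il by (simp add: N_def scalar_prod_def Matrix.row_def lessThan_atLeast0 del: sum.op_ivl_Suc)
    also have "\<dots> = (\<Sum>j\<in>{0, i}. N $$ (i, j) * f j l)"
      by (rule sum.mono_neutral_right) (use il in \<open>auto simp: N_def\<close>)
    also have "\<dots> = U $$ (i, l)" using il p by (auto simp: N_def U_def)
    finally show "(N * ?K) $$ (i, l) = U $$ (i, l)" .
  qed (auto simp: N_def U_def)
  have "Determinant.det (N * ?K) = Determinant.det N * Determinant.det ?K"
    by (rule Determinant.det_mult[where n = "Suc n"]) (auto simp: N_def)
  then have "mdet (Suc n) f = Determinant.det U" by (simp add: NK detN)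
  also have "\<dots> = (\<Sum>i<Suc n. U $$ (i, 0) * cofactor U i 0)"
    by (rule laplace_expansion_column) (auto simp: U_def)
  also have "\<dots> = (\<Sum>i\<in>{0}. U $$ (i, 0) * cofactor U i 0)"
    by (rule sum.mono_neutral_right) (use p in \<open>auto simp: U_def\<close>)
  also have "\<dots> = f 0 0 * Determinant.det (mat_delete U 0 0)"
    by (simp add: U_def cofactor_def)
  also have "mat_delete U 0 0 = Matrix.mat n n (\<lambda>(i, j). f (Suc i) (Suc j) - f (Suc i) 0 * f 0 (Suc j) / f 0 0)"
    by (rule eq_matI) (auto simp: mat_delete_def U_def)
  finally show ?thesis .
qed

text \<open>The update is applied to all i and j without range restrictions. With nonzero pivots it
  makes row and column k zero, and they remain zero; the block with indices from k on is the
  successive Schur complement.\<close>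

primrec elim :: "(nat \<Rightarrow> nat \<Rightarrow> 'a::field) \<Rightarrow> nat \<Rightarrow> nat \<Rightarrow> nat \<Rightarrow> 'a" where
  "elim f 0 = f"
| "elim f (Suc k) = (let g = elim f k in (\<lambda>i j. g i j - g i k * g k j / g k k))"

declare elim.simps(2) [simp del]

lemma elim_Suc [simp]:
  "elim f (Suc k) i j = elim f k i j - elim f k i k * elim f k k j / elim f k k k"
  by (simp add: elim.simps(2) Let_def)

text \<open>After k steps the determinant is the product of the first k pivots and the determinant
  of the trailing block.\<close>

lemma mdet_elim:
  fixes f :: "nat \<Rightarrow> nat \<Rightarrow> 'a::field"
  assumes piv: "\<And>k. k < r \<Longrightarrow> elim f k k k \<noteq> 0"
  shows "mdet r f = (\<Prod>k<r. elim f k k k)"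
proof -
  have "mdet r f = (\<Prod>l<k. elim f l l l) * mdet (r - k) (\<lambda>i j. elim f k (i + k) (j + k))"
    if "k \<le> r" for k
    using that
  proof (induction k)
    case (Suc k)
    have "mdet (r - k) (\<lambda>i j. elim f k (i + k) (j + k)) =
        elim f k k k * mdet (r - Suc k) (\<lambda>i j. elim f (Suc k) (i + Suc k) (j + Suc k))"
      using mdet_Schur_complement[of "\<lambda>i j. elim f k (i + k) (j + k)" "r - Suc k"] piv[of k] Suc.prems
      by (simp add: Suc_diff_Suc)
    moreover have "mdet r f = (\<Prod>l<k. elim f l l l) * mdet (r - k) (\<lambda>i j. elim f k (i + k) (j + k))"
      using Suc by simp
    ultimately show ?case by (simp add: mult.assoc del: elim_Suc)
  qed simp
  from this[of r] show ?thesis by simp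
qed

text \<open>The trailing block remains positive definite throughout, and a pivot is the value of its
  quadratic form at a unit vector. For the step, the form of the next block at x is the form of the
  current block at a suitable extension of x.\<close>

lemma elim_pivots_pos:
  fixes f :: "nat \<Rightarrow> nat \<Rightarrow> 'a::linordered_field"
  assumes pd: "\<And>x. \<exists>i<r. x i \<noteq> 0 \<Longrightarrow> (\<Sum>i<r. \<Sum>j<r. x i * f i j * x j) > 0"
    and k: "k < r"
  shows "elim f k k k > 0"
proof -
  have pivot: "elim f k k k > 0"
    if "k < r" "\<And>x. \<exists>i\<in>{k..<r}. x i \<noteq> 0 \<Longrightarrow>
      (\<Sum>i\<in>{k..<r}. \<Sum>j\<in>{k..<r}. x i * elim f k i j * x j) > 0" for k
  proof -
    let ?x = "\<lambda>i. if i = k then 1 else (0::'a)"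
    have "0 < (\<Sum>i\<in>{k..<r}. \<Sum>j\<in>{k..<r}. ?x i * elim f k i j * ?x j)"
      by (rule that(2)) (use that(1) in auto)
    also have "\<dots> = (\<Sum>i\<in>{k..<r}. \<Sum>j\<in>{k..<r}. if i = k then (if j = k then elim f k i j else 0) else 0)"
      by (intro sum.cong refl) auto
    also have "\<dots> = elim f k k k" using that(1)
      by (simp add: sum.If_cases)
    finally show ?thesis .
  qed
  have "(\<Sum>i\<in>{k..<r}. \<Sum>j\<in>{k..<r}. x i * elim f k i j * x j) > 0"
    if "k < r" "\<exists>i\<in>{k..<r}. x i \<noteq> 0" for k x
    using that
  proof (induction k arbitrary: x)
    case 0
    then show ?case using pd[of x] by (simp add: lessThan_atLeast0 Bex_def)
  next
    case (Suc k)
    define p where "p = elim f k k k"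
    define B where "B = (\<Sum>j\<in>{Suc k..<r}. elim f k k j * x j)"
    define C where "C = (\<Sum>i\<in>{Suc k..<r}. x i * elim f k i k)"
    define D where "D = (\<Sum>i\<in>{Suc k..<r}. \<Sum>j\<in>{Suc k..<r}. x i * elim f k i j * x j)"
    \<comment> \<open>Chosen such that \<open>z k * p + B = 0\<close>: the terms from row k cancel,
      and what remains is the form of the Schur complement.\<close>
    define z where "z = x(k := - B / p)"
    have p: "p > 0" unfolding p_def using pivot[of k] Suc by simp
    have ins: "{k..<r} = insert k {Suc k..<r}" using Suc.prems by auto
    have "\<exists>i\<in>{k..<r}. z i \<noteq> 0" using Suc.prems(2) by (force simp: z_def)
    then have "0 < (\<Sum>i\<in>{k..<r}. \<Sum>j\<in>{k..<r}. z i * elim f k i j * z j)"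
      using Suc by simp
    also have "\<dots> = z k * p * z k + (\<Sum>j\<in>{Suc k..<r}. z k * elim f k k j * x j)
        + ((\<Sum>i\<in>{Suc k..<r}. x i * elim f k i k * z k) + D)"
    proof -
      have "z i = x i" if "i \<in> {Suc k..<r}" for i using that by (auto simp: z_def)
      then show ?thesis unfolding ins D_def p_def by (simp add: sum.distrib)
    qed
    also have "(\<Sum>j\<in>{Suc k..<r}. z k * elim f k k j * x j) = z k * B"
      by (simp add: B_def sum_distrib_left mult.assoc)
    also have "(\<Sum>i\<in>{Suc k..<r}. x i * elim f k i k * z k) = C * z k"
      by (simp add: C_def sum_distrib_right)
    also have "z k * p * z k + z k * B + (C * z k + D) = D - C * B / p"
    proof -
      have "z k = - B / p" "z k * p = - B" using p by (auto simp: z_def)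
      then show ?thesis by simp
    qed
    also have "C * B / p = (\<Sum>i\<in>{Suc k..<r}. \<Sum>j\<in>{Suc k..<r}. x i * (elim f k i k * elim f k k j / p) * x j)"
      unfolding C_def B_def sum_product sum_divide_distrib
      by (intro sum.cong refl) simp
    also have "D - \<dots> = (\<Sum>i\<in>{Suc k..<r}. \<Sum>j\<in>{Suc k..<r}. x i * elim f (Suc k) i j * x j)"
      unfolding D_def p_def by (simp add: right_diff_distrib left_diff_distrib sum_subtractf)
    finally show ?case .
  qed
  with k show ?thesis by (intro pivot) auto
qed

section \<open>Bases of a regular matroid as minors\<close>

text \<open>A square matrix is singular iff it has a nonzero kernel vector. The transpose is used,
  so that kernel vectors are relations between rows; entries are then transported from positions to
  elements of S along e.\<close>

lemma mdet_nonzero_iff: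
  fixes f :: "'b \<Rightarrow> nat \<Rightarrow> 'a::field"
  assumes e: "bij_betw e {0..<r} S"
  shows "mdet r (\<lambda>i. f (e i)) \<noteq> 0 \<longleftrightarrow>
    (\<forall>z. (\<forall>j<r. (\<Sum>i\<in>S. z i * f i j) = 0) \<longrightarrow> (\<forall>i\<in>S. z i = 0))"
proof -
  let ?B = "Matrix.mat r r (\<lambda>(i, j). f (e j) i)"
  have prod: "(?B *\<^sub>v v) $ j = (\<Sum>i<r. v $ i * f (e i) j)"
    if "j < r" "v \<in> carrier_vec r" for j and v :: "'a Matrix.vec"
    using that by (simp add: scalar_prod_def lessThan_atLeast0 mult.commute)
  have reindex: "(\<Sum>i\<in>S. h i) = (\<Sum>i<r. h (e i))" for h :: "'b \<Rightarrow> 'a"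
    using sum.reindex_bij_betw[OF e, of h] by (simp add: lessThan_atLeast0)
  have inv: "inv_into {0..<r} e (e i) = i" if "i < r" for i
    using e that by (intro inv_into_f_f) (auto simp: bij_betw_def)
  have "mdet r (\<lambda>i. f (e i)) = 0 \<longleftrightarrow> Determinant.det ?B = 0"
    using mdet_transpose[of r "\<lambda>i. f (e i)"] by simp
  also have "\<dots> \<longleftrightarrow> (\<exists>v. v \<in> carrier_vec r \<and> v \<noteq> 0\<^sub>v r \<and> ?B *\<^sub>v v = 0\<^sub>v r)"
    by (rule det_0_iff_vec_prod_zero_field) simp
  also have "\<dots> \<longleftrightarrow> (\<exists>z. (\<forall>j<r. (\<Sum>i\<in>S. z i * f i j) = 0) \<and> (\<exists>i\<in>S. z i \<noteq> 0))"
  proof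
    assume "\<exists>v. v \<in> carrier_vec r \<and> v \<noteq> 0\<^sub>v r \<and> ?B *\<^sub>v v = 0\<^sub>v r"
    then obtain v where v: "v \<in> carrier_vec r" "v \<noteq> 0\<^sub>v r" "?B *\<^sub>v v = 0\<^sub>v r" by blast
    define z where "z i = v $ inv_into {0..<r} e i" for i
    have z: "z (e i) = v $ i" if "i < r" for i using that by (simp add: z_def inv)
    have "(\<Sum>i\<in>S. z i * f i j) = 0" if "j < r" for j
      using prod[OF that v(1)] v(3) that by (simp add: reindex z)
    moreover obtain i where "i < r" "v $ i \<noteq> 0"
      using v(1,2) by (metis carrier_vecD eq_vecI index_zero_vec(1) index_zero_vec(2))
    moreover have "e i \<in> S" if "i < r" for i using e that by (auto simp: bij_betw_def)
    ultimately show "\<exists>z. (\<forall>j<r. (\<Sum>i\<in>S. z i * f i j) = 0) \<and> (\<exists>i\<in>S. z i \<noteq> 0)"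
      using z by (intro exI[of _ z]) force
  next
    assume "\<exists>z. (\<forall>j<r. (\<Sum>i\<in>S. z i * f i j) = 0) \<and> (\<exists>i\<in>S. z i \<noteq> 0)"
    then obtain z i where z: "\<forall>j<r. (\<Sum>i\<in>S. z i * f i j) = 0" "i \<in> S" "z i \<noteq> 0" by blast
    define v where "v = Matrix.vec r (\<lambda>i. z (e i))"
    have "?B *\<^sub>v v = 0\<^sub>v r"
    proof (rule eq_vecI)
      fix j assume "j < dim_vec (0\<^sub>v r :: 'a Matrix.vec)"
      then have j: "j < r" by simp
      have "(?B *\<^sub>v v) $ j = (\<Sum>i<r. v $ i * f (e i) j)"
        by (rule prod[OF j]) (simp add: v_def)
      also have "\<dots> = 0" using z(1) j by (simp add: v_def reindex)
      finally show "(?B *\<^sub>v v) $ j = 0\<^sub>v r $ j" using j by simp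
    qed simp
    moreover have "v \<noteq> 0\<^sub>v r"
    proof
      assume "v = 0\<^sub>v r"
      obtain l where "l < r" "i = e l" using z(2) e by (auto simp: bij_betw_def)
      then have "v $ l = z i" by (simp add: v_def)
      with \<open>v = 0\<^sub>v r\<close> \<open>l < r\<close> z(3) show False by simp
    qed
    ultimately show "\<exists>v. v \<in> carrier_vec r \<and> v \<noteq> 0\<^sub>v r \<and> ?B *\<^sub>v v = 0\<^sub>v r"
      by (intro exI[of _ v]) (simp add: v_def)
  qed
  finally show ?thesis by blast
qed

section \<open>Bases of a matroid and the weighted Gram matrix\<close>

context matroid
begin

lemma finite_indep: "X \<in> \<I> \<Longrightarrow> finite X"
  using indep_subset_ground finite_ground finite_subset by blast

text \<open>By augmentation no independent set is larger than a basis. Hence bases are equicardinal,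
  and an independent set of that size is maximal.\<close>

lemma bases_eq_card:
  assumes B: "B \<in> bases \<I>"
  shows "bases \<I> = {S \<in> \<I>. card S = card B}"
proof -
  have max: "card T \<le> card S" if "S \<in> bases \<I>" "T \<in> \<I>" for S T
    using that indep_augment[of S T] by (force simp: bases_def)
  have "S \<in> bases \<I>" if "S \<in> \<I>" "card S = card B" for S
  proof -
    have "S = T" if "T \<in> \<I>" "S \<subseteq> T" for T
    proof (rule card_seteq)
      show "card T \<le> card S" using max[OF B \<open>T \<in> \<I>\<close>] \<open>card S = card B\<close> by simp
    qed (use that finite_indep in auto)
    with that show ?thesis by (simp add: bases_def)
  qed
  moreover have "card S = card B" if "S \<in> bases \<I>" for S
  proof (rule antisym)
    show "card S \<le> card B" by (rule max[OF B]) (use that in \<open>simp add: bases_def\<close>)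
    show "card B \<le> card S" by (rule max[OF that]) (use B in \<open>simp add: bases_def\<close>)
  qed
  ultimately show ?thesis by (auto simp: bases_def)
qed

lemma bases_nonempty: "bases \<I> \<noteq> {}"
proof -
  have "finite \<I>" using finite_ground indep_subset_ground
    by (meson Pow_iff finite_Pow_iff finite_subset subsetI)
  then obtain B where "B \<in> \<I>" "\<And>T. T \<in> \<I> \<Longrightarrow> B \<subseteq> T \<Longrightarrow> B = T"
    using finite_has_maximal[of \<I>] indep_empty by auto
  then show ?thesis by (auto simp: bases_def)
qed

end

text \<open>This is A^T W A, with the rows of A numbered from 1 and its columns from 0.\<close>

definition gram :: "nat \<Rightarrow> (nat \<Rightarrow> nat \<Rightarrow> 'a::comm_ring_1) \<Rightarrow> (nat \<Rightarrow> 'a) \<Rightarrow> nat \<Rightarrow> nat \<Rightarrow> 'a" where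
  "gram m a w j l = (\<Sum>i=1..m. w i * a i j * a i l)"

text \<open>The quadratic form of A^T W A at x is the sum of \<open>w i\<close> times the square of
  entry i of A x. It vanishes only if A x = 0, and then the nonsingular rows \<open>e i\<close>
  force x = 0.\<close>

lemma gram_pivots_pos:
  fixes a :: "nat \<Rightarrow> nat \<Rightarrow> 'a::linordered_field"
  assumes e: "\<And>i. i < r \<Longrightarrow> e i \<in> {1..m}" and det: "mdet r (\<lambda>i. a (e i)) \<noteq> 0"
    and w: "\<And>i. i \<in> {1..m} \<Longrightarrow> w i > 0" and k: "k < r"
  shows "elim (gram m a w) k k k > 0"
proof (rule elim_pivots_pos[OF _ k])
  fix x :: "nat \<Rightarrow> 'a" assume x: "\<exists>i<r. x i \<noteq> 0"
  let ?s = "\<lambda>i. \<Sum>j<r. x j * a i j"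
  have "(\<Sum>j<r. \<Sum>l<r. x j * gram m a w j l * x l) =
      (\<Sum>j<r. \<Sum>l<r. \<Sum>i=1..m. w i * ((x j * a i j) * (x l * a i l)))"
    unfolding gram_def sum_distrib_left sum_distrib_right
    by (intro sum.cong refl) (simp add: mult_ac)
  also have "\<dots> = (\<Sum>j<r. \<Sum>i=1..m. \<Sum>l<r. w i * ((x j * a i j) * (x l * a i l)))"
    by (rule sum.cong[OF refl], rule sum.swap)
  also have "\<dots> = (\<Sum>i=1..m. \<Sum>j<r. \<Sum>l<r. w i * ((x j * a i j) * (x l * a i l)))"
    by (rule sum.swap)
  also have "\<dots> = (\<Sum>i=1..m. w i * (?s i)\<^sup>2)"
    unfolding power2_eq_square sum_product by (simp only: sum_distrib_left)
  also have "\<dots> > 0"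
  proof (rule ccontr)
    assume "\<not> (\<Sum>i=1..m. w i * (?s i)\<^sup>2) > 0"
    moreover have nn: "w i * (?s i)\<^sup>2 \<ge> 0" if "i \<in> {1..m}" for i
      using w[OF that] by simp
    then have "(\<Sum>i=1..m. w i * (?s i)\<^sup>2) \<ge> 0" by (rule sum_nonneg)
    ultimately have "(\<Sum>i=1..m. w i * (?s i)\<^sup>2) = 0" by simp
    then have "\<forall>i\<in>{1..m}. w i * (?s i)\<^sup>2 = 0"
      using nn by (subst (asm) sum_nonneg_eq_0_iff) auto
    then have "w i * (?s i)\<^sup>2 = 0" if "i \<in> {1..m}" for i using that by blast
    then have s0: "?s i = 0" if "i \<in> {1..m}" for i
      using w[OF that] that by (metis less_irrefl mult_eq_0_iff power_eq_0_iff)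
    have "mdet r (\<lambda>i j. a (e j) (id i)) \<noteq> 0"
      unfolding id_apply by (subst mdet_transpose[of r "\<lambda>i. a (e i)"]) (rule det)
    then have "\<forall>z. (\<forall>j<r. (\<Sum>i\<in>{0..<r}. z i * a (e j) i) = 0) \<longrightarrow> (\<forall>i\<in>{0..<r}. z i = 0)"
      by (rule mdet_nonzero_iff[of id r "{0..<r}" "\<lambda>i j. a (e j) i", OF bij_betw_id, THEN iffD1])
    then have "(\<forall>j<r. (\<Sum>i\<in>{0..<r}. x i * a (e j) i) = 0) \<longrightarrow> (\<forall>i\<in>{0..<r}. x i = 0)"
      by (rule spec)
    moreover have "(\<Sum>i\<in>{0..<r}. x i * a (e j) i) = 0" if "j < r" for j
      using s0[OF e[OF that]] by (simp add: lessThan_atLeast0)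
    ultimately have "\<forall>i\<in>{0..<r}. x i = 0" by blast
    with x show False by auto
  qed
  finally show "0 < (\<Sum>j<r. \<Sum>l<r. x j * gram m a w j l * x l)" .
qed

lemma of_rat_mdet: "of_rat (mdet r f) = mdet r (\<lambda>i j. of_rat (f i j))"
  unfolding mdet_eq by (simp add: of_rat_sum of_rat_prod of_rat_mult)

text \<open>All that the programs need to know about the matroid. r is the rank, and the columns of
  a are r columns on which one basis S0 has a nonzero minor. An r-set is a basis iff its minor on
  these columns is nonzero; by total unimodularity the square of the minor is then exactly 1, so
  that every basis enters Cauchy-Binet with coefficient 1.\<close>

theorem regular_matroid_representation:
  assumes "regular_matroid m \<I>"
  obtains r and a :: "nat \<Rightarrow> nat \<Rightarrow> rat" where
    "r \<le> m" "\<And>i j. a i j \<in> {-1, 0, 1}"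
    "\<And>w k. (\<And>i. i \<in> {1..m} \<Longrightarrow> w i > 0) \<Longrightarrow> k < r \<Longrightarrow> elim (gram m a w) k k k \<noteq> 0"
    "\<And>w. (\<And>i. i \<in> {1..m} \<Longrightarrow> w i > 0) \<Longrightarrow>
      (\<Prod>k<r. elim (gram m a w) k k k) = (\<Sum>S\<in>bases \<I>. \<Prod>i\<in>S. w i)"
proof -
  interpret matroid "{1..m}" \<I> using assms by (simp add: regular_matroid_def)
  obtain A where A: "dim_row A = m" "totally_unimodular A"
    and ind: "\<And>S. S \<subseteq> {1..m} \<Longrightarrow> S \<in> \<I> \<longleftrightarrow> rows_independent A S"
    using assms by (auto simp: regular_matroid_def)
  let ?n = "dim_col A"
  have ind: "S \<in> \<I> \<longleftrightarrow>
      (\<forall>y. (\<forall>j<?n. (\<Sum>i\<in>S. y i * A $$ (i - 1, j)) = 0) \<longrightarrow> (\<forall>i\<in>S. y i = 0))"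
    if "S \<subseteq> {1..m}" for S
    unfolding ind[OF that] using that finite_subset by (intro rows_independent_iff) blast
  obtain S0 where S0: "S0 \<in> bases \<I>" using bases_nonempty by blast
  define r where "r = card S0"
  have S0I: "S0 \<in> \<I>" and S0m: "S0 \<subseteq> {1..m}" and finS0: "finite S0"
    using S0 indep_subset_ground finite_indep by (auto simp: bases_def)
  have bases: "bases \<I> = {S \<in> \<I>. card S = r}"
    unfolding r_def by (rule bases_eq_card[OF S0])
  define en where "en S = (SOME e. bij_betw e {0..<r} S)" for S :: "nat set"
  have en: "bij_betw (en S) {0..<r} S" if "S \<subseteq> {1..m}" "card S = r" for S
  proof -
    have "finite S" using that(1) by (rule finite_subset) simp
    then show ?thesis
      unfolding en_def that(2)[symmetric] by (rule someI_ex[OF ex_bij_betw_nat_finite])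
  qed
  have en0: "bij_betw (en S0) {0..<r} S0" by (rule en[OF S0m]) (simp add: r_def)
  have en_mem: "en S i \<in> S" if "S \<subseteq> {1..m}" "card S = r" "i < r" for S i
    using en[OF that(1,2)] that(3) by (auto simp: bij_betw_def)
  have "\<exists>g. (\<forall>j<r. g j < ?n) \<and> mdet r (\<lambda>i j. A $$ (en S0 i - 1, g j)) \<noteq> 0"
  proof (rule independent_rows_minor)
    fix y :: "nat \<Rightarrow> real" assume y: "\<forall>j<?n. (\<Sum>i<r. y i * A $$ (en S0 i - 1, j)) = 0"
    let ?y = "\<lambda>s. y (inv_into {0..<r} (en S0) s)"
    have inv: "?y (en S0 i) = y i" if "i < r" for i
      using en0 that by (subst inv_into_f_f) (auto simp: bij_betw_def)
    have eq: "(\<Sum>s\<in>S0. ?y s * A $$ (s - 1, j)) = (\<Sum>i<r. y i * A $$ (en S0 i - 1, j))" for j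
      using sum.reindex_bij_betw[OF en0, of "\<lambda>s. ?y s * A $$ (s - 1, j)", symmetric]
      by (simp add: lessThan_atLeast0 inv)
    have "\<forall>s\<in>S0. ?y s = 0"
      by (rule S0I[unfolded ind[OF S0m], THEN spec, THEN mp]) (use y in \<open>simp only: eq\<close>)
    moreover have "en S0 i \<in> S0" if "i < r" for i
      by (rule en_mem[OF S0m _ that]) (simp add: r_def)
    ultimately show "\<forall>i<r. y i = 0" using inv by force
  qed
  then obtain g where g: "\<And>j. j < r \<Longrightarrow> g j < ?n"
    and det0: "mdet r (\<lambda>i j. A $$ (en S0 i - 1, g j)) \<noteq> 0" by blast
  \<comment> \<open>A repeated column would make the nonzero minor vanish; injectivity is needed to
    apply total unimodularity to the selected columns.\<close>
  have ginj: "inj_on g {0..<r}"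
  proof (rule inj_onI, rule ccontr)
    fix i j assume ij: "i \<in> {0..<r}" "j \<in> {0..<r}" "g i = g j" "i \<noteq> j"
    have "mdet r (\<lambda>i j. A $$ (en S0 j - 1, g i)) = 0"
      by (rule mdet_identical_rows[of i _ j]) (use ij in auto)
    then show False using det0 mdet_transpose[of r "\<lambda>i j. A $$ (en S0 i - 1, g j)"] by simp
  qed
  have TU: "mdet r (\<lambda>i j. A $$ (en S i - 1, g j)) \<in> {-1, 0, 1}"
    if S: "S \<subseteq> {1..m}" "card S = r" for S
  proof (rule totally_unimodular_det[OF A(2) _ _ ginj g])
    show "inj_on (\<lambda>i. en S i - 1) {0..<r}"
    proof (rule inj_onI)
      fix i j assume ij: "i \<in> {0..<r}" "j \<in> {0..<r}" "en S i - 1 = en S j - 1"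
      have "en S i \<in> S" "en S j \<in> S" using en_mem[OF S] ij(1,2) by simp_all
      then have "en S i \<in> {1..m}" "en S j \<in> {1..m}" using S(1) by blast+
      then have "en S i = en S j" using ij by auto
      then show "i = j" using en[OF S] ij by (auto simp: bij_betw_def dest: inj_onD)
    qed
    show "en S i - 1 < dim_row A" if "i < r" for i
      using en_mem[OF S that] S A by force
  qed
  \<comment> \<open>S0 is maximal, so adding i produces a relation; the coefficient of i is nonzero
    because S0 is independent, and the relation can be solved for row i.\<close>
  have span: "\<exists>N. \<forall>j<?n. A $$ (i - 1, j) = (\<Sum>s\<in>S0. N s * A $$ (s - 1, j))"
    if i: "i \<in> {1..m}" for i
  proof (cases "i \<in> S0")
    case True
    have "(\<Sum>s\<in>S0. (if s = i then 1 else 0) * A $$ (s - 1, j)) =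
        (\<Sum>s\<in>S0. if s = i then A $$ (s - 1, j) else 0)" for j
      by (intro sum.cong) auto
    then show ?thesis using True finS0
      by (intro exI[of _ "\<lambda>s. if s = i then 1 else 0"]) (simp add: sum.delta)
  next
    case False
    have "insert i S0 \<notin> \<I>" using S0 False unfolding bases_def by blast
    moreover have "insert i S0 \<subseteq> {1..m}" using S0m i by blast
    ultimately obtain y where y: "\<forall>j<?n. (\<Sum>s\<in>insert i S0. y s * A $$ (s - 1, j)) = 0"
      "\<exists>s\<in>insert i S0. y s \<noteq> 0"
      by (simp only: ind) blast
    have eq: "y i * A $$ (i - 1, j) + (\<Sum>s\<in>S0. y s * A $$ (s - 1, j)) = 0" if "j < ?n" for j
      using y(1) that False finS0 by simp
    have "y i \<noteq> 0"
    proof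
      assume "y i = 0"
      then have "\<forall>s\<in>S0. y s = 0" using S0I[unfolded ind[OF S0m]] eq by simp
      with \<open>y i = 0\<close> y(2) show False by simp
    qed
    have "A $$ (i - 1, j) = (\<Sum>s\<in>S0. - y s / y i * A $$ (s - 1, j))" if "j < ?n" for j
    proof -
      have "(\<Sum>s\<in>S0. - y s / y i * A $$ (s - 1, j)) = - (\<Sum>s\<in>S0. y s * A $$ (s - 1, j)) / y i"
        by (simp add: sum_divide_distrib sum_negf)
      also have "\<dots> = A $$ (i - 1, j)" using eq[OF that] \<open>y i \<noteq> 0\<close> by (simp add: field_simps)
      finally show ?thesis by simp
    qed
    then show ?thesis by (intro exI[of _ "\<lambda>s. - y s / y i"] allI impI)
  qed
  then have "\<forall>i\<in>{1..m}. \<exists>N. \<forall>j<?n. A $$ (i - 1, j) = (\<Sum>s\<in>S0. N s * A $$ (s - 1, j))"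
    by (rule ballI)
  from bchoice[OF this] obtain N where N: "\<forall>i\<in>{1..m}. \<forall>j<?n.
      A $$ (i - 1, j) = (\<Sum>s\<in>S0. N i s * A $$ (s - 1, j))" ..
  have N: "A $$ (i - 1, j) = (\<Sum>s\<in>S0. N i s * A $$ (s - 1, j))"
    if "i \<in> {1..m}" "j < ?n" for i j
    by (rule bspec[OF N that(1), THEN spec, THEN mp, OF that(2)])
  have basis_iff: "mdet r (\<lambda>i j. A $$ (en S i - 1, g j)) \<noteq> 0 \<longleftrightarrow> S \<in> bases \<I>"
    if S: "S \<subseteq> {1..m}" "card S = r" for S
  proof -
    note iff = mdet_nonzero_iff[of _ r _ "\<lambda>i j. A $$ (i - 1, g j)"]
    have "(\<forall>z. (\<forall>j<r. (\<Sum>i\<in>S. z i * A $$ (i - 1, g j)) = 0) \<longrightarrow> (\<forall>i\<in>S. z i = 0)) \<longleftrightarrow> S \<in> \<I>"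
    proof
      assume z: "\<forall>z. (\<forall>j<r. (\<Sum>i\<in>S. z i * A $$ (i - 1, g j)) = 0) \<longrightarrow> (\<forall>i\<in>S. z i = 0)"
      then show "S \<in> \<I>" unfolding ind[OF S(1)] using g by simp
    next
      assume "S \<in> \<I>"
      show "\<forall>z. (\<forall>j<r. (\<Sum>i\<in>S. z i * A $$ (i - 1, g j)) = 0) \<longrightarrow> (\<forall>i\<in>S. z i = 0)"
      proof (intro allI impI)
        fix z assume z: "\<forall>j<r. (\<Sum>i\<in>S. z i * A $$ (i - 1, g j)) = 0"
        \<comment> \<open>The coordinates of the combination with respect to the rows of S0. If it
          vanishes on the selected columns, the nonzero minor of S0 forces u = 0, so it vanishes on
          all columns and the independence of S applies.\<close>
        define u where "u s = (\<Sum>i\<in>S. z i * N i s)" for s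
        have u: "(\<Sum>i\<in>S. z i * A $$ (i - 1, j)) = (\<Sum>s\<in>S0. u s * A $$ (s - 1, j))"
          if "j < ?n" for j
        proof -
          have "(\<Sum>i\<in>S. z i * A $$ (i - 1, j)) = (\<Sum>i\<in>S. \<Sum>s\<in>S0. z i * N i s * A $$ (s - 1, j))"
            using S(1) by (intro sum.cong refl, subst N) (use that in \<open>auto simp: sum_distrib_left mult.assoc\<close>)
          also have "\<dots> = (\<Sum>s\<in>S0. u s * A $$ (s - 1, j))"
            unfolding u_def sum_distrib_right by (rule sum.swap)
          finally show ?thesis .
        qed
        have "\<forall>j<r. (\<Sum>s\<in>S0. u s * A $$ (s - 1, g j)) = 0" using z u g by simp
        then have "\<forall>s\<in>S0. u s = 0" by (rule iff[OF en0, THEN iffD1, OF det0, THEN spec, THEN mp])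
        then have "\<forall>j<?n. (\<Sum>i\<in>S. z i * A $$ (i - 1, j)) = 0" using u by simp
        then show "\<forall>i\<in>S. z i = 0" by (rule \<open>S \<in> \<I>\<close>[unfolded ind[OF S(1)], THEN spec, THEN mp])
      qed
    qed
    then show ?thesis unfolding iff[OF en[OF S]] bases using S by auto
  qed
  \<comment> \<open>The rational copy. Mapping every other value to 0 keeps the entries in {-1, 0,
    1} also for indices out of range.\<close>
  define a where "a i j = (if A $$ (i - 1, g j) = 1 then 1 else
    if A $$ (i - 1, g j) = -1 then -1 else (0::rat))" for i j
  have a: "of_rat (a i j) = A $$ (i - 1, g j)" if "i \<in> {1..m}" "j < r" for i j
  proof -
    \<comment> \<open>An entry is a minor of size 1.\<close>
    have "mdet 1 (\<lambda>i' j'. A $$ (i - 1, g j)) \<in> {-1, 0, 1}"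
      by (rule totally_unimodular_det[OF A(2), of "\<lambda>_. i - 1" 1 "\<lambda>_. g j"])
        (use that A g in auto)
    then have "A $$ (i - 1, g j) \<in> {-1, 0, 1}" by (simp add: mdet_eq)
    then show ?thesis by (auto simp: a_def)
  qed
  have det_a: "of_rat (mdet r (\<lambda>i. a (en S i))) = mdet r (\<lambda>i j. A $$ (en S i - 1, g j))"
    if S: "S \<subseteq> {1..m}" "card S = r" for S
    unfolding of_rat_mdet by (rule mdet_cong, rule a[OF subsetD[OF S(1) en_mem[OF S]]])
  have sq: "(mdet r (\<lambda>i. a (en S i)))\<^sup>2 = (if S \<in> bases \<I> then 1 else 0)"
    if S: "S \<subseteq> {1..m}" "card S = r" for S
  proof -
    define d where "d = mdet r (\<lambda>i j. A $$ (en S i - 1, g j))"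
    have "d = -1 \<or> d = 0 \<or> d = 1" using TU[OF S] by (simp add: d_def)
    moreover have "d \<noteq> 0 \<longleftrightarrow> S \<in> bases \<I>" unfolding d_def by (rule basis_iff[OF S])
    moreover have "of_rat ((mdet r (\<lambda>i. a (en S i)))\<^sup>2) = d\<^sup>2"
      unfolding d_def by (simp only: of_rat_power det_a[OF S])
    ultimately have "of_rat ((mdet r (\<lambda>i. a (en S i)))\<^sup>2) =
        (of_rat (if S \<in> bases \<I> then 1 else 0) :: real)" by auto
    then show ?thesis by (simp only: of_rat_eq_iff)
  qed
  have pos: "elim (gram m a w) k k k > 0" if "\<And>i. i \<in> {1..m} \<Longrightarrow> w i > 0" "k < r" for w k
  proof (rule gram_pivots_pos[of r "en S0"])
    show "en S0 i \<in> {1..m}" if "i < r" for i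
      using en_mem[OF S0m _ that] S0m by (auto simp: r_def)
    have "of_rat (mdet r (\<lambda>i. a (en S0 i))) \<noteq> (0::real)"
      using det0 det_a[OF S0m] by (simp add: r_def)
    then show "mdet r (\<lambda>i. a (en S0 i)) \<noteq> 0" by simp
  qed (use that in auto)
  have main: "(\<Prod>k<r. elim (gram m a w) k k k) = (\<Sum>S\<in>bases \<I>. \<Prod>i\<in>S. w i)"
    if w: "\<And>i. i \<in> {1..m} \<Longrightarrow> w i > 0" for w
  proof -
    have "(\<Prod>k<r. elim (gram m a w) k k k) = mdet r (gram m a w)"
      by (rule mdet_elim[symmetric]) (use pos[OF w] in \<open>simp add: less_imp_neq[symmetric]\<close>)
    also have "\<dots> = (\<Sum>S | S \<subseteq> {1..m} \<and> card S = r. (\<Prod>i\<in>S. w i) * (mdet r (\<lambda>i. a (en S i)))\<^sup>2)"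
      unfolding gram_def by (rule Cauchy_Binet_weighted) (use en in auto)
    also have "\<dots> = (\<Sum>S\<in>bases \<I>. \<Prod>i\<in>S. w i)"
    proof (rule sum.mono_neutral_cong_right)
      show sub: "bases \<I> \<subseteq> {S. S \<subseteq> {1..m} \<and> card S = r}"
        unfolding bases using indep_subset_ground by blast
      show "(\<Prod>i\<in>S. w i) * (mdet r (\<lambda>i. a (en S i)))\<^sup>2 = (\<Prod>i\<in>S. w i)"
        if "S \<in> bases \<I>" for S
        using sq[of S] sub that by auto
    qed (simp_all add: sq)
    finally show ?thesis .
  qed
  show thesis
  proof (rule that)
    show "r \<le> m" using card_mono[OF _ S0m] by (simp add: r_def)
    show "a i j \<in> {-1, 0, 1}" for i j by (simp add: a_def)
    show "elim (gram m a w) k k k \<noteq> 0" if "\<And>i. i \<in> {1..m} \<Longrightarrow> w i > 0" "k < r" for w k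
      by (rule pos[OF that, THEN less_imp_neq, THEN not_sym])
  qed (rule main)
qed

section \<open>Deterministic programs with a time bound\<close>

text \<open>The time is an upper bound and not exact, so that branches of different length share one
  bound and loops can be charged uniformly.\<close>

definition run :: "com \<Rightarrow> state \<Rightarrow> state \<Rightarrow> nat \<Rightarrow> bool" where
  "run P s s' T \<longleftrightarrow> (\<exists>t\<le>T. exec P s (return_pmf (s', t)))"

lemma tick_return: "tick k (return_pmf (s, t)) = return_pmf (s, k + t)"
  by (simp add: tick_def)

lemma run_mono: "run P s s' T \<Longrightarrow> T \<le> T' \<Longrightarrow> run P s s' T'"
  by (meson order_trans run_def)

lemma run_Skip: "run Skip s s 1"
  using exec.Skip by (auto simp: run_def)

lemma run_Assign:
  assumes "alegal i s" "aval i s = of_nat k" "alegal e s"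
  shows "run (Assign a i e) s (update s a k (aval e s)) (asize i + asize e + 1)"
  using exec.Assign[of i s e a] assms by (auto simp: run_def)

lemma run_Seq:
  assumes "run c s s1 T" "run d s1 s2 T'"
  shows "run (Seq c d) s s2 (T + T' + 1)"
proof -
  obtain t t' where t: "t \<le> T" "exec c s (return_pmf (s1, t))"
    and t': "t' \<le> T'" "exec d s1 (return_pmf (s2, t'))"
    using assms by (auto simp: run_def)
  have "exec (Seq c d) s
      (bind_pmf (return_pmf (s1, t)) (\<lambda>(s', t). tick (t + 1) (return_pmf (s2, t'))))"
    by (rule exec.Seq[OF t(2)]) (use t' in auto)
  then have "exec (Seq c d) s (return_pmf (s2, t + 1 + t'))"
    by (simp add: bind_return_pmf tick_return)
  then show ?thesis unfolding run_def using t t' by (intro exI[of _ "t + 1 + t'"]) auto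
qed

lemma run_Cond:
  assumes "blegal b s" "bval b s \<Longrightarrow> run c s s' T" "\<not> bval b s \<Longrightarrow> run d s s' T"
  shows "run (Cond b c d) s s' (bsize b + 1 + T)"
proof (cases "bval b s")
  case True
  then obtain t where "t \<le> T" "exec c s (return_pmf (s', t))"
    using assms by (auto simp: run_def)
  then show ?thesis using exec.CondTrue[of b s c "return_pmf (s', t)" d] assms(1) True
    unfolding run_def tick_return by (intro exI[of _ "bsize b + 1 + t"]) auto
next
  case False
  then obtain t where "t \<le> T" "exec d s (return_pmf (s', t))"
    using assms by (auto simp: run_def)
  then show ?thesis using exec.CondFalse[of b s d "return_pmf (s', t)" c] assms(1) False
    unfolding run_def tick_return by (intro exI[of _ "bsize b + 1 + t"]) auto
qed

lemma run_While_step: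
  assumes "blegal b s" "bval b s" "run c s s1 T" "run (While b c) s1 s2 T'"
  shows "run (While b c) s s2 (T + bsize b + 2 + T')"
proof -
  obtain t where "t \<le> T + T' + 1" "exec (Seq c (While b c)) s (return_pmf (s2, t))"
    using run_Seq[OF assms(3,4)] by (auto simp: run_def)
  then show ?thesis using exec.WhileTrue[of b s c "return_pmf (s2, t)"] assms(1,2)
    unfolding run_def tick_return by (intro exI[of _ "bsize b + 1 + t"]) auto
qed

text \<open>The number n of iterations is known beforehand and indexes the invariant, so
  termination, correctness and time follow from one induction. The 2 in the time pays for the
  \<open>While\<close> and for the \<open>Seq\<close> that one unrolling creates.\<close>

lemma run_While:
  assumes step: "\<And>k s. k < n \<Longrightarrow> I k s \<Longrightarrow>
      blegal b s \<and> bval b s \<and> (\<exists>s'. run c s s' T \<and> I (Suc k) s')"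
    and exit: "\<And>s. I n s \<Longrightarrow> blegal b s \<and> \<not> bval b s"
    and init: "I 0 s" and time: "n * (T + bsize b + 2) + bsize b + 1 \<le> T'"
  shows "\<exists>s'. run (While b c) s s' T' \<and> I n s'"
proof -
  have "\<exists>s'. run (While b c) s s' ((n - k) * (T + bsize b + 2) + bsize b + 1) \<and> I n s'"
    if "k \<le> n" "I k s" for k s
    using that
  proof (induction "n - k" arbitrary: k s)
    case 0
    then have "I n s" by simp
    then show ?case using exit[of s] exec.WhileFalse[of b s c] 0
      by (auto simp: run_def intro!: exI[of _ s])
  next
    case (Suc d)
    then have k: "k < n" by simp
    obtain s1 where s1: "blegal b s" "bval b s" "run c s s1 T" "I (Suc k) s1"
      using step[OF k Suc.prems(2)] by blast
    obtain s2 where s2: "run (While b c) s1 s2 ((n - Suc k) * (T + bsize b + 2) + bsize b + 1)" "I n s2"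
      using Suc.hyps(1)[OF _ Suc_leI[OF k] s1(4)] Suc.hyps(2) by fastforce
    have "run (While b c) s s2 (T + bsize b + 2 + ((n - Suc k) * (T + bsize b + 2) + bsize b + 1))"
      by (rule run_While_step[OF s1(1-3) s2(1)])
    moreover have "n - k = Suc (n - Suc k)" using k by simp
    then have "T + bsize b + 2 + ((n - Suc k) * (T + bsize b + 2) + bsize b + 1) =
        (n - k) * (T + bsize b + 2) + bsize b + 1" by simp
    ultimately show ?case using s2(2) by metis
  qed
  from this[of 0 s] init show ?thesis using run_mono[OF _ time] by auto
qed

lemma run_SeqI:
  assumes "run c s s1 T" "run d s1 s2 T'" "T + T' + 1 \<le> T''"
  shows "run (Seq c d) s s2 T''"
  using run_mono[OF run_Seq[OF assms(1,2)] assms(3)] .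

section \<open>Unrolled programs and constant expressions\<close>

primrec seqs :: "com list \<Rightarrow> com" where
  "seqs [] = Skip"
| "seqs (c # cs) = Seq c (seqs cs)"

lemma run_seqs:
  assumes step: "\<And>k s. k < length cs \<Longrightarrow> I k s \<Longrightarrow> \<exists>s'. run (cs ! k) s s' T \<and> I (Suc k) s'"
    and init: "I 0 s" and time: "length cs * (T + 1) + 1 \<le> T'"
  shows "\<exists>s'. run (seqs cs) s s' T' \<and> I (length cs) s'"
proof -
  have "\<exists>s'. run (seqs cs) s s' (length cs * (T + 1) + 1) \<and> I (length cs) s'"
    using step init
  proof (induction cs arbitrary: I s)
    case Nil
    then show ?case using run_Skip by auto
  next
    case (Cons c cs)
    obtain s1 where s1: "run c s s1 T" "I 1 s1" using Cons.prems(1)[of 0 s] Cons.prems(2) by auto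
    have "\<exists>s'. run (seqs cs) s1 s' (length cs * (T + 1) + 1) \<and> (\<lambda>k. I (Suc k)) (length cs) s'"
    proof (rule Cons.IH)
      fix k s assume "k < length cs" "I (Suc k) s"
      then show "\<exists>s'. run (cs ! k) s s' T \<and> I (Suc (Suc k)) s'" using Cons.prems(1)[of "Suc k" s] by simp
    qed (use s1 in simp)
    then obtain s2 where s2: "run (seqs cs) s1 s2 (length cs * (T + 1) + 1)" "I (length (c # cs)) s2"
      by auto
    have "run (seqs (c # cs)) s s2 (length (c # cs) * (T + 1) + 1)"
      using run_Seq[OF s1(1) s2(1)] by (auto elim: run_mono)
    with s2(2) show ?case by blast
  qed
  then show ?thesis using run_mono[OF _ time] by blast
qed

lemma csize_seqs:
  assumes "\<And>c. c \<in> set cs \<Longrightarrow> csize c \<le> K"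
  shows "csize (seqs cs) \<le> length cs * (K + 1) + 1"
  using assms by (induction cs) (force simp: add_mono)+

text \<open>Unary constants are long, but they serve only as array indices, which are bounded by a
  polynomial in m.\<close>

primrec num :: "nat \<Rightarrow> aexp" where
  "num 0 = Zero"
| "num (Suc n) = Add (num n) One"

lemma num [simp]: "alegal (num n) s" "aval (num n) s = of_nat n" "asize (num n) = 2 * n + 1"
  by (induction n) auto

definition esum :: "aexp list \<Rightarrow> aexp" where "esum es = foldr Add es Zero"
definition eprod :: "aexp list \<Rightarrow> aexp" where "eprod es = foldr Mul es One"

lemma alegal_esum [simp]: "alegal (esum es) s \<longleftrightarrow> (\<forall>e\<in>set es. alegal e s)"
  by (induction es) (auto simp: esum_def)

lemma alegal_eprod [simp]: "alegal (eprod es) s \<longleftrightarrow> (\<forall>e\<in>set es. alegal e s)"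
  by (induction es) (auto simp: eprod_def)

lemma aval_esum [simp]: "aval (esum es) s = (\<Sum>e\<leftarrow>es. aval e s)"
  by (induction es) (auto simp: esum_def)

lemma aval_eprod [simp]: "aval (eprod es) s = (\<Prod>e\<leftarrow>es. aval e s)"
  by (induction es) (auto simp: eprod_def)

lemma asize_esum: "(\<And>e. e \<in> set es \<Longrightarrow> asize e \<le> K) \<Longrightarrow> asize (esum es) \<le> length es * (K + 1) + 1"
  by (induction es) (force simp: esum_def add_mono)+

lemma asize_eprod: "(\<And>e. e \<in> set es \<Longrightarrow> asize e \<le> K) \<Longrightarrow> asize (eprod es) \<le> length es * (K + 1) + 1"
  by (induction es) (force simp: eprod_def add_mono)+

abbreviation two :: aexp where "two \<equiv> Add One One"

primrec epow :: "nat \<Rightarrow> aexp" where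
  "epow 0 = One"
| "epow (Suc n) = Mul two (epow n)"

lemma epow [simp]: "alegal (epow n) s" "aval (epow n) s = 2 ^ n" "asize (epow n) = 4 * n + 1"
  by (induction n) auto

definition entry :: "rat \<Rightarrow> aexp" where
  "entry x = (if x = 0 then Zero else if x = 1 then One else Sub Zero One)"

lemma entry [simp]: "alegal (entry x) s" "x \<in> {-1, 0, 1} \<Longrightarrow> aval (entry x) s = x"
  and asize_entry: "asize (entry x) \<le> 3"
  by (auto simp: entry_def)

abbreviation var :: "name \<Rightarrow> aexp" where "var a \<equiv> Cell a Zero"

definition setv :: "name \<Rightarrow> aexp \<Rightarrow> com" where "setv a e = Assign a Zero e"

lemma run_setv:
  assumes "alegal e s" "aval e s = v" "asize e + 2 \<le> T"
  shows "run (setv a e) s (update s a 0 v) T"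
proof -
  have "run (setv a e) s (update s a 0 (aval e s)) (asize Zero + asize e + 1)"
    unfolding setv_def by (rule run_Assign) (use assms in auto)
  then show ?thesis using assms by (auto elim: run_mono)
qed

lemma csize_setv [simp]: "csize (setv a e) = asize e + 2"
  by (simp add: setv_def)

lemma update_apply [simp]:
  "update s a k v b = (if b = a then (s a)(k := v) else s b)"
  by (simp add: update_def)

text \<open>The frame condition, at the granularity of whole arrays: only arrays in W may have
  changed.\<close>

definition agree :: "name set \<Rightarrow> state \<Rightarrow> state \<Rightarrow> bool" where
  "agree W s s' \<longleftrightarrow> (\<forall>a. a \<notin> W \<longrightarrow> s' a = s a)"

lemma agreeD: "agree W s s' \<Longrightarrow> a \<notin> W \<Longrightarrow> s' a = s a"
  by (simp add: agree_def)

lemma agree_refl: "agree W s s"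
  by (simp add: agree_def)

definition assigns :: "name \<Rightarrow> 'x list \<Rightarrow> ('x \<Rightarrow> nat) \<Rightarrow> ('x \<Rightarrow> aexp) \<Rightarrow> com" where
  "assigns A xs idx e = seqs (map (\<lambda>x. Assign A (num (idx x)) (e x)) xs)"

text \<open>The expressions may read the array being written, as elimination does. Therefore
  \<open>e\<close> is required to be correct only in states where the cells outside the target
  indices are still the original ones.\<close>

lemma run_assigns:
  assumes inj: "inj_on idx (set xs)"
    and e: "\<And>x s'. x \<in> set xs \<Longrightarrow> agree {A} s s' \<Longrightarrow> \<forall>n. n \<notin> idx ` set xs \<longrightarrow> s' A n = s A n \<Longrightarrow>
      alegal (e x) s' \<and> aval (e x) s' = v x"
    and T: "\<And>x. x \<in> set xs \<Longrightarrow> 2 * idx x + asize (e x) + 2 \<le> T"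
    and time: "length xs * (T + 1) + 1 \<le> T'"
  shows "\<exists>s'. run (assigns A xs idx e) s s' T' \<and> agree {A} s s' \<and>
    (\<forall>n. n \<notin> idx ` set xs \<longrightarrow> s' A n = s A n) \<and> (\<forall>x\<in>set xs. s' A (idx x) = v x)"
proof -
  let ?cs = "map (\<lambda>x. Assign A (num (idx x)) (e x)) xs"
  let ?I = "\<lambda>k s'. agree {A} s s' \<and> (\<forall>n. n \<notin> idx ` set xs \<longrightarrow> s' A n = s A n) \<and>
    (\<forall>x\<in>set (take k xs). s' A (idx x) = v x)"
  have "\<exists>s'. run (seqs ?cs) s s' T' \<and> ?I (length ?cs) s'"
  proof (rule run_seqs[where I = ?I])
    fix k s1 assume k: "k < length ?cs" and I: "?I k s1"
    let ?x = "xs ! k"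
    have x: "?x \<in> set xs" using k by simp
    have ex: "alegal (e ?x) s1" "aval (e ?x) s1 = v ?x" using e[OF x] I by auto
    have "run (?cs ! k) s1 (update s1 A (idx ?x) (v ?x)) (asize (num (idx ?x)) + asize (e ?x) + 1)"
      using run_Assign[of "num (idx ?x)" s1 "idx ?x" "e ?x" A] ex k by simp
    then have "run (?cs ! k) s1 (update s1 A (idx ?x) (v ?x)) T"
      by (rule run_mono) (use T[OF x] in simp)
    moreover have "?I (Suc k) (update s1 A (idx ?x) (v ?x))"
    proof (intro conjI)
      show "agree {A} s (update s1 A (idx ?x) (v ?x))"
        using I by (simp add: agree_def)
      show "\<forall>n. n \<notin> idx ` set xs \<longrightarrow> update s1 A (idx ?x) (v ?x) A n = s A n"
        using I x by auto
      show "\<forall>x\<in>set (take (Suc k) xs). update s1 A (idx ?x) (v ?x) A (idx x) = v x"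
      proof
        fix x assume "x \<in> set (take (Suc k) xs)"
        then have "x = ?x \<or> x \<in> set (take k xs)" using k by (auto simp: take_Suc_conv_app_nth)
        moreover have "x \<in> set xs" using \<open>x \<in> set (take (Suc k) xs)\<close> by (rule in_set_takeD)
        ultimately show "update s1 A (idx ?x) (v ?x) A (idx x) = v x"
          using I x inj by (auto dest: inj_onD)
      qed
    qed
    ultimately show "\<exists>s'. run (?cs ! k) s1 s' T \<and> ?I (Suc k) s'" by blast
  qed (use time in \<open>simp_all add: agree_refl\<close>)
  then show ?thesis by (simp add: assigns_def)
qed

lemma csize_assigns:
  assumes "\<And>x. x \<in> set xs \<Longrightarrow> 2 * idx x + asize (e x) + 2 \<le> K"
  shows "csize (assigns A xs idx e) \<le> length xs * (K + 1) + 1"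
proof -
  have "csize (assigns A xs idx e) \<le> length (map (\<lambda>x. Assign A (num (idx x)) (e x)) xs) * (K + 1) + 1"
    unfolding assigns_def by (rule csize_seqs) (use assms in force)
  then show ?thesis by simp
qed

section \<open>Loops for powers and for reduction modulo a power of two\<close>

text \<open>Raises \<open>X\<close> to the value of e by repeated multiplication. A time linear in
  the exponent is affordable, because all exponents are bounded by a multiple of the sum of squared
  costs, plus 1.\<close>

definition pow_prog :: "aexp \<Rightarrow> com" where
  "pow_prog e = Seq (setv ''n'' e) (Seq (setv ''p'' One)
     (While (Less Zero (var ''n''))
       (Seq (setv ''p'' (Mul (var ''p'') (var ''X''))) (setv ''n'' (Sub (var ''n'') One)))))"

lemma run_pow_prog:
  assumes e: "alegal e s" "aval e s = of_nat n"
  shows "\<exists>s'. run (pow_prog e) s s' (asize e + 20 * n + 12) \<and> agree {''n'', ''p''} s s' \<and>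
    s' ''p'' 0 = s ''X'' 0 ^ n"
proof -
  let ?b = "Less Zero (var ''n'')"
  let ?c = "Seq (setv ''p'' (Mul (var ''p'') (var ''X''))) (setv ''n'' (Sub (var ''n'') One))"
  let ?s1 = "update s ''n'' 0 (of_nat n)"
  let ?s2 = "update ?s1 ''p'' 0 1"
  let ?I = "\<lambda>k s'. agree {''n'', ''p''} s s' \<and> s' ''n'' 0 = of_nat n - of_nat k \<and>
    s' ''p'' 0 = s ''X'' 0 ^ k"
  have r1: "run (setv ''n'' e) s ?s1 (asize e + 2)" by (rule run_setv) (simp_all add: e)
  have r2: "run (setv ''p'' One) ?s1 ?s2 3" by (rule run_setv) simp_all
  have "\<exists>s'. run (While ?b ?c) ?s2 s' (n * 20 + 5) \<and> ?I n s'"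
  proof (rule run_While[where I = ?I])
    fix k s' assume k: "k < n" and I: "?I k s'"
    let ?t1 = "update s' ''p'' 0 (s' ''p'' 0 * s' ''X'' 0)"
    let ?t2 = "update ?t1 ''n'' 0 (s' ''n'' 0 - 1)"
    have X: "s' ''X'' = s ''X''" using I by (auto intro: agreeD)
    have "run (setv ''p'' (Mul (var ''p'') (var ''X''))) s' ?t1 7"
      by (rule run_setv) simp_all
    moreover have "run (setv ''n'' (Sub (var ''n'') One)) ?t1 ?t2 6"
      by (rule run_setv) simp_all
    ultimately have "run ?c s' ?t2 14" by (rule run_SeqI) simp
    moreover have "?I (Suc k) ?t2" using I X by (auto simp: agree_def)
    ultimately show "blegal ?b s' \<and> bval ?b s' \<and> (\<exists>t. run ?c s' t 14 \<and> ?I (Suc k) t)"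
      using I k by auto
  qed (auto simp: agree_def)
  then obtain s' where s': "run (While ?b ?c) ?s2 s' (n * 20 + 5)" "?I n s'" by blast
  have "run (pow_prog e) s s' (asize e + 20 * n + 12)"
    unfolding pow_prog_def by (rule run_SeqI[OF r1 run_Seq[OF r2 s'(1)]]) simp
  with s'(2) show ?thesis by blast
qed

definition double_prog :: com where
  "double_prog = Seq (setv ''p'' One)
    (While (Neg (Less (var ''y'') (var ''p''))) (setv ''p'' (Add (var ''p'') (var ''p''))))"

lemma run_double_prog:
  assumes "s ''y'' 0 < 2 ^ L"
  shows "\<exists>s' n. n \<le> L \<and> run double_prog s s' (16 * L + 11) \<and> agree {''p''} s s' \<and>
    s' ''p'' 0 = 2 ^ n \<and> s ''y'' 0 < 2 ^ n"
proof -
  let ?b = "Neg (Less (var ''y'') (var ''p''))"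
  let ?c = "setv ''p'' (Add (var ''p'') (var ''p''))"
  let ?s1 = "update s ''p'' 0 1"
  \<comment> \<open>The exact number of doublings, as required by \<open>run_While\<close>; L serves
    only as a bound for the time.\<close>
  define n where "n = (LEAST n. s ''y'' 0 < 2 ^ n)"
  have n: "s ''y'' 0 < 2 ^ n" unfolding n_def by (rule LeastI[where k = L]) (rule assms)
  have nL: "n \<le> L" unfolding n_def by (rule Least_le) (rule assms)
  have less: "\<not> s ''y'' 0 < 2 ^ k" if "k < n" for k using that not_less_Least unfolding n_def by blast
  let ?I = "\<lambda>k s'. agree {''p''} s s' \<and> s' ''p'' 0 = 2 ^ k"
  have r1: "run (setv ''p'' One) s ?s1 3" by (rule run_setv) simp_all
  have "\<exists>s'. run (While ?b ?c) ?s1 s' (n * 15 + 7) \<and> ?I n s'"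
  proof (rule run_While[where I = ?I])
    fix k s' assume k: "k < n" and I: "?I k s'"
    have y: "s' ''y'' = s ''y''" using I by (auto intro: agreeD)
    have "run ?c s' (update s' ''p'' 0 (2 ^ Suc k)) 7"
      by (rule run_setv) (use I in simp_all)
    moreover have "?I (Suc k) (update s' ''p'' 0 (2 ^ Suc k))" using I by (auto simp: agree_def)
    ultimately show "blegal ?b s' \<and> bval ?b s' \<and> (\<exists>t. run ?c s' t 7 \<and> ?I (Suc k) t)"
      using I less[OF k] by (auto simp: y)
  next
    fix s' assume I: "?I n s'"
    then have "s' ''y'' = s ''y''" by (auto intro: agreeD)
    with I n show "blegal ?b s' \<and> \<not> bval ?b s'" by simp
  qed (auto simp: agree_def)
  then obtain s' where s': "run (While ?b ?c) ?s1 s' (n * 15 + 7)" "?I n s'" by blast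
  have "run double_prog s s' (16 * L + 11)"
    unfolding double_prog_def by (rule run_SeqI[OF r1 s'(1)]) (use nL in simp)
  with s'(2) n nL show ?thesis by blast
qed

definition reduce_prog :: "aexp \<Rightarrow> com" where
  "reduce_prog b = While (Neg (Less (var ''p'') b))
    (Seq (Cond (Less (var ''y'') (var ''p'')) Skip (setv ''y'' (Sub (var ''y'') (var ''p''))))
      (setv ''p'' (Div (var ''p'') two)))"

text \<open>The binary long division: p runs downwards through powers of 2 while y < 2p. Every power
  that is subtracted is at least 2^e, hence a multiple of it, so the final y is the remainder modulo
  2^e. With e = 0 this is the fractional part.\<close>

lemma run_reduce_prog:
  assumes b: "\<And>s'. agree {''p'', ''y''} s s' \<Longrightarrow> alegal b s' \<and> aval b s' = 2 ^ e"
    and p: "s ''p'' 0 = 2 ^ n" and y: "0 \<le> s ''y'' 0" "s ''y'' 0 < 2 * 2 ^ n"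
  shows "\<exists>s' j. run (reduce_prog b) s s' (Suc n * (asize b + 30) + asize b + 5) \<and>
    agree {''p'', ''y''} s s' \<and>
    s' ''y'' 0 = s ''y'' 0 - of_nat j * 2 ^ e \<and> 0 \<le> s' ''y'' 0 \<and> s' ''y'' 0 < 2 ^ e"
proof -
  let ?b = "Neg (Less (var ''p'') b)"
  let ?d = "Cond (Less (var ''y'') (var ''p'')) Skip (setv ''y'' (Sub (var ''y'') (var ''p'')))"
  let ?c = "Seq ?d (setv ''p'' (Div (var ''p'') two))"
  let ?I = "\<lambda>k s'. agree {''p'', ''y''} s s' \<and> s' ''p'' 0 = 2 ^ n / 2 ^ k \<and>
    0 \<le> s' ''y'' 0 \<and> s' ''y'' 0 < 2 * s' ''p'' 0 \<and> (\<exists>j. s' ''y'' 0 = s ''y'' 0 - of_nat j * 2 ^ e)"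
  \<comment> \<open>p descends from 2^n to 2^(e-1), which is 1/2 for e = 0; hence the invariant
    divides by 2^k instead of lowering the exponent. If e > n, the truncated difference is 0 and the
    loop exits at once.\<close>
  define N where "N = Suc n - e"
  have final: "2 * s' ''p'' 0 \<le> 2 ^ e \<and> s' ''p'' 0 < 2 ^ e" if "s' ''p'' 0 = 2 ^ n / 2 ^ N"
    for s' :: state
  proof (cases "e \<le> n")
    case True
    then have "(2::rat) ^ N * 2 ^ e = 2 ^ Suc n" unfolding N_def power_add[symmetric] by simp
    then have "(2::rat) ^ n = 2 ^ N * (2 ^ e / 2)" by simp
    then have "s' ''p'' 0 = 2 ^ e / 2" unfolding that by simp
    moreover have "(0::rat) < 2 ^ e" by simp
    ultimately show ?thesis by linarith
  next
    case False
    then have "N = 0" by (simp add: N_def)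
    moreover have "(2::rat) ^ Suc n \<le> 2 ^ e" using False by (intro power_increasing) auto
    ultimately show ?thesis using that False by simp
  qed
  have "\<exists>s'. run (While ?b ?c) s s' (N * (24 + bsize ?b) + bsize ?b + 1) \<and> ?I N s'"
  proof (rule run_While[where I = ?I])
    fix k s' assume k: "k < N" and I: "?I k s'"
    let ?y = "if s' ''y'' 0 < s' ''p'' 0 then s' ''y'' 0 else s' ''y'' 0 - s' ''p'' 0"
    let ?t1 = "update s' ''y'' 0 ?y"
    let ?t2 = "update ?t1 ''p'' 0 (s' ''p'' 0 / 2)"
    have bs': "alegal b s'" "aval b s' = 2 ^ e" using b I by auto
    have "k + e \<le> n" using k by (simp add: N_def)
    then have "(2::rat) ^ n = 2 ^ (n - k - e) * 2 ^ e * 2 ^ k"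
      by (simp add: power_add[symmetric])
    then have p': "s' ''p'' 0 = 2 ^ (n - k - e) * 2 ^ e" using I by simp
    have "run ?d s' ?t1 (bsize (Less (var ''y'') (var ''p'')) + 1 + 7)"
    proof (rule run_Cond)
      assume "bval (Less (var ''y'') (var ''p'')) s'"
      then have "?t1 = s'" by (auto simp: update_def fun_eq_iff)
      then show "run Skip s' ?t1 7" using run_mono[OF run_Skip, of 7 s'] by simp
    next
      assume "\<not> bval (Less (var ''y'') (var ''p'')) s'"
      then show "run (setv ''y'' (Sub (var ''y'') (var ''p''))) s' ?t1 7"
        by (intro run_setv) simp_all
    qed simp
    moreover have "run (setv ''p'' (Div (var ''p'') two)) ?t1 ?t2 8"
      by (rule run_setv) simp_all
    ultimately have "run ?c s' ?t2 22" by (rule run_SeqI) simp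
    moreover have "?I (Suc k) ?t2"
    proof -
      obtain j where j: "s' ''y'' 0 = s ''y'' 0 - of_nat j * 2 ^ e" using I by auto
      have "?y = s ''y'' 0 - of_nat (if s' ''y'' 0 < s' ''p'' 0 then j else j + 2 ^ (n - k - e)) * 2 ^ e"
        unfolding j p' by (simp add: algebra_simps)
      then have "\<exists>j. ?y = s ''y'' 0 - of_nat j * 2 ^ e" by (rule exI)
      moreover have "0 \<le> ?y" "?y < s' ''p'' 0" using I by auto
      moreover have "agree {''p'', ''y''} s ?t2" using I by (auto simp: agree_def)
      ultimately show ?thesis using I by simp
    qed
    moreover have "blegal ?b s'" "bval ?b s'" using bs' by (simp_all add: p' not_less)
    ultimately show "blegal ?b s' \<and> bval ?b s' \<and> (\<exists>t. run ?c s' t 22 \<and> ?I (Suc k) t)"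
      by blast
  next
    fix s' assume I: "?I N s'"
    then have bs': "alegal b s'" "aval b s' = 2 ^ e" using b by auto
    have "s' ''p'' 0 < 2 ^ e" using final[of s'] I by simp
    with bs' show "blegal ?b s' \<and> \<not> bval ?b s'" by simp
  next
    show "?I 0 s" using p y by (auto simp: agree_refl intro: exI[of _ 0])
  qed simp
  then obtain s' where s': "run (While ?b ?c) s s' (N * (24 + bsize ?b) + bsize ?b + 1)" "?I N s'" by blast
  have "2 * s' ''p'' 0 \<le> 2 ^ e" using final[of s'] s'(2) by simp
  then have "s' ''y'' 0 < 2 ^ e" using s'(2) by simp
  moreover have "N * (24 + bsize ?b) + bsize ?b + 1 \<le> Suc n * (asize b + 30) + asize b + 5"
  proof -
    have "N * (24 + bsize ?b) \<le> Suc n * (asize b + 30)"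
      by (rule mult_le_mono) (auto simp: N_def)
    then show ?thesis by simp
  qed
  then have "run (reduce_prog b) s s' (Suc n * (asize b + 30) + asize b + 5)"
    unfolding reduce_prog_def by (rule run_mono[OF s'(1)])
  ultimately show ?thesis using s'(2) by blast
qed

section \<open>The generating function of the bases at a single point\<close>

text \<open>M + 1 is 1 modulo M, and so are its powers.\<close>

lemma Suc_power_mod: "\<exists>j::nat. (of_nat M + 1) ^ n = (1 + of_nat j * of_nat M :: rat)"
proof (induction n)
  case (Suc n)
  then obtain j where j: "(of_nat M + 1) ^ n = (1 + of_nat j * of_nat M :: rat)" by blast
  have "(of_nat M + 1) ^ Suc n = (1 + of_nat (j * M + j + 1) * of_nat M :: rat)"
    unfolding power_Suc j by (simp add: algebra_simps)
  then show ?case by (rule exI)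
qed (auto intro: exI[of _ 0])

text \<open>f S stands for the slack of S, the threshold minus its cost. Modulo M = 2^(m+1) the
  terms with nonnegative exponent add up to their number; the at most 2^m others, each at most 1/X,
  add up to some b in [0, 1). Hence the remainder y1 is this number plus b, and its fractional part
  y2 is b.\<close>

lemma power_sum_digits:
  fixes B :: "'b set" and f :: "'b \<Rightarrow> int" and y y1 y2 :: rat
  assumes B: "finite B" "card B \<le> 2 ^ m"
    and y: "y = (\<Sum>S\<in>B. (2 ^ Suc m + 1) powi f S)"
    and y1: "y1 = y - of_nat j * 2 ^ Suc m" "0 \<le> y1" "y1 < 2 ^ Suc m"
    and y2: "y2 = y1 - of_nat l" "0 \<le> y2" "y2 < 1"
  shows "y1 - y2 = of_nat (card {S \<in> B. f S \<ge> 0})"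
proof -
  let ?X = "2 ^ Suc m + 1 :: rat" and ?M = "2 ^ Suc m :: rat"
  let ?G = "{S \<in> B. f S \<ge> 0}" and ?H = "{S \<in> B. f S < 0}"
  define b where "b = (\<Sum>S\<in>?H. ?X powi f S)"
  have X1: "1 \<le> ?X" by simp
  have "\<exists>g. \<forall>S\<in>?G. ?X powi f S = 1 + of_nat (g S) * ?M"
  proof (rule bchoice, rule ballI)
    fix S assume "S \<in> ?G"
    then have "?X powi f S = ?X ^ nat (f S)" by (simp add: power_int_def)
    also obtain i where "\<dots> = 1 + of_nat i * ?M"
      using Suc_power_mod[of "2 ^ Suc m" "nat (f S)"] unfolding of_nat_power of_nat_numeral by blast
    finally show "\<exists>i. ?X powi f S = 1 + of_nat i * ?M" by blast
  qed
  then obtain g where g: "\<And>S. S \<in> ?G \<Longrightarrow> ?X powi f S = 1 + of_nat (g S) * ?M" by blast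
  define J where "J = (\<Sum>S\<in>?G. g S)"
  have "(\<Sum>S\<in>?G. ?X powi f S) = (\<Sum>S\<in>?G. 1 + of_nat (g S) * ?M)"
    by (rule sum.cong[OF refl g])
  also have "\<dots> = of_nat (card ?G) + of_nat J * ?M"
    by (simp add: J_def sum.distrib sum_distrib_right)
  finally have G: "(\<Sum>S\<in>?G. ?X powi f S) = of_nat (card ?G) + of_nat J * ?M" .
  have "y = (\<Sum>S\<in>?G \<union> ?H. ?X powi f S)"
    unfolding y by (rule sum.cong) auto
  also have "\<dots> = (\<Sum>S\<in>?G. ?X powi f S) + b"
    unfolding b_def by (rule sum.union_disjoint) (use B in auto)
  finally have yGb: "y = of_nat (card ?G) + of_nat J * ?M + b" by (simp only: G)
  have b0: "0 \<le> b" unfolding b_def by (rule sum_nonneg) (simp add: add_nonneg_pos)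
  have "b \<le> of_nat (card ?H) * inverse ?X"
    unfolding b_def
  proof (rule sum_bounded_above)
    fix S assume "S \<in> ?H"
    then have "?X powi f S \<le> ?X powi (-1)" by (intro power_int_increasing) auto
    then show "?X powi f S \<le> inverse ?X" by (simp add: power_int_minus)
  qed
  also have "\<dots> < 1"
  proof -
    have "card ?H \<le> card B" by (rule card_mono) (use B in auto)
    then have "of_nat (card ?H) \<le> (of_nat (2 ^ m) :: rat)" using B by (simp only: of_nat_le_iff)
    also have "\<dots> < ?X" by (simp add: add_strict_increasing2)
    finally show ?thesis using X1 by (simp add: field_simps)
  qed
  finally have b1: "b < 1" .
  have "card ?G \<le> card B" by (rule card_mono) (use B in auto)
  then have "of_nat (card ?G) \<le> (of_nat (2 ^ m) :: rat)" using B by (simp only: of_nat_le_iff)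
  moreover have "(1::rat) \<le> 2 ^ m" by simp
  \<comment> \<open>Here the exponent m + 1 matters: the number of terms is at most 2^m and b < 1,
    so both together fit below 2^(m+1).\<close>
  ultimately have cG: "of_nat (card ?G) + b < ?M"
    using b1 unfolding power_Suc of_nat_power of_nat_numeral by linarith
  \<comment> \<open>Two numbers in [0, M) that differ by d * M with d an integer; so d = 0. The same
    argument with M replaced by 1 follows for c.\<close>
  define d where "d = int J - int j"
  have d: "y1 = of_nat (card ?G) + b + of_int d * ?M"
    unfolding y1(1) yGb d_def by (simp add: algebra_simps)
  have "d = 0"
  proof (rule ccontr)
    assume "d \<noteq> 0"
    then consider "d \<ge> 1" | "d \<le> -1" by linarith
    then show False
    proof cases
      case 1
      then have "1 * ?M \<le> of_int d * ?M" by (intro mult_right_mono) auto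
      moreover have "0 \<le> rat_of_nat (card ?G)" by simp
      ultimately show False using d y1(3) b0 by linarith
    next
      case 2
      then have "of_int d \<le> (of_int (-1) :: rat)" by (simp only: of_int_le_iff)
      then have "of_int d * ?M \<le> of_int (-1) * ?M" by (rule mult_right_mono) simp
      then have "of_int d * ?M \<le> - ?M" unfolding of_int_minus of_int_1 mult_minus1 .
      then show False using d y1(2) cG by linarith
    qed
  qed
  with d have y1': "y1 = of_nat (card ?G) + b" by simp
  define c where "c = int (card ?G) - int l"
  have c: "y2 = of_int c + b" unfolding y2(1) y1' c_def by simp
  have "of_int c < (1::rat)" "of_int c > (-1::rat)" using c y2 b0 b1 by linarith+
  then have "c = 0" by linarith
  with c y1' show ?thesis by simp
qed

text \<open>At most 2^m terms, each at most X^n, where X is at most 2^(m+2). The exponent of 2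
  bounds the number of doubling and halving steps.\<close>

lemma power_sum_bounds:
  fixes B :: "'b set" and f :: "'b \<Rightarrow> int"
  assumes B: "finite B" "card B \<le> 2 ^ m" and f: "\<And>S. S \<in> B \<Longrightarrow> f S \<le> int n"
  shows "0 \<le> (\<Sum>S\<in>B. (2 ^ Suc m + 1 :: rat) powi f S)"
    and "(\<Sum>S\<in>B. (2 ^ Suc m + 1 :: rat) powi f S) < 2 ^ (m + (m + 2) * n + 1)"
proof -
  let ?X = "2 ^ Suc m + 1 :: rat"
  show "0 \<le> (\<Sum>S\<in>B. ?X powi f S)" by (rule sum_nonneg) (simp add: add_nonneg_pos)
  have "1 \<le> (2::rat) ^ Suc m" by (rule one_le_power) simp
  then have X: "?X \<le> 2 ^ (m + 2)" by simp
  have "(\<Sum>S\<in>B. ?X powi f S) \<le> of_nat (card B) * ?X ^ n"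
  proof (rule sum_bounded_above)
    fix S assume "S \<in> B"
    then have "?X powi f S \<le> ?X powi int n" using f by (intro power_int_increasing) auto
    then show "?X powi f S \<le> ?X ^ n" by simp
  qed
  also have "\<dots> \<le> of_nat (2 ^ m) * (2 ^ (m + 2)) ^ n"
  proof (rule mult_mono)
    show "of_nat (card B) \<le> (of_nat (2 ^ m) :: rat)" using B by (simp only: of_nat_le_iff)
    show "?X ^ n \<le> (2 ^ (m + 2)) ^ n" by (rule power_mono[OF X]) (simp add: add_nonneg_pos)
  qed (simp_all add: add_nonneg_pos)
  also have "\<dots> = 2 ^ (m + (m + 2) * n)"
    by (simp only: of_nat_power of_nat_numeral power_add power_mult)
  also have "\<dots> < 2 ^ (m + (m + 2) * n + 1)" by simp
  finally show "(\<Sum>S\<in>B. ?X powi f S) < 2 ^ (m + (m + 2) * n + 1)" .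
qed

text \<open>Memory arrays are one-dimensional, so stage k and position (i, j) are packed by Cantor
  pairing. The pairing is quadratic, hence the unary addresses stay polynomial in m.\<close>

definition ix :: "nat \<Rightarrow> nat \<Rightarrow> nat \<Rightarrow> nat" where
  "ix k i j = prod_encode (k, prod_encode (i, j))"

lemma ix_inject [simp]: "ix k i j = ix k' i' j' \<longleftrightarrow> k = k' \<and> i = i' \<and> j = j'"
  by (simp add: ix_def)

lemma prod_encode_bound: "prod_encode (x, y) \<le> (x + y + 1)\<^sup>2"
proof -
  have "triangle n \<le> n * Suc n" for n by (simp add: triangle_def)
  from this[of "x + y"] show ?thesis
    by (simp add: prod_encode_def power2_eq_square algebra_simps)
qed

definition ixbound :: "nat \<Rightarrow> nat" where
  "ixbound m = (m + (2 * m + 1)\<^sup>2 + 1)\<^sup>2"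

lemma ix_le: "k \<le> m \<Longrightarrow> i \<le> m \<Longrightarrow> j \<le> m \<Longrightarrow> ix k i j \<le> ixbound m"
proof -
  assume *: "k \<le> m" "i \<le> m" "j \<le> m"
  have "prod_encode (i, j) \<le> (i + j + 1)\<^sup>2" by (rule prod_encode_bound)
  also have "\<dots> \<le> (2 * m + 1)\<^sup>2" by (rule power_mono) (use * in auto)
  finally have "(k + prod_encode (i, j) + 1)\<^sup>2 \<le> (m + (2 * m + 1)\<^sup>2 + 1)\<^sup>2"
    by (intro power_mono) (use * in auto)
  then show ?thesis unfolding ix_def ixbound_def using prod_encode_bound le_trans by blast
qed

abbreviation cK :: "nat \<Rightarrow> aexp" where "cK i \<equiv> Cell ''k'' (num i)"
abbreviation cW :: "nat \<Rightarrow> aexp" where "cW i \<equiv> Cell ''w'' (num i)"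
abbreviation cE :: "nat \<Rightarrow> nat \<Rightarrow> nat \<Rightarrow> aexp" where "cE k i j \<equiv> Cell ''E'' (num (ix k i j))"

abbreviation negq :: aexp where "negq \<equiv> Sub (Sub Zero (var ''q'')) One"

definition sq_prog :: "nat \<Rightarrow> com" where
  "sq_prog m = setv ''q'' (esum (map (\<lambda>i. Mul (cK i) (cK i)) [1..<Suc m]))"

text \<open>The sum of the squared costs replaces \<open>l1_norm\<close>, because it needs no absolute values. The
  threshold is clamped to \<open>[-q - 1, q]\<close>, which makes the running time independent of it.\<close>

definition init_prog :: "nat \<Rightarrow> com" where
  "init_prog m = Seq (sq_prog m) (Seq (setv ''t'' (var ''K''))
    (Seq (Cond (Less (var ''q'') (var ''t'')) (setv ''t'' (var ''q'')) Skip)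
    (Seq (Cond (Less (var ''t'') negq) (setv ''t'' negq) Skip)
    (Seq (setv ''M'' (epow (Suc m)))
    (Seq (setv ''X'' (Add (var ''M'') One))
    (Seq (pow_prog (var ''q'')) (setv ''z'' (var ''p''))))))))"

lemma run_Cond_setv:
  assumes "blegal b s" "bval b s \<Longrightarrow> alegal e s" "bsize b + asize e + 3 \<le> T"
    and v: "v = (if bval b s then aval e s else s a 0)"
  shows "run (Cond b (setv a e) Skip) s (update s a 0 v) T"
proof -
  have "run (Cond b (setv a e) Skip) s (update s a 0 v) (bsize b + 1 + (asize e + 2))"
  proof (rule run_Cond)
    assume "\<not> bval b s"
    then have "update s a 0 v = s" by (auto simp: v update_def fun_eq_iff)
    then show "run Skip s (update s a 0 v) (asize e + 2)" using run_mono[OF run_Skip] by simp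
  qed (use assms in \<open>auto intro: run_setv\<close>)
  then show ?thesis by (rule run_mono) (use assms in simp)
qed

definition sqsum :: "nat \<Rightarrow> (nat \<Rightarrow> int) \<Rightarrow> nat" where
  "sqsum m \<kappa> = nat (\<Sum>i=1..m. (\<kappa> i)\<^sup>2)"

lemma int_sqsum: "int (sqsum m \<kappa>) = (\<Sum>i=1..m. (\<kappa> i)\<^sup>2)"
  by (simp add: sqsum_def sum_nonneg)

lemma sum_list_upt: "(\<Sum>i\<leftarrow>[1..<Suc m]. f i) = (\<Sum>i=1..m. f i)"
  using interv_sum_list_conv_sum_set_nat[of f 1 "Suc m"]
  by (simp add: atLeastLessThanSuc_atLeastAtMost del: upt_Suc)

lemma prod_list_upt: "(\<Prod>i\<leftarrow>[0..<r]. f i) = (\<Prod>i<r. f i)"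
  by (simp add: prod.list_conv_set_nth lessThan_atLeast0)

lemma sq_expr_size: "asize (esum (map (\<lambda>i. Mul (cK i) (cK i)) [1..<Suc m])) \<le> m * (4 * m + 6) + 1"
proof -
  have "asize (esum (map (\<lambda>i. Mul (cK i) (cK i)) [1..<Suc m])) \<le>
      length (map (\<lambda>i. Mul (cK i) (cK i)) [1..<Suc m]) * (4 * m + 5 + 1) + 1"
    by (rule asize_esum) auto
  then show ?thesis by (simp add: algebra_simps del: upt_Suc)
qed

lemma run_sq_prog:
  assumes k: "\<And>i. i \<in> {1..m} \<Longrightarrow> s ''k'' i = of_int (\<kappa> i)"
  shows "run (sq_prog m) s (update s ''q'' 0 (of_nat (sqsum m \<kappa>))) (m * (4 * m + 6) + 3)"
  unfolding sq_prog_def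
proof (rule run_setv)
  have "aval (esum (map (\<lambda>i. Mul (cK i) (cK i)) [1..<Suc m])) s = (\<Sum>i=1..m. s ''k'' i * s ''k'' i)"
    unfolding aval_esum map_map comp_def using sum_list_upt[of "\<lambda>i. s ''k'' i * s ''k'' i" m]
    by (simp del: upt_Suc)
  also have "\<dots> = of_int (\<Sum>i=1..m. (\<kappa> i)\<^sup>2)"
    using k by (simp add: power2_eq_square)
  also have "\<dots> = of_nat (sqsum m \<kappa>)" 
    unfolding int_sqsum[symmetric] by (rule of_int_of_nat_eq)
  finally show "aval (esum (map (\<lambda>i. Mul (cK i) (cK i)) [1..<Suc m])) s = of_nat (sqsum m \<kappa>)" .
qed (use sq_expr_size[of m] in \<open>simp_all del: upt_Suc\<close>)

lemma run_init_prog: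
  assumes k: "\<And>i. i \<in> {1..m} \<Longrightarrow> s ''k'' i = of_int (\<kappa> i)" and K: "s ''K'' 0 = of_int \<K>"
  defines "Q \<equiv> sqsum m \<kappa>"
  defines "\<tau> \<equiv> max (- int Q - 1) (min \<K> (int Q))"
  shows "\<exists>s'. run (init_prog m) s s' (m * (4 * m + 6) + 4 * m + 20 * Q + 100) \<and>
    agree {''q'', ''t'', ''M'', ''X'', ''n'', ''p'', ''z''} s s' \<and>
    s' ''q'' 0 = of_nat Q \<and> s' ''t'' 0 = of_int \<tau> \<and> s' ''M'' 0 = 2 ^ Suc m \<and>
    s' ''X'' 0 = 2 ^ Suc m + 1 \<and> s' ''z'' 0 = (2 ^ Suc m + 1) ^ Q"
proof -
  define \<mu> where "\<mu> = min \<K> (int Q)"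
  let ?s1 = "update s ''q'' 0 (of_nat Q)"
  let ?s2 = "update ?s1 ''t'' 0 (of_int \<K>)"
  let ?s3 = "update ?s2 ''t'' 0 (of_int \<mu>)"
  let ?s4 = "update ?s3 ''t'' 0 (of_int \<tau>)"
  let ?s5 = "update ?s4 ''M'' 0 (2 ^ Suc m)"
  let ?s6 = "update ?s5 ''X'' 0 (2 ^ Suc m + 1)"
  have r1: "run (sq_prog m) s ?s1 (m * (4 * m + 6) + 3)"
    unfolding Q_def by (rule run_sq_prog) (rule k)
  have r2: "run (setv ''t'' (var ''K'')) ?s1 ?s2 4" by (rule run_setv) (simp_all add: K)
  have r3: "run (Cond (Less (var ''q'') (var ''t'')) (setv ''t'' (var ''q'')) Skip) ?s2 ?s3 10"
  proof (rule run_Cond_setv)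
    have "(rat_of_nat Q < of_int \<K>) = (int Q < \<K>)"
      using of_int_less_iff[where 'a = rat, of "int Q" \<K>] by simp
    then show "of_int \<mu> = (if bval (Less (var ''q'') (var ''t'')) ?s2
        then aval (var ''q'') ?s2 else ?s2 ''t'' 0)" by (simp add: \<mu>_def)
  qed simp_all
  have r4: "run (Cond (Less (var ''t'') negq) (setv ''t'' negq) Skip) ?s3 ?s4 20"
  proof (rule run_Cond_setv)
    have "(rat_of_int \<mu> < - of_nat Q - 1) = (\<mu> < - int Q - 1)"
      using of_int_less_iff[where 'a = rat, of \<mu> "- int Q - 1"] by simp
    moreover have "\<tau> = (if \<mu> < - int Q - 1 then - int Q - 1 else \<mu>)"
      by (simp add: \<tau>_def \<mu>_def)
    ultimately show "of_int \<tau> = (if bval (Less (var ''t'') negq) ?s3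
        then aval negq ?s3 else ?s3 ''t'' 0)" by simp
  qed simp_all
  have r5: "run (setv ''M'' (epow (Suc m))) ?s4 ?s5 (4 * m + 7)" by (rule run_setv) simp_all
  have r6: "run (setv ''X'' (Add (var ''M'') One)) ?s5 ?s6 6" by (rule run_setv) simp_all
  have e7: "alegal (var ''q'') ?s6" "aval (var ''q'') ?s6 = of_nat Q" by simp_all
  obtain s7 where r7: "run (pow_prog (var ''q'')) ?s6 s7 (asize (var ''q'') + 20 * Q + 12)"
    and a7: "agree {''n'', ''p''} ?s6 s7" and "s7 ''p'' 0 = ?s6 ''X'' 0 ^ Q"
    using run_pow_prog[OF e7] by blast
  then have p7: "s7 ''p'' 0 = (2 ^ Suc m + 1) ^ Q" by simp
  let ?s8 = "update s7 ''z'' 0 (s7 ''p'' 0)"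
  have r8: "run (setv ''z'' (var ''p'')) s7 ?s8 4" by (rule run_setv) simp_all
  have "run (init_prog m) s ?s8 (m * (4 * m + 6) + 4 * m + 20 * Q + 100)"
    unfolding init_prog_def
    by (rule run_SeqI[OF r1 run_Seq[OF r2 run_Seq[OF r3 run_Seq[OF r4 run_Seq[OF r5
      run_Seq[OF r6 run_Seq[OF r7 r8]]]]]]]) simp
  moreover have "agree {''q'', ''t'', ''M'', ''X'', ''n'', ''p'', ''z''} s ?s8"
    using a7 by (simp add: agree_def)
  moreover have "?s8 ''q'' 0 = of_nat Q" "?s8 ''t'' 0 = of_int \<tau>" "?s8 ''M'' 0 = 2 ^ Suc m"
    "?s8 ''X'' 0 = 2 ^ Suc m + 1" "?s8 ''z'' 0 = (2 ^ Suc m + 1) ^ Q"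
    using a7 p7 by (simp_all add: agree_def)
  ultimately show ?thesis by blast
qed

text \<open>\<open>pow_prog\<close> takes natural exponents only, whereas the weight X^(-k_i) may
  have either sign. The exponent is shifted by q, which is at least every |k_i|, and the shift is
  undone by dividing by z = X^q.\<close>

definition weight_prog :: "nat \<Rightarrow> com" where
  "weight_prog m = seqs (map (\<lambda>i. Seq (pow_prog (Sub (var ''q'') (cK i)))
     (Assign ''w'' (num i) (Div (var ''p'') (var ''z'')))) [1..<Suc m])"

lemma abs_le_square_int: "\<bar>x\<bar> \<le> x\<^sup>2" for x :: int
proof (cases "x = 0")
  case False
  then have "\<bar>x\<bar> ^ 1 \<le> \<bar>x\<bar>\<^sup>2" by (intro power_increasing) auto
  then show ?thesis by simp
qed simp

text \<open>An integer is at most its square in absolute value; so the sum of squares computed by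
  the program also bounds every cost.\<close>

lemma cost_le_sqsum:
  assumes "S \<subseteq> {1..m}"
  shows "\<bar>cost \<kappa> S\<bar> \<le> int (sqsum m \<kappa>)"
proof -
  have "\<bar>cost \<kappa> S\<bar> \<le> (\<Sum>i\<in>S. \<bar>\<kappa> i\<bar>)" unfolding cost_def by (rule sum_abs)
  also have "\<dots> \<le> (\<Sum>i\<in>S. (\<kappa> i)\<^sup>2)" by (rule sum_mono) (rule abs_le_square_int)
  also have "\<dots> \<le> (\<Sum>i=1..m. (\<kappa> i)\<^sup>2)" by (rule sum_mono2) (use assms in auto)
  finally show ?thesis by (simp add: int_sqsum)
qed

lemma sqsum_ge: "i \<in> {1..m} \<Longrightarrow> \<bar>\<kappa> i\<bar> \<le> int (sqsum m \<kappa>)"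
  using cost_le_sqsum[of "{i}" m \<kappa>] by (simp add: cost_def)

lemma run_weight_prog:
  assumes k: "\<And>i. i \<in> {1..m} \<Longrightarrow> s ''k'' i = of_int (\<kappa> i)"
    and q: "s ''q'' 0 = of_nat Q" and Q: "\<And>i. i \<in> {1..m} \<Longrightarrow> \<bar>\<kappa> i\<bar> \<le> int Q"
    and X: "s ''X'' 0 \<noteq> 0" and z: "s ''z'' 0 = s ''X'' 0 ^ Q"
  shows "\<exists>s'. run (weight_prog m) s s' (m * (4 * m + 40 * Q + 31) + 1) \<and>
    agree {''n'', ''p'', ''w''} s s' \<and> (\<forall>i\<in>{1..m}. s' ''w'' i = s ''X'' 0 powi (- \<kappa> i))"
proof -
  let ?f = "\<lambda>i. Seq (pow_prog (Sub (var ''q'') (cK i)))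
     (Assign ''w'' (num i) (Div (var ''p'') (var ''z'')))"
  let ?cs = "map ?f [1..<Suc m]"
  let ?I = "\<lambda>k s'. agree {''n'', ''p'', ''w''} s s' \<and> (\<forall>i\<in>{1..k}. s' ''w'' i = s ''X'' 0 powi (- \<kappa> i))"
  have len: "length ?cs = m" by simp
  have "\<exists>s'. run (seqs ?cs) s s' (m * (4 * m + 40 * Q + 31) + 1) \<and> ?I (length ?cs) s'"
  proof (rule run_seqs[where I = ?I])
    fix l s1 assume "l < length ?cs" and I: "?I l s1"
    then have "l < m" by (simp only: len)
    define i where "i = Suc l"
    have i: "i \<in> {1..m}" using \<open>l < m\<close> by (simp add: i_def)
    have nth: "?cs ! l = ?f i" using \<open>l < m\<close> by (simp add: i_def del: upt_Suc)
    define n where "n = nat (int Q - \<kappa> i)"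
    have n: "int n = int Q - \<kappa> i" "n \<le> 2 * Q" using Q[OF i] by (auto simp: n_def)
    have eq: "s1 ''q'' = s ''q''" "s1 ''k'' = s ''k''" "s1 ''X'' = s ''X''" "s1 ''z'' = s ''z''"
      using I by (auto intro: agreeD)
    have "rat_of_nat n = of_int (int n)" by simp
    also have "\<dots> = of_nat Q - of_int (\<kappa> i)" by (simp add: n(1))
    finally have e: "aval (Sub (var ''q'') (cK i)) s1 = of_nat n" using k[OF i] by (simp add: eq q)
    have "alegal (Sub (var ''q'') (cK i)) s1" by simp
    from run_pow_prog[OF this e] obtain s2 where
      r2: "run (pow_prog (Sub (var ''q'') (cK i))) s1 s2 (asize (Sub (var ''q'') (cK i)) + 20 * n + 12)"
      and a2: "agree {''n'', ''p''} s1 s2" and p2: "s2 ''p'' 0 = s ''X'' 0 ^ n"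
      unfolding eq by blast
    have z2: "s2 ''z'' = s ''z''" "s2 ''w'' = s1 ''w''" 
      using agreeD[OF a2, of "''z''"] agreeD[OF a2, of "''w''"] by (simp_all add: eq)
    let ?s3 = "update s2 ''w'' i (aval (Div (var ''p'') (var ''z'')) s2)"
    have "run (Assign ''w'' (num i) (Div (var ''p'') (var ''z''))) s2 ?s3
        (asize (num i) + asize (Div (var ''p'') (var ''z'')) + 1)"
      by (rule run_Assign) (use X z in \<open>simp_all add: z2\<close>)
    from run_SeqI[OF r2 this] have "run (?cs ! l) s1 ?s3 (4 * m + 40 * Q + 30)"
      unfolding nth using n(2) i by simp
    moreover have "?I (Suc l) ?s3"
    proof (intro conjI ballI)
      show "agree {''n'', ''p'', ''w''} s ?s3" using I a2 by (simp add: agree_def)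
      fix i' assume i': "i' \<in> {1..Suc l}"
      show "?s3 ''w'' i' = s ''X'' 0 powi (- \<kappa> i')"
      proof (cases "i' = i")
        case True
        have "s ''X'' 0 ^ n / s ''X'' 0 ^ Q = s ''X'' 0 powi int n / s ''X'' 0 powi int Q" by simp
        also have "\<dots> = s ''X'' 0 powi (int n - int Q)" 
          by (rule power_int_diff[symmetric]) (use X in simp)
        also have "int n - int Q = - \<kappa> i" by (simp add: n(1))
        finally show ?thesis using True by (simp add: p2 z2 z)
      next
        case False
        then have "i' \<in> {1..l}" using i' by (simp add: i_def)
        then show ?thesis using I False by (simp add: z2)
      qed
    qed
    ultimately show "\<exists>s'. run (?cs ! l) s1 s' (4 * m + 40 * Q + 30) \<and> ?I (Suc l) s'" by blast
  qed (simp_all add: agree_refl)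
  then show ?thesis unfolding weight_prog_def by (simp only: len)
qed

definition pairs :: "nat \<Rightarrow> (nat \<times> nat) list" where
  "pairs r = List.product [0..<r] [0..<r]"

lemma set_pairs [simp]: "set (pairs r) = {0..<r} \<times> {0..<r}"
  by (simp add: pairs_def)

lemma length_pairs [simp]: "length (pairs r) = r * r"
  by (simp add: pairs_def)

lemma pairs_time: "r \<le> m \<Longrightarrow> T + 1 = U \<Longrightarrow> length (pairs r) * (T + 1) + 1 \<le> m * m * U + 1"
  by (auto intro!: mult_le_mono simp del: One_nat_def)

definition gram_entry :: "nat \<Rightarrow> (nat \<Rightarrow> nat \<Rightarrow> rat) \<Rightarrow> nat \<times> nat \<Rightarrow> aexp" where
  "gram_entry m a = (\<lambda>(j, l). esum (map (\<lambda>i. Mul (Mul (cW i) (entry (a i j))) (entry (a i l))) [1..<Suc m]))"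

text \<open>The matrix entries are written into the program text; this is where the program depends
  on the matroid.\<close>

definition gram_prog :: "nat \<Rightarrow> nat \<Rightarrow> (nat \<Rightarrow> nat \<Rightarrow> rat) \<Rightarrow> com" where
  "gram_prog m r a = assigns ''E'' (pairs r) (\<lambda>(j, l). ix 0 j l) (gram_entry m a)"

lemma asize_gram_entry: "asize (gram_entry m a x) \<le> m * (2 * m + 11) + 1"
proof -
  obtain j l where x: "x = (j, l)" by (cases x)
  let ?es = "map (\<lambda>i. Mul (Mul (cW i) (entry (a i j))) (entry (a i l))) [1..<Suc m]"
  have "asize (esum ?es) \<le> length ?es * (2 * m + 10 + 1) + 1"
  proof (rule asize_esum)
    fix e assume "e \<in> set ?es"
    then obtain i where i: "i \<in> set [1..<Suc m]" "e = Mul (Mul (cW i) (entry (a i j))) (entry (a i l))"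
      unfolding set_map by (rule imageE) blast
    have "i \<le> m" using i(1) unfolding set_upt by simp
    then show "asize e \<le> 2 * m + 10"
      using asize_entry[of "a i j"] asize_entry[of "a i l"] unfolding i(2) by simp
  qed
  moreover have "length ?es = m" by simp
  ultimately show ?thesis unfolding gram_entry_def x by (simp add: add.commute del: upt_Suc)
qed

lemma run_gram_prog:
  assumes w: "\<And>i. i \<in> {1..m} \<Longrightarrow> s ''w'' i = \<omega> i"
    and a: "\<And>i j. a i j \<in> {-1, 0, 1}" and r: "r \<le> m"
  shows "\<exists>s'. run (gram_prog m r a) s s' (m * m * (2 * ixbound m + m * (2 * m + 11) + 4) + 1) \<and>
    agree {''E''} s s' \<and> (\<forall>i<r. \<forall>j<r. s' ''E'' (ix 0 i j) = gram m a \<omega> i j)"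
proof -
  let ?idx = "\<lambda>(j, l). ix 0 j l" and ?T = "2 * ixbound m + m * (2 * m + 11) + 3"
  let ?T' = "m * m * (2 * ixbound m + m * (2 * m + 11) + 4) + 1"
  let ?v = "\<lambda>(j, l). gram m a \<omega> j l"
  have "\<exists>s'. run (gram_prog m r a) s s' ?T' \<and> agree {''E''} s s' \<and>
    (\<forall>n. n \<notin> ?idx ` set (pairs r) \<longrightarrow> s' ''E'' n = s ''E'' n) \<and>
    (\<forall>x\<in>set (pairs r). s' ''E'' (?idx x) = ?v x)"
    unfolding gram_prog_def
  proof (rule run_assigns[where T = ?T])
    show "inj_on ?idx (set (pairs r))" by (auto simp: inj_on_def)
    fix x assume x: "x \<in> set (pairs r)"
    obtain j l where jl: "x = (j, l)" "j < r" "l < r" using x by auto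
    have "ix 0 j l \<le> ixbound m" by (rule ix_le) (use jl r in auto)
    then show "2 * ?idx x + asize (gram_entry m a x) + 2 \<le> ?T"
      unfolding jl(1) prod.case using asize_gram_entry[of m a "(j, l)"] by linarith
    fix s' assume "agree {''E''} s s'"
    then have w': "s' ''w'' = s ''w''" by (rule agreeD) simp
    have "aval (gram_entry m a x) s' = (\<Sum>i\<leftarrow>[1..<Suc m]. s ''w'' i * a i j * a i l)"
      unfolding gram_entry_def jl(1) using a
      by (simp add: comp_def w' del: upt_Suc)
    also have "\<dots> = (\<Sum>i=1..m. s ''w'' i * a i j * a i l)" by (rule sum_list_upt)
    also have "\<dots> = gram m a \<omega> j l" unfolding gram_def by (intro sum.cong refl) (simp add: w)
    finally show "alegal (gram_entry m a x) s' \<and> aval (gram_entry m a x) s' = ?v x"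
      by (simp add: jl(1) gram_entry_def del: upt_Suc)
  next
    show "length (pairs r) * (?T + 1) + 1 \<le> ?T'" by (rule pairs_time[OF r]) simp
  qed
  then obtain s' where s': "run (gram_prog m r a) s s' ?T'" "agree {''E''} s s'"
    "\<forall>x\<in>set (pairs r). s' ''E'' (?idx x) = ?v x" by blast
  have "s' ''E'' (ix 0 i j) = gram m a \<omega> i j" if "i < r" "j < r" for i j
    using s'(3)[THEN bspec, of "(i, j)"] that by simp
  with s'(1,2) show ?thesis by blast
qed

definition elim_entry :: "nat \<Rightarrow> nat \<times> nat \<Rightarrow> aexp" where
  "elim_entry k = (\<lambda>(i, j). Sub (cE k i j) (Div (Mul (cE k i k) (cE k k j)) (cE k k k)))"

text \<open>Each intermediate matrix of the elimination has its own cells, so that no step overwrites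
  entries that are still needed.\<close>

definition elim_prog :: "nat \<Rightarrow> com" where
  "elim_prog r = seqs (map (\<lambda>k. assigns ''E'' (pairs r) (\<lambda>(i, j). ix (Suc k) i j) (elim_entry k)) [0..<r])"

lemma elim_entry_size:
  assumes "x \<in> set (pairs r)" "k < r" "r \<le> m"
  shows "2 * (case x of (i, j) \<Rightarrow> ix (Suc k) i j) + asize (elim_entry k x) + 2 \<le> 10 * ixbound m + 13"
proof -
  obtain i j where ij: "x = (i, j)" "i < r" "j < r" using assms by auto
  have "ix k' i' j' \<le> ixbound m" if "k' \<le> r" "i' < r" "j' < r" for k' i' j'
    by (rule ix_le) (use that assms in auto)
  note this[of "Suc k" i j] this[of k i j] this[of k i k] this[of k k j] this[of k k k]
  then show ?thesis using ij assms by (simp add: elim_entry_def)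
qed

lemma run_elim_prog:
  assumes f: "\<And>i j. i < r \<Longrightarrow> j < r \<Longrightarrow> s ''E'' (ix 0 i j) = f i j"
    and piv: "\<And>k. k < r \<Longrightarrow> elim f k k k \<noteq> 0" and r: "r \<le> m"
  shows "\<exists>s'. run (elim_prog r) s s' (m * (m * m * (10 * ixbound m + 14) + 2) + 1) \<and>
    agree {''E''} s s' \<and> (\<forall>k\<le>r. \<forall>i<r. \<forall>j<r. s' ''E'' (ix k i j) = elim f k i j)"
proof -
  let ?idx = "\<lambda>k (i, j). ix (Suc k) i j" and ?T = "10 * ixbound m + 13"
  let ?f = "\<lambda>k. assigns ''E'' (pairs r) (?idx k) (elim_entry k)"
  let ?cs = "map ?f [0..<r]" and ?T' = "m * m * (10 * ixbound m + 14) + 1"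
  let ?I = "\<lambda>k s'. agree {''E''} s s' \<and> (\<forall>k'\<le>k. \<forall>i<r. \<forall>j<r. s' ''E'' (ix k' i j) = elim f k' i j)"
  have len: "length ?cs = r" by simp
  have "\<exists>s'. run (seqs ?cs) s s' (m * (?T' + 1) + 1) \<and> ?I (length ?cs) s'"
  proof (rule run_seqs[where I = ?I])
    fix k s1 assume "k < length ?cs" and I: "?I k s1"
    then have k: "k < r" by simp
    have E: "s1 ''E'' (ix k i j) = elim f k i j" if "i < r" "j < r" for i j using I that by simp
    let ?v = "\<lambda>(i, j). elim f (Suc k) i j"
    have "\<exists>s'. run (?f k) s1 s' ?T' \<and> agree {''E''} s1 s' \<and>
        (\<forall>n. n \<notin> ?idx k ` set (pairs r) \<longrightarrow> s' ''E'' n = s1 ''E'' n) \<and>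
        (\<forall>x\<in>set (pairs r). s' ''E'' (?idx k x) = ?v x)"
    proof (rule run_assigns[where T = ?T])
      show "inj_on (?idx k) (set (pairs r))" by (auto simp: inj_on_def)
      fix x assume x: "x \<in> set (pairs r)"
      then show "2 * ?idx k x + asize (elim_entry k x) + 2 \<le> ?T"
        by (rule elim_entry_size[OF _ k r])
      obtain i j where ij: "x = (i, j)" "i < r" "j < r" using x by auto
      fix s' assume fr: "\<forall>n. n \<notin> ?idx k ` set (pairs r) \<longrightarrow> s' ''E'' n = s1 ''E'' n"
      have E': "s' ''E'' (ix k i j) = elim f k i j" if "i < r" "j < r" for i j
      proof -
        have "ix k i j \<notin> ?idx k ` set (pairs r)" by auto
        then have "s' ''E'' (ix k i j) = s1 ''E'' (ix k i j)" using fr by blast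
        then show ?thesis using E[OF that] by simp
      qed
      show "alegal (elim_entry k x) s' \<and> aval (elim_entry k x) s' = ?v x"
        using ij k piv[OF k] by (simp add: elim_entry_def E')
    next
      show "length (pairs r) * (?T + 1) + 1 \<le> ?T'" by (rule pairs_time[OF r]) simp
    qed
    then obtain s2 where s2: "run (?f k) s1 s2 ?T'" "agree {''E''} s1 s2"
      "\<forall>n. n \<notin> ?idx k ` set (pairs r) \<longrightarrow> s2 ''E'' n = s1 ''E'' n"
      "\<forall>x\<in>set (pairs r). s2 ''E'' (?idx k x) = ?v x" by blast
    have "?I (Suc k) s2"
    proof (intro conjI allI impI)
      show "agree {''E''} s s2" using I s2(2) by (simp add: agree_def)
      fix k' i j assume kij: "k' \<le> Suc k" "i < r" "j < r"
      show "s2 ''E'' (ix k' i j) = elim f k' i j"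
      proof (cases "k' = Suc k")
        case True
        then show ?thesis using s2(4)[THEN bspec, of "(i, j)"] kij by simp
      next
        case False
        then have "ix k' i j \<notin> ?idx k ` set (pairs r)" by auto
        then have "s2 ''E'' (ix k' i j) = s1 ''E'' (ix k' i j)" using s2(3) by blast
        then show ?thesis using I kij False by simp
      qed
    qed
    with s2(1) k show "\<exists>s'. run (?cs ! k) s1 s' ?T' \<and> ?I (Suc k) s'" by auto
  next
    show "?I 0 s" using f by (simp add: agree_refl)
    have "r * (?T' + 1) \<le> m * (?T' + 1)" by (intro mult_le_mono r order_refl)
    then show "length ?cs * (?T' + 1) + 1 \<le> m * (?T' + 1) + 1" by (simp only: len add_le_mono)
  qed
  then show ?thesis unfolding elim_prog_def by (simp only: len) simp
qed

text \<open>The factor X^t is obtained as z divided by X^(q - t), whose exponent is natural after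
  the clamping. The first reduction, modulo \<open>M\<close>, leaves the count plus a fraction; the
  second, modulo 1, isolates the fraction, which is subtracted. It restarts from p =
  \<open>M\<close>, as y is below \<open>M\<close> by then.\<close>

definition finish_prog :: "nat \<Rightarrow> com" where
  "finish_prog r = Seq (pow_prog (Sub (var ''q'') (var ''t'')))
    (Seq (setv ''y'' (Div (Mul (eprod (map (\<lambda>k. cE k k k) [0..<r])) (var ''z'')) (var ''p'')))
    (Seq double_prog
    (Seq (reduce_prog (var ''M''))
    (Seq (setv ''N'' (var ''y''))
    (Seq (setv ''p'' (var ''M''))
    (Seq (reduce_prog One)
    (setv ''N'' (Sub (var ''N'') (var ''y'')))))))))"

lemma asize_pivot_product:
  assumes "r \<le> m"
  shows "asize (eprod (map (\<lambda>k. cE k k k) [0..<r])) \<le> m * (2 * ixbound m + 3) + 1"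
proof -
  have "asize (eprod (map (\<lambda>k. cE k k k) [0..<r])) \<le>
      length (map (\<lambda>k. cE k k k) [0..<r]) * (2 * ixbound m + 2 + 1) + 1"
    by (rule asize_eprod) (use assms ix_le in auto)
  also have "\<dots> \<le> m * (2 * ixbound m + 2 + 1) + 1"
    using assms by (intro add_mono mult_le_mono) auto
  finally show ?thesis by (simp add: add_mult_distrib2)
qed

text \<open>40 Q pays for the exponent q - t, which is at most 2 Q + 1. The factor 48 consists of 16
  for a doubling and 32 for a step of the reduction modulo \<open>M\<close>; 31 m belongs to the
  reduction modulo 1.\<close>

definition finish_time :: "nat \<Rightarrow> nat \<Rightarrow> nat" where
  "finish_time m Q = 40 * Q + m * (2 * ixbound m + 3) + 48 * (m + (m + 2) * (2 * Q) + 1) + 31 * m + 300"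

lemma run_finish_prog:
  assumes q: "s ''q'' 0 = of_nat Q" and t: "s ''t'' 0 = of_int \<tau>" "- int Q - 1 \<le> \<tau>" "\<tau> \<le> int Q"
    and M: "s ''M'' 0 = 2 ^ Suc m" and X: "s ''X'' 0 = 2 ^ Suc m + 1"
    and z: "s ''z'' 0 = (2 ^ Suc m + 1) ^ Q" and r: "r \<le> m"
    and prod: "(\<Prod>k<r. s ''E'' (ix k k k)) = (\<Sum>S\<in>B. (2 ^ Suc m + 1) powi (- f S))"
    and B: "finite B" "card B \<le> 2 ^ m" and f: "\<And>S. S \<in> B \<Longrightarrow> \<bar>f S\<bar> \<le> int Q"
  shows "\<exists>s'. run (finish_prog r) s s' (finish_time m Q) \<and> agree {''n'', ''p'', ''y'', ''N''} s s' \<and>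
    s' ''N'' 0 = of_nat (card {S \<in> B. f S \<le> \<tau>})"
proof -
  let ?X = "2 ^ Suc m + 1 :: rat"
  have "(0::rat) < 2 ^ Suc m" by simp
  then have X0: "?X \<noteq> 0" by linarith
  define n where "n = nat (int Q - \<tau>)"
  have n: "int n = int Q - \<tau>" "n \<le> 2 * Q + 1" using t by (auto simp: n_def)
  have "rat_of_nat n = of_int (int n)" by simp
  also have "\<dots> = of_nat Q - of_int \<tau>" by (simp add: n(1))
  finally have e1: "aval (Sub (var ''q'') (var ''t'')) s = of_nat n" by (simp add: q t)
  have l1: "alegal (Sub (var ''q'') (var ''t'')) s" by simp
  from run_pow_prog[OF l1 e1] obtain s1 where
    r1: "run (pow_prog (Sub (var ''q'') (var ''t''))) s s1 (asize (Sub (var ''q'') (var ''t'')) + 20 * n + 12)"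
    and a1: "agree {''n'', ''p''} s s1" and p1: "s1 ''p'' 0 = s ''X'' 0 ^ n" by blast
  have s1: "s1 ''E'' = s ''E''" "s1 ''z'' = s ''z''" "s1 ''M'' = s ''M''" using a1 by (simp_all add: agree_def)
  let ?y = "Div (Mul (eprod (map (\<lambda>k. cE k k k) [0..<r])) (var ''z'')) (var ''p'')"
  define y where "y = (\<Sum>S\<in>B. ?X powi (\<tau> - f S))"
  let ?s2 = "update s1 ''y'' 0 y"
  have pn: "?X ^ n \<noteq> 0" using X0 by (rule power_not_zero)
  have r2: "run (setv ''y'' ?y) s1 ?s2 (m * (2 * ixbound m + 3) + 9)"
  proof (rule run_setv)
    have "aval ?y s1 = (\<Prod>k<r. s ''E'' (ix k k k)) * ?X ^ Q / ?X ^ n"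
      by (simp add: s1 comp_def prod_list_upt z p1 X)
    also have "\<dots> = (\<Sum>S\<in>B. ?X powi (- f S) * (?X powi int Q / ?X powi int n))"
      by (simp only: prod sum_distrib_right power_int_of_nat times_divide_eq_right)
        (simp add: sum_divide_distrib sum_distrib_right)
    also have "\<dots> = y" unfolding y_def
    proof (rule sum.cong[OF refl])
      fix S
      have "?X powi int Q / ?X powi int n = ?X powi (int Q - int n)"
        by (rule power_int_diff[symmetric]) (use X0 in simp)
      also have "?X powi (- f S) * \<dots> = ?X powi (- f S + (int Q - int n))"
        by (rule power_int_add[symmetric]) (use X0 in simp)
      also have "- f S + (int Q - int n) = \<tau> - f S" by (simp add: n(1))
      finally show "?X powi (- f S) * (?X powi int Q / ?X powi int n) = ?X powi (\<tau> - f S)" .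
    qed
    finally show "aval ?y s1 = y" .
    show "alegal ?y s1" using pn by (simp add: p1 X)
    show "asize ?y + 2 \<le> m * (2 * ixbound m + 3) + 9" using asize_pivot_product[OF r] by simp
  qed
  \<comment> \<open>The bound of \<open>power_sum_bounds\<close> for n = 2 Q, since neither the
    threshold nor any cost exceeds Q in the direction that enlarges the slack.\<close>
  define L where "L = m + (m + 2) * (2 * Q) + 1"
  have fle: "\<tau> - f S \<le> int (2 * Q)" if "S \<in> B" for S using f[OF that] t(3) by simp
  have y0: "0 \<le> y" unfolding y_def by (rule power_sum_bounds(1)[OF B fle])
  have "y < 2 ^ L" unfolding y_def L_def by (rule power_sum_bounds(2)[OF B fle])
  then have "?s2 ''y'' 0 < 2 ^ L" by simp
  from run_double_prog[of ?s2 L, OF this] obtain s3 n3 where n3: "n3 \<le> L" and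
    r3: "run double_prog ?s2 s3 (16 * L + 11)" and a3: "agree {''p''} ?s2 s3"
    and p3: "s3 ''p'' 0 = 2 ^ n3" and y3': "?s2 ''y'' 0 < 2 ^ n3" by blast
  have s3: "s3 ''y'' 0 = y" "s3 ''M'' 0 = 2 ^ Suc m" using a3 by (simp_all add: agree_def s1 M)
  have y3: "0 \<le> s3 ''y'' 0" "s3 ''y'' 0 < 2 * 2 ^ n3" using y3' y0 by (simp_all add: s3)
  have b3: "alegal (var ''M'') s' \<and> aval (var ''M'') s' = 2 ^ Suc m"
    if "agree {''p'', ''y''} s3 s'" for s'
    using that s3(2) by (simp add: agree_def)
  from run_reduce_prog[where s = s3 and b = "var ''M''" and e = "Suc m" and n = n3, OF b3 p3 y3] obtain s4 j where
    r4: "run (reduce_prog (var ''M'')) s3 s4 (Suc n3 * (asize (var ''M'') + 30) + asize (var ''M'') + 5)"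
    and a4: "agree {''p'', ''y''} s3 s4" and y4: "s4 ''y'' 0 = s3 ''y'' 0 - of_nat j * 2 ^ Suc m"
      "0 \<le> s4 ''y'' 0" "s4 ''y'' 0 < 2 ^ Suc m" by blast
  let ?y1 = "s4 ''y'' 0"
  let ?s5 = "update s4 ''N'' 0 ?y1"
  let ?s6 = "update ?s5 ''p'' 0 (2 ^ Suc m)"
  have M4: "s4 ''M'' 0 = 2 ^ Suc m" using a4 s3(2) by (simp add: agree_def)
  have r5: "run (setv ''N'' (var ''y'')) s4 ?s5 4" by (rule run_setv) simp_all
  have r6: "run (setv ''p'' (var ''M'')) ?s5 ?s6 4" by (rule run_setv) (simp_all add: M4)
  have p6: "?s6 ''p'' 0 = 2 ^ Suc m" by simp
  have y6: "0 \<le> ?s6 ''y'' 0" "?s6 ''y'' 0 < 2 * 2 ^ Suc m"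
  proof -
    show "0 \<le> ?s6 ''y'' 0" using y4 by simp
    have "(0::rat) < 2 ^ Suc m" by simp
    with y4(3) have "s4 ''y'' 0 < 2 * 2 ^ Suc m" by linarith
    then show "?s6 ''y'' 0 < 2 * 2 ^ Suc m" by simp
  qed
  have b6: "alegal One s' \<and> aval One s' = 2 ^ 0" for s' by simp
  from run_reduce_prog[where s = ?s6 and b = One and e = 0 and n = "Suc m", OF b6 p6 y6] obtain s7 l where
    r7: "run (reduce_prog One) ?s6 s7 (Suc (Suc m) * (asize One + 30) + asize One + 5)"
    and a7: "agree {''p'', ''y''} ?s6 s7" and y7': "s7 ''y'' 0 = ?s6 ''y'' 0 - of_nat l * 2 ^ 0"
      "0 \<le> s7 ''y'' 0" "s7 ''y'' 0 < 2 ^ 0" by blast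
  have y7: "s7 ''y'' 0 = ?y1 - of_nat l" "0 \<le> s7 ''y'' 0" "s7 ''y'' 0 < 1" using y7' by simp_all
  let ?s8 = "update s7 ''N'' 0 (?y1 - s7 ''y'' 0)"
  have N7: "s7 ''N'' 0 = ?y1" using a7 by (simp add: agree_def)
  have r8: "run (setv ''N'' (Sub (var ''N'') (var ''y''))) s7 ?s8 7"
    by (rule run_setv) (simp_all add: N7)
  have "?y1 - s7 ''y'' 0 = of_nat (card {S \<in> B. \<tau> - f S \<ge> 0})"
    by (rule power_sum_digits[OF B y_def _ y4(2,3) y7]) (simp add: y4(1) s3)
  then have N8: "?s8 ''N'' 0 = of_nat (card {S \<in> B. f S \<le> \<tau>})" by simp
  have time: "finish_time m Q = 40 * Q + m * (2 * ixbound m + 3) + 48 * L + 31 * m + 300"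
    by (simp only: finish_time_def L_def)
  have "run (finish_prog r) s ?s8 (finish_time m Q)"
    unfolding finish_prog_def
    by (rule run_SeqI[OF r1 run_Seq[OF r2 run_Seq[OF r3 run_Seq[OF r4 run_Seq[OF r5
      run_Seq[OF r6 run_Seq[OF r7 r8]]]]]]])
      (use n(2) n3 in \<open>simp add: time\<close>)
  moreover have "agree {''n'', ''p'', ''y'', ''N''} s ?s8"
    using a1 a3 a4 a7 by (simp add: agree_def)
  ultimately show ?thesis using N8 by blast
qed

section \<open>The counting program\<close>

text \<open>The arrays \<open>k\<close>, \<open>K\<close>, \<open>c\<close>, \<open>C\<close>,
  \<open>B\<close>, \<open>D\<close> and \<open>out\<close> are absent, so the sampler keeps its
  data across calls of the counting program.\<close>

definition work_vars :: "name set" where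
  "work_vars = {''q'', ''t'', ''M'', ''X'', ''n'', ''p'', ''z'', ''w'', ''E'', ''y'', ''N''}"

definition count_prog :: "nat \<Rightarrow> nat \<Rightarrow> (nat \<Rightarrow> nat \<Rightarrow> rat) \<Rightarrow> com" where
  "count_prog m r a = Seq (init_prog m) (Seq (weight_prog m)
    (Seq (gram_prog m r a) (Seq (elim_prog r) (finish_prog r))))"

definition count_time :: "nat \<Rightarrow> nat \<Rightarrow> nat" where
  "count_time m Q = (m * (4 * m + 6) + 4 * m + 20 * Q + 100) + (m * (4 * m + 40 * Q + 31) + 1) +
    (m * m * (2 * ixbound m + m * (2 * m + 11) + 4) + 1) +
    (m * (m * m * (10 * ixbound m + 14) + 2) + 1) + finish_time m Q + 4"

lemma count_time_mono: "Q \<le> Q' \<Longrightarrow> count_time m Q \<le> count_time m Q'"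
  unfolding count_time_def finish_time_def by (intro add_mono mult_le_mono order_refl) simp_all

lemma prod_power_int:
  assumes "X \<noteq> (0 :: 'a :: field)"
  shows "(\<Prod>i\<in>S. X powi (- f i)) = X powi (- (\<Sum>i\<in>S. f i))"
proof (induction S rule: infinite_finite_induct)
  case (insert x F)
  have "X powi (- (\<Sum>i\<in>insert x F. f i)) = X powi (- f x + - (\<Sum>i\<in>F. f i))"
    using insert(1,2) by simp
  also have "\<dots> = X powi (- f x) * X powi (- (\<Sum>i\<in>F. f i))"
    by (rule power_int_add) (use assms in simp)
  finally show ?case using insert by simp
qed simp_all

text \<open>The initial state is arbitrary apart from the costs in \<open>k\<close> and the
  threshold in \<open>K\<close>: the program initializes its working cells itself and can be run
  repeatedly.\<close>

lemma run_count_prog: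
  assumes "matroid {1..m} \<I>" and r: "r \<le> m" and a: "\<And>i j. a i j \<in> {-1, 0, 1}"
    and piv: "\<And>w k. (\<And>i. i \<in> {1..m} \<Longrightarrow> w i > 0) \<Longrightarrow> k < r \<Longrightarrow> elim (gram m a w) k k k \<noteq> 0"
    and sum: "\<And>w. (\<And>i. i \<in> {1..m} \<Longrightarrow> w i > 0) \<Longrightarrow>
      (\<Prod>k<r. elim (gram m a w) k k k) = (\<Sum>S\<in>bases \<I>. \<Prod>i\<in>S. w i)"
    and k: "\<And>i. i \<in> {1..m} \<Longrightarrow> s ''k'' i = of_int (\<kappa> i)" and K: "s ''K'' 0 = of_int \<K>"
  shows "\<exists>s'. run (count_prog m r a) s s' (count_time m (sqsum m \<kappa>)) \<and> agree work_vars s s' \<and>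
    s' ''N'' 0 = of_nat (card (bases_within \<I> \<kappa> \<K>))"
proof -
  interpret matroid "{1..m}" \<I> by fact
  define Q where "Q = sqsum m \<kappa>"
  define \<tau> where "\<tau> = max (- int Q - 1) (min \<K> (int Q))"
  let ?X = "2 ^ Suc m + 1 :: rat"
  have "(0::rat) < 2 ^ Suc m" by simp
  then have X0: "?X > 0" by linarith
  have B1: "bases \<I> \<subseteq> Pow {1..m}" using indep_subset_ground by (auto simp: bases_def)
  then have B: "finite (bases \<I>)" "card (bases \<I>) \<le> 2 ^ m"
    using finite_subset[OF B1] card_mono[OF _ B1] by (simp_all add: card_Pow)
  have cost: "\<bar>cost \<kappa> S\<bar> \<le> int Q" if "S \<in> bases \<I>" for S
    unfolding Q_def by (rule cost_le_sqsum) (use that B1 in blast)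
  obtain s1 where r1: "run (init_prog m) s s1 (m * (4 * m + 6) + 4 * m + 20 * Q + 100)"
    and a1: "agree {''q'', ''t'', ''M'', ''X'', ''n'', ''p'', ''z''} s s1"
    and s1: "s1 ''q'' 0 = of_nat Q" "s1 ''t'' 0 = of_int \<tau>" "s1 ''M'' 0 = 2 ^ Suc m"
      "s1 ''X'' 0 = ?X" "s1 ''z'' 0 = ?X ^ Q"
    using run_init_prog[where s = s and m = m, OF k K] unfolding Q_def[symmetric] \<tau>_def[symmetric] by blast
  have k1: "s1 ''k'' i = of_int (\<kappa> i)" if "i \<in> {1..m}" for i
    using a1 k[OF that] by (simp add: agree_def)
  have X1: "s1 ''X'' 0 \<noteq> 0" and z1: "s1 ''z'' 0 = s1 ''X'' 0 ^ Q" using X0 by (simp_all add: s1)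
  have Qk: "\<bar>\<kappa> i\<bar> \<le> int Q" if "i \<in> {1..m}" for i
    unfolding Q_def by (rule sqsum_ge[OF that])
  from run_weight_prog[where s = s1 and m = m and Q = Q and \<kappa> = \<kappa>, OF k1 s1(1) Qk X1 z1]
  obtain s2 where r2: "run (weight_prog m) s1 s2 (m * (4 * m + 40 * Q + 31) + 1)"
    and a2: "agree {''n'', ''p'', ''w''} s1 s2"
    and w2: "\<forall>i\<in>{1..m}. s2 ''w'' i = s1 ''X'' 0 powi (- \<kappa> i)" by blast
  define w where "w i = ?X powi (- \<kappa> i)" for i
  have w0: "w i > 0" for i unfolding w_def using X0 by (rule zero_less_power_int)
  have w2': "s2 ''w'' i = w i" if "i \<in> {1..m}" for i
    using w2 that by (simp only: s1(4) w_def)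
  have "\<exists>s3. run (gram_prog m r a) s2 s3 (m * m * (2 * ixbound m + m * (2 * m + 11) + 4) + 1) \<and>
      agree {''E''} s2 s3 \<and> (\<forall>i<r. \<forall>j<r. s3 ''E'' (ix 0 i j) = gram m a w i j)"
    by (rule run_gram_prog[where a = a and \<omega> = w, OF _ a r]) (rule w2')
  then obtain s3 where
    r3: "run (gram_prog m r a) s2 s3 (m * m * (2 * ixbound m + m * (2 * m + 11) + 4) + 1)"
    and a3: "agree {''E''} s2 s3"
    and E3: "\<forall>i<r. \<forall>j<r. s3 ''E'' (ix 0 i j) = gram m a w i j" by blast
  have E3': "s3 ''E'' (ix 0 i j) = gram m a w i j" if "i < r" "j < r" for i j
    using E3 that by blast
  have "\<exists>s4. run (elim_prog r) s3 s4 (m * (m * m * (10 * ixbound m + 14) + 2) + 1) \<and>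
      agree {''E''} s3 s4 \<and> (\<forall>k\<le>r. \<forall>i<r. \<forall>j<r. s4 ''E'' (ix k i j) = elim (gram m a w) k i j)"
    by (rule run_elim_prog[where f = "gram m a w", OF _ piv[OF w0] r]) (rule E3')
  then obtain s4 where
    r4: "run (elim_prog r) s3 s4 (m * (m * m * (10 * ixbound m + 14) + 2) + 1)"
    and a4: "agree {''E''} s3 s4"
    and E4: "\<forall>k\<le>r. \<forall>i<r. \<forall>j<r. s4 ''E'' (ix k i j) = elim (gram m a w) k i j" by blast
  have s4: "s4 ''q'' 0 = of_nat Q" "s4 ''t'' 0 = of_int \<tau>" "s4 ''M'' 0 = 2 ^ Suc m"
      "s4 ''X'' 0 = ?X" "s4 ''z'' 0 = ?X ^ Q"
    using s1 a2 a3 a4 by (simp_all add: agree_def)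
  have "(\<Prod>k<r. s4 ''E'' (ix k k k)) = (\<Prod>k<r. elim (gram m a w) k k k)"
    by (rule prod.cong[OF refl]) (use E4 in simp)
  also have "\<dots> = (\<Sum>S\<in>bases \<I>. \<Prod>i\<in>S. w i)" by (rule sum[OF w0])
  also have "\<dots> = (\<Sum>S\<in>bases \<I>. ?X powi (- cost \<kappa> S))"
  proof (rule sum.cong[OF refl])
    fix S
    show "(\<Prod>i\<in>S. w i) = ?X powi (- cost \<kappa> S)"
      unfolding w_def cost_def by (rule prod_power_int) (use X0 in simp)
  qed
  finally have prod: "(\<Prod>k<r. s4 ''E'' (ix k k k)) = (\<Sum>S\<in>bases \<I>. ?X powi (- cost \<kappa> S))" .
  have \<tau>: "- int Q - 1 \<le> \<tau>" "\<tau> \<le> int Q" by (auto simp: \<tau>_def)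
  from run_finish_prog[where s = s4 and m = m and Q = Q, OF s4(1,2) \<tau> s4(3-5) r prod B cost]
  obtain s5 where r5: "run (finish_prog r) s4 s5 (finish_time m Q)"
    and a5: "agree {''n'', ''p'', ''y'', ''N''} s4 s5"
    and N5: "s5 ''N'' 0 = of_nat (card {S \<in> bases \<I>. cost \<kappa> S \<le> \<tau>})" by blast
  \<comment> \<open>All costs lie in [-Q, Q]. The clamped threshold Q admits every basis and -Q - 1
    admits none, so clamping changes no comparison.\<close>
  have "cost \<kappa> S \<le> \<tau> \<longleftrightarrow> cost \<kappa> S \<le> \<K>" if "S \<in> bases \<I>" for S
    using cost[OF that] by (auto simp: \<tau>_def)
  then have "{S \<in> bases \<I>. cost \<kappa> S \<le> \<tau>} = bases_within \<I> \<kappa> \<K>"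
    unfolding bases_within_def by blast
  moreover have "run (count_prog m r a) s s5 (count_time m Q)"
    unfolding count_prog_def
    by (rule run_SeqI[OF r1 run_Seq[OF r2 run_Seq[OF r3 run_Seq[OF r4 r5]]]])
      (simp add: count_time_def)
  moreover have "agree work_vars s s5"
    using a1 a2 a3 a4 a5 by (simp add: agree_def work_vars_def)
  ultimately show ?thesis using N5 unfolding Q_def by metis
qed

definition count_size :: "nat \<Rightarrow> nat" where
  "count_size m = (m * (4 * m + 6) + 4 * m + 150) + (m * (4 * m + 61) + 1) +
    (m * m * (2 * ixbound m + m * (2 * m + 11) + 4) + 1) +
    (m * (m * m * (10 * ixbound m + 14) + 2) + 1) + (m * (2 * ixbound m + 3) + 200) + 4"

lemma csize_pow_prog: "csize (pow_prog e) = asize e + 26"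
  by (simp add: pow_prog_def)

lemma csize_count_prog:
  assumes r: "r \<le> m"
  shows "csize (count_prog m r a) \<le> count_size m"
proof -
  have init: "csize (init_prog m) \<le> m * (4 * m + 6) + 4 * m + 150"
    using sq_expr_size[of m] unfolding init_prog_def sq_prog_def by (simp add: csize_pow_prog del: upt_Suc)
  have weight: "csize (weight_prog m) \<le> m * (4 * m + 61) + 1"
  proof -
    let ?cs = "map (\<lambda>i. Seq (pow_prog (Sub (var ''q'') (cK i)))
      (Assign ''w'' (num i) (Div (var ''p'') (var ''z'')))) [1..<Suc m]"
    have "csize (seqs ?cs) \<le> length ?cs * (4 * m + 60 + 1) + 1"
      by (rule csize_seqs) (auto simp: csize_pow_prog simp del: upt_Suc)
    moreover have "length ?cs = m" by simp
    ultimately have "csize (seqs ?cs) \<le> m * (4 * m + 60 + 1) + 1" by (simp only:)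
    also have "\<dots> = m * (4 * m + 61) + 1" by simp
    finally show ?thesis unfolding weight_prog_def .
  qed
  have gram: "csize (gram_prog m r a) \<le> m * m * (2 * ixbound m + m * (2 * m + 11) + 4) + 1"
  proof -
    let ?T = "2 * ixbound m + m * (2 * m + 11) + 3"
    have "csize (gram_prog m r a) \<le> length (pairs r) * (?T + 1) + 1"
      unfolding gram_prog_def
    proof (rule csize_assigns)
      fix x assume "x \<in> set (pairs r)"
      then obtain j l where jl: "x = (j, l)" "j < r" "l < r" by auto
      have "ix 0 j l \<le> ixbound m" by (rule ix_le) (use jl r in auto)
      then show "2 * (case x of (j, l) \<Rightarrow> ix 0 j l) + asize (gram_entry m a x) + 2 \<le> ?T"
        unfolding jl(1) prod.case using asize_gram_entry[of m a "(j, l)"] by linarith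
    qed
    also have "\<dots> \<le> m * m * (2 * ixbound m + m * (2 * m + 11) + 4) + 1"
      by (rule pairs_time[OF r]) simp
    finally show ?thesis .
  qed
  have elim: "csize (elim_prog r) \<le> m * (m * m * (10 * ixbound m + 14) + 2) + 1"
  proof -
    let ?T' = "m * m * (10 * ixbound m + 14) + 1"
    let ?f = "\<lambda>k. assigns ''E'' (pairs r) (\<lambda>(i, j). ix (Suc k) i j) (elim_entry k)"
    have "csize (seqs (map ?f [0..<r])) \<le> length (map ?f [0..<r]) * (?T' + 1) + 1"
    proof (rule csize_seqs)
      fix c assume "c \<in> set (map ?f [0..<r])"
      then obtain k where k: "k < r" "c = ?f k" by auto
      have "csize c \<le> length (pairs r) * (10 * ixbound m + 13 + 1) + 1"
        unfolding k(2) by (rule csize_assigns) (rule elim_entry_size[OF _ k(1) r])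
      also have "\<dots> \<le> ?T'" by (rule pairs_time[OF r]) simp
      finally show "csize c \<le> ?T'" .
    qed
    also have "\<dots> \<le> m * (?T' + 1) + 1" using r by (intro add_mono mult_le_mono) auto
    finally show ?thesis unfolding elim_prog_def by simp
  qed
  have finish: "csize (finish_prog r) \<le> m * (2 * ixbound m + 3) + 200"
    using asize_pivot_product[OF r]
    by (simp add: finish_prog_def csize_pow_prog double_prog_def reduce_prog_def)
  show ?thesis unfolding count_prog_def count_size_def
    using init weight gram elim finish by simp
qed

text \<open>Closed under sums and products, so the explicit time bounds are recognized as
  polynomials from their syntax, without computing coefficients.\<close>

definition poly_fun :: "(nat \<Rightarrow> nat \<Rightarrow> nat) \<Rightarrow> bool" where
  "poly_fun f \<longleftrightarrow> (\<exists>p. \<forall>x y. f x y = poly2 p x y)"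

lemma poly_fun_const: "poly_fun (\<lambda>x y. c)"
  unfolding poly_fun_def by (rule exI[of _ "[:[:c:]:]"]) (simp add: poly2_def)

lemma poly_fun_fst: "poly_fun (\<lambda>x y. x)"
  unfolding poly_fun_def by (rule exI[of _ "[:0, 1:]"]) (simp add: poly2_def)

lemma poly_fun_snd: "poly_fun (\<lambda>x y. y)"
  unfolding poly_fun_def by (rule exI[of _ "[:[:0, 1:]:]"]) (simp add: poly2_def)

lemma poly_fun_add:
  assumes "poly_fun f" "poly_fun g"
  shows "poly_fun (\<lambda>x y. f x y + g x y)"
proof -
  obtain p q where "\<forall>x y. f x y = poly2 p x y" "\<forall>x y. g x y = poly2 q x y"
    using assms by (auto simp: poly_fun_def)
  then show ?thesis unfolding poly_fun_def by (intro exI[of _ "p + q"]) (simp add: poly2_def)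
qed

lemma poly_fun_mult:
  assumes "poly_fun f" "poly_fun g"
  shows "poly_fun (\<lambda>x y. f x y * g x y)"
proof -
  obtain p q where "\<forall>x y. f x y = poly2 p x y" "\<forall>x y. g x y = poly2 q x y"
    using assms by (auto simp: poly_fun_def)
  then show ?thesis unfolding poly_fun_def by (intro exI[of _ "p * q"]) (simp add: poly2_def)
qed

lemma poly_fun_power2: "poly_fun f \<Longrightarrow> poly_fun (\<lambda>x y. (f x y)\<^sup>2)"
  unfolding power2_eq_square by (rule poly_fun_mult)

lemmas poly_fun_intros = poly_fun_const poly_fun_fst poly_fun_snd poly_fun_add poly_fun_mult
  poly_fun_power2

lemma poly_fun_ixbound: "poly_fun (\<lambda>x y. ixbound x)"
  unfolding ixbound_def by (intro poly_fun_intros)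

lemma poly_fun_count_time: "poly_fun Q \<Longrightarrow> poly_fun (\<lambda>x y. count_time x (Q x y))"
  unfolding count_time_def finish_time_def by (intro poly_fun_intros poly_fun_ixbound)

lemma poly_fun_count_size: "poly_fun (\<lambda>x y. count_size x)"
  unfolding count_size_def by (intro poly_fun_intros poly_fun_ixbound)

section \<open>The sampling program\<close>

text \<open>The contract between counting and sampling; the sampler is verified for any program that
  fulfills it.\<close>

definition counts :: "nat \<Rightarrow> nat set set \<Rightarrow> com \<Rightarrow> bool" where
  "counts m \<I> P \<longleftrightarrow> (\<forall>s \<kappa> \<K>. (\<forall>i\<in>{1..m}. s ''k'' i = of_int (\<kappa> i)) \<longrightarrow> s ''K'' 0 = of_int \<K> \<longrightarrow>
    (\<exists>s'. run P s s' (count_time m (sqsum m \<kappa>)) \<and> agree work_vars s s' \<and>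
      s' ''N'' 0 = of_nat (card (bases_within \<I> \<kappa> \<K>))))"

definition penalized :: "(nat \<Rightarrow> int) \<Rightarrow> int \<Rightarrow> nat \<Rightarrow> nat set \<Rightarrow> nat \<Rightarrow> int" where
  "penalized c B i T j = c j + (if j \<in> T then - B else 0) + (if j \<in> {1..i} - T then B else 0)"

lemma cost_penalized:
  assumes "finite S"
  shows "cost (penalized c B i T) S =
    cost c S - B * int (card (S \<inter> T)) + B * int (card (S \<inter> ({1..i} - T)))"
  unfolding cost_def penalized_def sum.distrib
  using assms by (simp only: sum.inter_restrict[symmetric]) simp

definition extensions :: "nat set set \<Rightarrow> (nat \<Rightarrow> int) \<Rightarrow> int \<Rightarrow> nat \<Rightarrow> nat set \<Rightarrow> nat set set" where
  "extensions \<I> c C i T = {S \<in> bases_within \<I> c C. S \<inter> {1..i} = T}"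

text \<open>A basis that agrees with T on the first i elements is shifted by exactly -B |T|, and
  each deviation costs at least B more. As costs lie in [-Q, Q], B = 2 Q + 1 lifts a deviating basis
  to at least Q + 1 - B |T|, above the threshold. This is why the threshold is first lowered to at
  most Q, which excludes no basis.\<close>

lemma bases_within_penalized:
  assumes "matroid {1..m} \<I>" and T: "T \<subseteq> {1..i}" and Q: "Q = sqsum m c" and B: "B = 2 * int Q + 1"
  shows "bases_within \<I> (penalized c B i T) (min C (int Q) - B * int (card T)) = extensions \<I> c C i T"
proof -
  interpret matroid "{1..m}" \<I> by fact
  have "cost (penalized c B i T) S \<le> min C (int Q) - B * int (card T) \<longleftrightarrow>
      cost c S \<le> C \<and> S \<inter> {1..i} = T" if "S \<in> bases \<I>" for S
  proof -
    have S: "S \<subseteq> {1..m}" "finite S"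
      using that indep_subset_ground finite_indep by (auto simp: bases_def)
    have c: "\<bar>cost c S\<bar> \<le> int Q" unfolding Q by (rule cost_le_sqsum[OF S(1)])
    have T': "finite T" using T by (rule finite_subset) simp
    define x where "x = card (S \<inter> T)"
    define z where "z = card (S \<inter> ({1..i} - T))"
    have cost: "cost (penalized c B i T) S = cost c S - B * int x + B * int z"
      unfolding x_def z_def by (rule cost_penalized[OF S(2)])
    show ?thesis
    proof (cases "S \<inter> {1..i} = T")
      case True
      then have "S \<inter> T = T" "S \<inter> ({1..i} - T) = {}" by auto
      then show ?thesis using True c by (auto simp: cost x_def z_def)
    next
      case False
      have x: "x \<le> card T" unfolding x_def using T' by (intro card_mono) auto
      have "x < card T \<or> 0 < z"
      proof (rule ccontr)
        assume "\<not> (x < card T \<or> 0 < z)"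
        then have "card T \<le> x" "z = 0" by auto
        then have "S \<inter> T = T" "S \<inter> ({1..i} - T) = {}"
          using card_seteq[OF T', of "S \<inter> T"] S(2) by (auto simp: x_def z_def)
        then show False using False T by blast
      qed
      then have "int z - int x \<ge> 1 - int (card T)" using x by linarith
      then have "B * (int z - int x) \<ge> B * (1 - int (card T))"
        by (rule mult_left_mono) (simp add: B)
      then have "cost (penalized c B i T) S \<ge> cost c S + B - B * int (card T)"
        unfolding cost by (simp add: algebra_simps)
      then show ?thesis using c False by (simp add: B)
    qed
  qed
  then show ?thesis unfolding bases_within_def extensions_def by blast
qed

text \<open>A penalized cost is at most Q + B = 3 Q + 1 in absolute value. So the penalties keep the
  time of each count polynomial in m and Q.\<close>

lemma sqsum_penalized:
  assumes Q: "Q = sqsum m c" and B: "B = 2 * int Q + 1"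
  shows "sqsum m (penalized c B i T) \<le> m * (3 * Q + 1)\<^sup>2"
proof -
  have "(\<Sum>j=1..m. (penalized c B i T j)\<^sup>2) \<le> of_nat (card {1..m}) * (int (3 * Q + 1))\<^sup>2"
  proof (rule sum_bounded_above)
    fix j assume "j \<in> {1..m}"
    then have "\<bar>c j\<bar> \<le> int Q" unfolding Q by (rule sqsum_ge)
    then have "\<bar>penalized c B i T j\<bar> \<le> \<bar>int (3 * Q + 1)\<bar>" by (auto simp: penalized_def B)
    then show "(penalized c B i T j)\<^sup>2 \<le> (int (3 * Q + 1))\<^sup>2" by (simp only: abs_le_square_iff)
  qed
  then have "int (sqsum m (penalized c B i T)) \<le> int (m * (3 * Q + 1)\<^sup>2)"
    unfolding int_sqsum by simp
  then show ?thesis by (simp only: of_nat_le_iff)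
qed

text \<open>\<open>D\<close> receives the number of extensions of the decisions made so far. Then
  element i is chosen tentatively, lowering both its cost and the threshold by \<open>B\<close>, and
  \<open>N\<close> receives the number of extensions containing it.\<close>

definition sample_pre :: "com \<Rightarrow> nat \<Rightarrow> com" where
  "sample_pre P i = Seq P (Seq (setv ''D'' (var ''N''))
    (Seq (Assign ''k'' (num i) (Sub (cK i) (var ''B'')))
    (Seq (setv ''K'' (Sub (var ''K'') (var ''B''))) P)))"

text \<open>Corrects the tentative choice after a rejection: the cost moves from c - B to c + B,
  hence \<open>B\<close> is added twice, and the threshold is restored.\<close>

definition sample_post :: "nat \<Rightarrow> com" where
  "sample_post i = Cond (Less (Cell ''out'' (num i)) One)
    (Seq (Assign ''k'' (num i) (Add (Add (cK i) (var ''B'')) (var ''B'')))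
      (setv ''K'' (Add (var ''K'') (var ''B'')))) Skip"

definition sample_step :: "com \<Rightarrow> nat \<Rightarrow> com" where
  "sample_step P i = Seq (sample_pre P i)
    (Seq (Toss ''out'' (num i) (Div (var ''N'') (var ''D''))) (sample_post i))"

definition sample_init :: "nat \<Rightarrow> com" where
  "sample_init m = Seq (assigns ''k'' [1..<Suc m] (\<lambda>i. i) (\<lambda>i. Cell ''c'' (num i)))
    (Seq (sq_prog m)
    (Seq (setv ''B'' (Add (Add (var ''q'') (var ''q'')) One))
    (Seq (setv ''K'' (var ''C''))
    (Cond (Less (var ''q'') (var ''C'')) (setv ''K'' (var ''q'')) Skip))))"

definition sample_prog :: "nat \<Rightarrow> com \<Rightarrow> com" where
  "sample_prog m P = Seq (sample_init m) (seqs (map (sample_step P) [1..<Suc m]))"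

lemma exec_Seq_return:
  assumes "exec c s (return_pmf (s1, t))" "exec d s1 D"
  shows "exec (Seq c d) s (tick (t + 1) D)"
proof -
  have "exec (Seq c d) s (bind_pmf (return_pmf (s1, t)) (\<lambda>(s', t). tick (t + 1) D))"
    by (rule exec.Seq[OF assms(1)]) (use assms(2) in auto)
  then show ?thesis by (simp add: bind_return_pmf)
qed

text \<open>\<open>exec.Seq\<close> wants the continuation as a function of the intermediate state.
  Injectivity lets it recover the outcome r from that state.\<close>

lemma exec_Seq_map:
  assumes c: "exec c s (map_pmf f M)" and inj: "inj (\<lambda>r. fst (f r))"
    and d: "\<And>r. exec d (fst (f r)) (return_pmf (h r))"
  shows "exec (Seq c d) s (map_pmf (\<lambda>r. (fst (h r), snd (f r) + 1 + snd (h r))) M)"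
proof -
  let ?F = "\<lambda>s'. return_pmf (h (inv_into UNIV (\<lambda>r. fst (f r)) s'))"
  have inv: "inv_into UNIV (\<lambda>r. fst (f r)) (fst (f r)) = r" for r using inv_f_f[OF inj, of r] by simp
  have "exec (Seq c d) s (bind_pmf (map_pmf f M) (\<lambda>(s', t). tick (t + 1) (?F s')))"
  proof (rule exec.Seq[OF c])
    fix s' t assume "(s', t) \<in> set_pmf (map_pmf f M)"
    then obtain r where "f r = (s', t)" by auto
    then have "s' = fst (f r)" by simp
    then show "exec d s' (?F s')" using d[of r] by (simp only: inv)
  qed
  also have "bind_pmf (map_pmf f M) (\<lambda>(s', t). tick (t + 1) (?F s')) =
      map_pmf (\<lambda>r. (fst (h r), snd (f r) + 1 + snd (h r))) M"
    by (simp add: map_pmf_def bind_assoc_pmf bind_return_pmf tick_def case_prod_beta inv)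
  finally show ?thesis .
qed

lemma bernoulli_pmf_0: "bernoulli_pmf 0 = return_pmf False"
proof (rule pmf_eqI)
  fix b show "pmf (bernoulli_pmf 0) b = pmf (return_pmf False) b" by (cases b) simp_all
qed

lemma bernoulli_pmf_1: "bernoulli_pmf 1 = return_pmf True"
proof (rule pmf_eqI)
  fix b show "pmf (bernoulli_pmf 1) b = pmf (return_pmf True) b" by (cases b) simp_all
qed

text \<open>The uniform distribution on A is the mixture of those on the two parts, with weights
  proportional to their sizes.\<close>

lemma pmf_of_set_bernoulli:
  fixes A A1 A0 :: "'b set"
  assumes "finite A" "A \<noteq> {}" "A = A1 \<union> A0" "A1 \<inter> A0 = {}"
  shows "bind_pmf (bernoulli_pmf (real (card A1) / real (card A)))
    (\<lambda>r. pmf_of_set (if r then A1 else A0)) = pmf_of_set A"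
proof (rule pmf_eqI)
  fix x :: 'b
  let ?p = "real (card A1) / real (card A)"
  have fin: "finite A1" "finite A0" using assms by auto
  have cA: "card A = card A1 + card A0" using assms fin by (simp add: card_Un_disjoint)
  have A0: "0 < card A" using assms by (simp add: card_gt_0_iff)
  have "real (card A1) \<le> real (card A)" by (simp add: cA)
  then have p: "0 \<le> ?p" "?p \<le> 1" using A0 by (simp_all add: divide_le_eq_1_pos)
  have q: "1 - ?p = real (card A0) / real (card A)"
  proof -
    have "real (card A0) = real (card A) - real (card A1)" by (simp add: cA)
    then show ?thesis using A0 by (simp add: diff_divide_distrib)
  qed
  \<comment> \<open>If B is empty, \<open>pmf_of_set B\<close> carries no information, but its
    weight is 0 and both sides vanish.\<close>
  have w: "real (card B) / real (card A) * pmf (pmf_of_set B) x = indicator B x / real (card A)"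
    if "finite B" for B
  proof (cases "B = {}")
    case False
    then have "0 < card B" using that by (simp add: card_gt_0_iff)
    then show ?thesis using that False by (simp add: pmf_of_set)
  qed simp
  have "pmf (bind_pmf (bernoulli_pmf ?p) (\<lambda>r. pmf_of_set (if r then A1 else A0))) x =
      ?p * pmf (pmf_of_set A1) x + (1 - ?p) * pmf (pmf_of_set A0) x"
    unfolding pmf_bind using p by (simp add: integral_bernoulli_pmf)
  also have "\<dots> = indicator A1 x / real (card A) + indicator A0 x / real (card A)"
    unfolding q w[OF fin(1)] w[OF fin(2)] ..
  also have "\<dots> = indicator A x / real (card A)"
    using assms by (auto simp: indicator_def)
  also have "\<dots> = pmf (pmf_of_set A) x" using assms by (simp add: pmf_of_set)
  finally show "pmf (bind_pmf (bernoulli_pmf ?p) (\<lambda>r. pmf_of_set (if r then A1 else A0))) x =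
    pmf (pmf_of_set A) x" .
qed

section \<open>Correctness of the sampler\<close>

definition sample_inv ::
    "nat \<Rightarrow> (nat \<Rightarrow> int) \<Rightarrow> int \<Rightarrow> int \<Rightarrow> nat \<Rightarrow> nat set \<Rightarrow> state \<Rightarrow> bool" where
  "sample_inv m c B K i T s \<longleftrightarrow> T \<subseteq> {1..i} \<and> (\<forall>j\<in>{1..m}. s ''k'' j = of_int (penalized c B i T j)) \<and>
    s ''K'' 0 = of_int (K - B * int (card T)) \<and> s ''B'' 0 = of_int B \<and>
    (\<forall>j\<in>{1..m}. s ''out'' j = (if j \<in> T then 1 else 0))"

lemma sample_inv_out_set:
  assumes "sample_inv m c B K i T s" "i \<le> m"
  shows "out_set m s = T"
proof -
  have "T \<subseteq> {1..m}" using assms by (auto simp: sample_inv_def)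
  moreover have "s ''out'' j = 1 \<longleftrightarrow> j \<in> T" if "j \<in> {1..m}" for j
    using assms that by (simp add: sample_inv_def)
  ultimately show ?thesis unfolding out_set_def by blast
qed

definition step_time :: "nat \<Rightarrow> nat \<Rightarrow> nat" where
  "step_time m Q = 2 * count_time m (m * (3 * Q + 1)\<^sup>2) + 12 * m + 80"

context
  fixes m :: nat and \<I> :: "nat set set" and P :: com and c :: "nat \<Rightarrow> int" and C :: int
    and Q :: nat and B :: int
  assumes mat: "matroid {1..m} \<I>" and P: "counts m \<I> P"
    and Q: "Q = sqsum m c" and B: "B = 2 * int Q + 1"
begin

abbreviation "ext i T \<equiv> extensions \<I> c C i T"
abbreviation "sinv i T s \<equiv> sample_inv m c B (min C (int Q)) i T s"

lemma run_count_penalized: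
  assumes T: "T \<subseteq> {1..i}" and k: "\<forall>j\<in>{1..m}. s ''k'' j = of_int (penalized c B i T j)"
    and K: "s ''K'' 0 = of_int (min C (int Q) - B * int (card T))"
  obtains s' where "run P s s' (count_time m (m * (3 * Q + 1)\<^sup>2))" "agree work_vars s s'"
    "s' ''N'' 0 = of_nat (card (ext i T))"
proof -
  obtain s' where s': "run P s s' (count_time m (sqsum m (penalized c B i T)))" "agree work_vars s s'"
    "s' ''N'' 0 = of_nat (card (bases_within \<I> (penalized c B i T) (min C (int Q) - B * int (card T))))"
    using P[unfolded counts_def] k K by blast
  have "run P s s' (count_time m (m * (3 * Q + 1)\<^sup>2))"
    by (rule run_mono[OF s'(1) count_time_mono[OF sqsum_penalized[OF Q B]]])
  then show thesis using s'(2,3) unfolding bases_within_penalized[OF mat T Q B] by (rule that)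
qed

text \<open>Everything except the toss is deterministic, so the joint distribution of state and time
  is an image g of the coin, and the invariant can be stated separately for each outcome.\<close>

lemma exec_sample_step:
  assumes inv: "sinv i T s" and i: "i < m" and ne: "ext i T \<noteq> {}" "finite (ext i T)"
  shows "\<exists>g. exec (sample_step P (Suc i)) s
      (map_pmf g (bernoulli_pmf (real (card (ext (Suc i) (insert (Suc i) T))) / real (card (ext i T))))) \<and>
    (\<forall>r. sinv (Suc i) (if r then insert (Suc i) T else T) (fst (g r)) \<and> snd (g r) \<le> step_time m Q)"
proof -
  define l where "l = Suc i"
  define T1 where "T1 = insert l T"
  define K where "K = min C (int Q)"
  let ?t = "count_time m (m * (3 * Q + 1)\<^sup>2)"
  have l: "l \<in> {1..m}" using i by (simp add: l_def)
  have T: "T \<subseteq> {1..i}" and k: "\<forall>j\<in>{1..m}. s ''k'' j = of_int (penalized c B i T j)"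
    and K0: "s ''K'' 0 = of_int (K - B * int (card T))" and B0: "s ''B'' 0 = of_int B"
    and out: "\<forall>j\<in>{1..m}. s ''out'' j = (if j \<in> T then 1 else 0)"
    using inv by (simp_all add: sample_inv_def K_def)
  have "finite T" using T by (rule finite_subset) simp
  have lT: "l \<notin> T" using T by (auto simp: l_def)
  have T1: "T1 \<subseteq> {1..l}" using T by (auto simp: T1_def l_def)
  have cT1: "int (card T1) = int (card T) + 1" using \<open>finite T\<close> lT by (simp add: T1_def)
  have pen: "penalized c B i T l = c l" "penalized c B l T1 l = c l - B" "penalized c B l T l = c l + B"
    using lT by (auto simp: penalized_def T1_def l_def)
  have pen': "penalized c B l T1 j = penalized c B i T j" "penalized c B l T j = penalized c B i T j"
    if "j \<noteq> l" for j
    using that by (auto simp: penalized_def T1_def l_def)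
  obtain s1 where r1: "run P s s1 ?t" and a1: "agree work_vars s s1"
    and N1: "s1 ''N'' 0 = of_nat (card (ext i T))"
    by (rule run_count_penalized[OF T k K0[unfolded K_def]])
  let ?s2 = "update s1 ''D'' 0 (of_nat (card (ext i T)))"
  let ?s3 = "update ?s2 ''k'' l (of_int (c l - B))"
  let ?s4 = "update ?s3 ''K'' 0 (of_int (K - B * int (card T1)))"
  have s1: "s1 ''k'' = s ''k''" "s1 ''K'' = s ''K''" "s1 ''B'' = s ''B''" "s1 ''out'' = s ''out''"
    using a1 by (simp_all add: agree_def work_vars_def)
  have r2: "run (setv ''D'' (var ''N'')) s1 ?s2 4" by (rule run_setv) (simp_all add: N1)
  have e3: "aval (Sub (cK l) (var ''B'')) ?s2 = of_int (c l - B)"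
    using k l by (simp add: s1 B0 pen)
  have "run (Assign ''k'' (num l) (Sub (cK l) (var ''B''))) ?s2
      (update ?s2 ''k'' l (aval (Sub (cK l) (var ''B'')) ?s2))
      (asize (num l) + asize (Sub (cK l) (var ''B'')) + 1)"
    by (rule run_Assign) simp_all
  then have r3: "run (Assign ''k'' (num l) (Sub (cK l) (var ''B''))) ?s2 ?s3 (4 * m + 8)"
    unfolding e3 by (rule run_mono) (use l in simp)
  have r4: "run (setv ''K'' (Sub (var ''K'') (var ''B''))) ?s3 ?s4 7"
    by (rule run_setv) (simp_all add: s1 K0 B0 cT1 algebra_simps)
  have k4: "\<forall>j\<in>{1..m}. ?s4 ''k'' j = of_int (penalized c B l T1 j)"
    using k pen' by (auto simp: pen s1)
  have K4: "?s4 ''K'' 0 = of_int (min C (int Q) - B * int (card T1))" by (simp add: K_def)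
  obtain s5 where r5: "run P ?s4 s5 ?t" and a5: "agree work_vars ?s4 s5"
    and N5: "s5 ''N'' 0 = of_nat (card (ext l T1))"
    by (rule run_count_penalized[OF T1 k4 K4])
  have s5: "s5 ''k'' = ?s4 ''k''" "s5 ''K'' = ?s4 ''K''" "s5 ''B'' = s ''B''" "s5 ''out'' = s ''out''"
      "s5 ''D'' 0 = of_nat (card (ext i T))"
    using a5 by (simp_all add: agree_def work_vars_def s1)
  have "run (sample_pre P l) s s5 (2 * ?t + 4 * m + 30)"
    unfolding sample_pre_def by (rule run_SeqI[OF r1 run_Seq[OF r2 run_Seq[OF r3 run_Seq[OF r4 r5]]]]) simp
  then obtain t5 where t5: "t5 \<le> 2 * ?t + 4 * m + 30" and x5: "exec (sample_pre P l) s (return_pmf (s5, t5))"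
    unfolding run_def by blast
  \<comment> \<open>Bounds the bias by 1; a toss with any other bias would get stuck.\<close>
  have sub: "ext l T1 \<subseteq> ext i T"
  proof
    fix S assume "S \<in> ext l T1"
    then have "S \<in> bases_within \<I> c C" "S \<inter> {1..l} = T1" by (simp_all add: extensions_def)
    moreover have "S \<inter> {1..i} = S \<inter> {1..l} - {l}" by (auto simp: l_def)
    ultimately show "S \<in> ext i T" using lT by (simp add: extensions_def T1_def)
  qed
  let ?p = "real (card (ext l T1)) / real (card (ext i T))"
  let ?div = "Div (var ''N'') (var ''D'')"
  have D0: "0 < card (ext i T)" using ne by (simp add: card_gt_0_iff)
  have le: "card (ext l T1) \<le> card (ext i T)" by (rule card_mono[OF ne(2) sub])
  have div: "aval ?div s5 = of_nat (card (ext l T1)) / of_nat (card (ext i T))" by (simp add: N5 s5)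
  define f where "f r = (update s5 ''out'' l (if r then 1 else 0), asize (num l) + asize ?div + 1)" for r
  have x6: "exec (Toss ''out'' (num l) ?div) s5 (map_pmf f (bernoulli_pmf ?p))"
  proof -
    have "exec (Toss ''out'' (num l) ?div) s5
      (map_pmf (\<lambda>r. (update s5 ''out'' (nat \<lfloor>aval (num l) s5\<rfloor>) (if r then 1 else 0),
        asize (num l) + asize ?div + 1)) (bernoulli_pmf (real_of_rat (aval ?div s5))))"
    proof (rule exec.Toss)
      show "alegal ?div s5" using D0 by (simp add: s5)
      show "0 \<le> aval ?div s5" unfolding div by simp
      show "aval ?div s5 \<le> 1" unfolding div using D0 le by (simp add: divide_le_eq_1)
    qed simp_all
    moreover have "real_of_rat (aval ?div s5) = ?p" unfolding div by (simp add: of_rat_divide)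
    ultimately show ?thesis by (simp add: f_def[abs_def])
  qed
  \<comment> \<open>The outcome can be read off the cell just written.\<close>
  have inj: "inj (\<lambda>r. fst (f r))"
  proof (rule injI)
    fix r r' assume "fst (f r) = fst (f r')"
    then have "fst (f r) ''out'' l = fst (f r') ''out'' l" by simp
    then show "r = r'" by (simp add: f_def split: if_splits)
  qed
  have "\<exists>h. exec (sample_post l) (fst (f r)) (return_pmf h) \<and>
      sinv l (if r then T1 else T) (fst h) \<and> snd h \<le> 6 * m + 40" for r
  proof -
    let ?s6 = "update s5 ''out'' l (if r then 1 else 0)"
    let ?b = "Less (Cell ''out'' (num l)) One"
    let ?e = "Add (Add (cK l) (var ''B'')) (var ''B'')"
    let ?s7 = "update ?s6 ''k'' l (of_int (c l + B))"
    let ?s8 = "update ?s7 ''K'' 0 (of_int (K - B * int (card T)))"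
    let ?s' = "if r then ?s6 else ?s8"
    have "run (sample_post l) ?s6 ?s' (bsize ?b + 1 + (4 * m + 20))"
      unfolding sample_post_def
    proof (rule run_Cond)
      assume "bval ?b ?s6"
      then have r: "\<not> r" by (auto split: if_splits)
      have e: "aval ?e ?s6 = of_int (c l + B)" by (simp add: s5 s1 B0)
      have "run (Assign ''k'' (num l) ?e) ?s6 (update ?s6 ''k'' l (aval ?e ?s6))
          (asize (num l) + asize ?e + 1)"
        by (rule run_Assign) simp_all
      then have r7: "run (Assign ''k'' (num l) ?e) ?s6 ?s7 (asize (num l) + asize ?e + 1)"
        by (simp only: e)
      have r8: "run (setv ''K'' (Add (var ''K'') (var ''B''))) ?s7 ?s8 7"
        by (rule run_setv) (simp_all add: s5 s1 B0 cT1 algebra_simps)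
      have "run (Seq (Assign ''k'' (num l) ?e) (setv ''K'' (Add (var ''K'') (var ''B'')))) ?s6 ?s8 (4 * m + 20)"
        by (rule run_SeqI[OF r7 r8]) (use l in simp)
      then show "run (Seq (Assign ''k'' (num l) ?e) (setv ''K'' (Add (var ''K'') (var ''B'')))) ?s6 ?s'
        (4 * m + 20)" using r by simp
    next
      assume "\<not> bval ?b ?s6"
      then have r: r by (auto split: if_splits)
      have "run Skip ?s6 ?s6 (4 * m + 20)" by (rule run_mono[OF run_Skip]) simp
      then show "run Skip ?s6 ?s' (4 * m + 20)" using r by simp
    qed simp
    then obtain t where "t \<le> bsize ?b + 1 + (4 * m + 20)"
      "exec (sample_post l) ?s6 (return_pmf (?s', t))" unfolding run_def by blast
    moreover have "sinv l (if r then T1 else T) ?s'"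
    proof (cases r)
      case True
      have "\<forall>j\<in>{1..m}. ?s6 ''out'' j = (if j \<in> T1 then 1 else 0)"
        using out True by (auto simp: s5 T1_def)
      moreover have "\<forall>j\<in>{1..m}. ?s6 ''k'' j = of_int (penalized c B l T1 j)" using k4 by (simp add: s5)
      ultimately show ?thesis using True T1 by (simp add: sample_inv_def s5 B0 K_def)
    next
      case False
      have "\<forall>j\<in>{1..m}. ?s8 ''out'' j = (if j \<in> T then 1 else 0)"
        using out False lT by (auto simp: s5)
      moreover have "\<forall>j\<in>{1..m}. ?s8 ''k'' j = of_int (penalized c B l T j)"
        using k pen' by (auto simp: s5 s1 pen)
      moreover have "T \<subseteq> {1..l}" using T by (auto simp: l_def)
      ultimately show ?thesis using False by (simp add: sample_inv_def s5 B0 K_def)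
    qed
    ultimately show ?thesis using l by (intro exI[of _ "(?s', t)"]) (simp add: f_def)
  qed
  then obtain h where h: "\<And>r. exec (sample_post l) (fst (f r)) (return_pmf (h r))"
    "\<And>r. sinv l (if r then T1 else T) (fst (h r))" "\<And>r. snd (h r) \<le> 6 * m + 40" by metis
  define g where "g r = (fst (h r), t5 + 1 + (snd (f r) + 1 + snd (h r)))" for r
  have "exec (sample_step P l) s (tick (t5 + 1)
      (map_pmf (\<lambda>r. (fst (h r), snd (f r) + 1 + snd (h r))) (bernoulli_pmf ?p)))"
    unfolding sample_step_def by (rule exec_Seq_return[OF x5 exec_Seq_map[OF x6 inj h(1)]])
  then have "exec (sample_step P l) s (map_pmf g (bernoulli_pmf ?p))"
    by (simp add: tick_def map_pmf_comp g_def[abs_def])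
  moreover have "snd (g r) \<le> step_time m Q" for r
    using t5 h(3)[of r] l by (simp add: g_def f_def step_time_def)
  ultimately show ?thesis using h(2) unfolding l_def[symmetric] T1_def[symmetric]
    by (intro exI[of _ g]) (simp add: g_def)
qed

text \<open>Induction on the number of undecided elements. The extensions of T split according to
  the next element, and the coin has the relative size of the part containing it, so uniformity on
  the parts gives uniformity on the whole. At i = m the only extension is T.\<close>

lemma exec_sample_rest:
  assumes "i \<le> m" "sinv i T s" "ext i T \<noteq> {}"
  shows "\<exists>D. exec (seqs (map (sample_step P) [Suc i..<Suc m])) s D \<and>
    map_pmf (\<lambda>(s, t). out_set m s) D = pmf_of_set (ext i T) \<and>
    (\<forall>(s, t)\<in>set_pmf D. t \<le> (m - i) * (step_time m Q + 1) + 1)"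
  using assms
proof (induction "m - i" arbitrary: i T s)
  case 0
  then have i: "i = m" by simp
  interpret matroid "{1..m}" \<I> by (rule mat)
  have "S = T" if "S \<in> ext i T" for S
    using that indep_subset_ground unfolding i extensions_def bases_within_def bases_def by blast
  then have ext: "ext i T = {T}" using 0(4) by blast
  have "out_set m s = T" by (rule sample_inv_out_set[OF 0(3)]) (simp add: i)
  then show ?case using exec.Skip[of s] unfolding ext unfolding i
    by (intro exI[of _ "return_pmf (s, 1)"]) (simp add: pmf_of_set_singleton)
next
  case (Suc d)
  then have i: "i < m" by simp
  interpret matroid "{1..m}" \<I> by (rule mat)
  have "bases \<I> \<subseteq> Pow {1..m}" using indep_subset_ground by (auto simp: bases_def)
  then have finb: "finite (bases \<I>)" by (rule finite_subset) simp
  have fin: "finite (ext i T)" for i T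
    by (rule finite_subset[OF _ finb]) (auto simp: extensions_def bases_within_def)
  define T' where "T' r = (if r then insert (Suc i) T else T)" for r
  have T: "T \<subseteq> {1..i}" using Suc.prems(2) by (simp add: sample_inv_def)
  have split: "ext i T = ext (Suc i) (T' True) \<union> ext (Suc i) (T' False)"
    "ext (Suc i) (T' True) \<inter> ext (Suc i) (T' False) = {}"
  proof -
    have nT: "Suc i \<notin> T" using T by auto
    have eq: "S \<inter> {1..i} = T \<longleftrightarrow> S \<inter> {1..Suc i} = T' True \<or> S \<inter> {1..Suc i} = T' False" for S
    proof (cases "Suc i \<in> S")
      case True
      then have "S \<inter> {1..Suc i} = insert (Suc i) (S \<inter> {1..i})" by (auto simp: le_Suc_eq)
      moreover have "Suc i \<notin> S \<inter> {1..i}" by simp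
      ultimately show ?thesis using nT insert_ident[of "Suc i" "S \<inter> {1..i}" T]
        by (auto simp: T'_def)
    next
      case False
      then have "S \<inter> {1..Suc i} = S \<inter> {1..i}" by (auto simp: le_Suc_eq)
      then show ?thesis using False by (auto simp: T'_def)
    qed
    show "ext i T = ext (Suc i) (T' True) \<union> ext (Suc i) (T' False)"
      unfolding extensions_def eq conj_disj_distribL by (rule Collect_disj_eq)
    have "T' True \<noteq> T' False" using nT by (auto simp: T'_def)
    then show "ext (Suc i) (T' True) \<inter> ext (Suc i) (T' False) = {}"
      by (auto simp: extensions_def)
  qed
  let ?p = "real (card (ext (Suc i) (T' True))) / real (card (ext i T))"
  let ?rest = "seqs (map (sample_step P) [Suc (Suc i)..<Suc m])"
  let ?t = "(m - Suc i) * (step_time m Q + 1) + 1"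
  obtain g where g: "exec (sample_step P (Suc i)) s (map_pmf g (bernoulli_pmf ?p))"
    and gi: "\<And>r. sinv (Suc i) (T' r) (fst (g r))" and gt: "\<And>r. snd (g r) \<le> step_time m Q"
    using exec_sample_step[OF Suc.prems(2) i Suc.prems(3) fin] by (auto simp: T'_def)
  have out: "out_set m (fst (g r)) = T' r" for r
    by (rule sample_inv_out_set[OF gi]) (use i in simp)
  \<comment> \<open>The induction hypothesis requires an extension to exist. A branch without
    extensions has probability 0 and is never entered.\<close>
  have ne: "ext (Suc i) (T' r) \<noteq> {}" if r: "r \<in> set_pmf (bernoulli_pmf ?p)" for r
  proof
    assume empty: "ext (Suc i) (T' r) = {}"
    have "0 < card (ext i T)" using Suc.prems(3) fin by (simp add: card_gt_0_iff)
    then have "?p = (if r then 0 else 1)" using empty split by (cases r) auto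
    then have "bernoulli_pmf ?p = bernoulli_pmf (if r then 0 else 1)" by (rule arg_cong)
    also have "\<dots> = return_pmf (\<not> r)" by (simp add: bernoulli_pmf_0 bernoulli_pmf_1)
    finally show False using r by simp
  qed
  \<comment> \<open>The continuation may depend on the state only. The decisions made so far are
    therefore expressed as \<open>out_set m s'\<close> and not through r.\<close>
  let ?good = "\<lambda>s' D. exec ?rest s' D \<and>
    map_pmf (\<lambda>(s, t). out_set m s) D = pmf_of_set (ext (Suc i) (out_set m s')) \<and>
    (\<forall>(s, t)\<in>set_pmf D. t \<le> ?t)"
  define F where "F s' = (SOME D. ?good s' D)" for s'
  have F: "?good (fst (g r)) (F (fst (g r)))" if r: "r \<in> set_pmf (bernoulli_pmf ?p)" for r
  proof -
    have "\<exists>D. ?good (fst (g r)) D"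
      unfolding out by (rule Suc.hyps(1)) (use Suc.hyps(2) i gi ne[OF r] in auto)
    then show ?thesis unfolding F_def by (rule someI_ex)
  qed
  let ?D = "bind_pmf (map_pmf g (bernoulli_pmf ?p)) (\<lambda>(s', t). tick (t + 1) (F s'))"
  have upt: "[Suc i..<Suc m] = Suc i # [Suc (Suc i)..<Suc m]" using i by (simp add: upt_conv_Cons del: upt_Suc)
  have "exec (seqs (map (sample_step P) [Suc i..<Suc m])) s ?D"
    unfolding upt list.map seqs.simps
  proof (rule exec.Seq[OF g])
    fix s' t assume "(s', t) \<in> set_pmf (map_pmf g (bernoulli_pmf ?p))"
    then obtain r where r: "r \<in> set_pmf (bernoulli_pmf ?p)" "(s', t) = g r"
      unfolding set_map_pmf by (rule imageE)
    have "s' = fst (g r)" by (subst r(2)[symmetric]) simp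
    then show "exec ?rest s' (F s')" using F[OF r(1)] by simp
  qed
  moreover have "map_pmf (\<lambda>(s, t). out_set m s) ?D = pmf_of_set (ext i T)"
  proof -
    have "map_pmf (\<lambda>(s, t). out_set m s) ?D =
        bind_pmf (bernoulli_pmf ?p) (\<lambda>r. map_pmf (\<lambda>(s, t). out_set m s) (F (fst (g r))))"
      by (simp add: map_bind_pmf bind_map_pmf case_prod_beta' tick_def map_pmf_comp)
    also have "\<dots> = bind_pmf (bernoulli_pmf ?p) (\<lambda>r. pmf_of_set (ext (Suc i) (T' r)))"
    proof (rule bind_pmf_cong[OF refl])
      fix r assume "r \<in> set_pmf (bernoulli_pmf ?p)"
      from F[OF this] show "map_pmf (\<lambda>(s, t). out_set m s) (F (fst (g r))) = pmf_of_set (ext (Suc i) (T' r))"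
        unfolding out by blast
    qed
    also have "(\<lambda>r. pmf_of_set (ext (Suc i) (T' r))) =
        (\<lambda>r. pmf_of_set (if r then ext (Suc i) (T' True) else ext (Suc i) (T' False)))"
    proof
      fix r show "pmf_of_set (ext (Suc i) (T' r)) =
        pmf_of_set (if r then ext (Suc i) (T' True) else ext (Suc i) (T' False))" by (cases r) simp_all
    qed
    also have "bind_pmf (bernoulli_pmf ?p) \<dots> = pmf_of_set (ext i T)"
      by (rule pmf_of_set_bernoulli[OF fin Suc.prems(3) split])
    finally show ?thesis .
  qed
  moreover have "\<forall>(s, t)\<in>set_pmf ?D. t \<le> (m - i) * (step_time m Q + 1) + 1"
  proof (intro ballI, clarify)
    fix s' t assume "(s', t) \<in> set_pmf ?D"
    then obtain r where r: "r \<in> set_pmf (bernoulli_pmf ?p)"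
      and "(s', t) \<in> set_pmf (tick (snd (g r) + 1) (F (fst (g r))))"
      by (auto simp: case_prod_beta)
    then obtain t' where t': "(s', t') \<in> set_pmf (F (fst (g r)))" "t = snd (g r) + 1 + t'"
      by (auto simp: tick_def)
    have "t' \<le> ?t" using F[OF r] t'(1) by blast
    moreover have "m - i = Suc (m - Suc i)" using i by simp
    ultimately show "t \<le> (m - i) * (step_time m Q + 1) + 1" using t'(2) gt[of r] by simp
  qed
  ultimately show ?case by blast
qed

end

section \<open>Loading the input and the total running time\<close>

definition load_prog :: "nat \<Rightarrow> com" where
  "load_prog m = assigns ''k'' [1..<Suc m] (\<lambda>i. i) (\<lambda>i. Cell ''c'' (num i))"

lemma run_load_prog:
  "\<exists>s'. run (load_prog m) (input m c C) s' (m * (4 * m + 5) + 1) \<and>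
    agree {''k''} (input m c C) s' \<and> (\<forall>i\<in>{1..m}. s' ''k'' i = of_int (c i))"
proof -
  let ?xs = "[1..<Suc m]"
  have set: "set ?xs = {1..m}" by (simp add: atLeastLessThanSuc_atLeastAtMost del: upt_Suc)
  have "\<exists>s'. run (load_prog m) (input m c C) s' (m * (4 * m + 5) + 1) \<and>
      agree {''k''} (input m c C) s' \<and>
      (\<forall>n. n \<notin> (\<lambda>i. i) ` set ?xs \<longrightarrow> s' ''k'' n = input m c C ''k'' n) \<and>
      (\<forall>x\<in>set ?xs. s' ''k'' x = of_int (c x))"
    unfolding load_prog_def
  proof (rule run_assigns[where T = "4 * m + 4"])
    show "inj_on (\<lambda>i. i) (set ?xs)" by simp
    fix x assume "x \<in> set ?xs"
    then have x: "x \<in> {1..m}" by (simp only: set)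
    then show "2 * x + asize (Cell ''c'' (num x)) + 2 \<le> 4 * m + 4" by simp
    fix s' assume "agree {''k''} (input m c C) s'"
    then have "s' ''c'' = input m c C ''c''" by (rule agreeD) simp
    then show "alegal (Cell ''c'' (num x)) s' \<and> aval (Cell ''c'' (num x)) s' = of_int (c x)"
      using x by (simp add: input_def)
  qed simp
  then show ?thesis unfolding set by blast
qed

lemma csize_load_prog: "csize (load_prog m) \<le> m * (4 * m + 5) + 1"
proof -
  have "csize (load_prog m) \<le> length [1..<Suc m] * (4 * m + 4 + 1) + 1"
    unfolding load_prog_def by (rule csize_assigns) (auto simp del: upt_Suc)
  then show ?thesis by (simp add: algebra_simps del: upt_Suc)
qed

definition counting_prog :: "nat \<Rightarrow> com \<Rightarrow> com" where
  "counting_prog m P = Seq (load_prog m) (Seq (setv ''K'' (var ''C''))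
    (Seq P (setv ''out'' (var ''N''))))"

lemma run_counting_prog:
  assumes "counts m \<I> P"
  shows "\<exists>s'. run (counting_prog m P) (input m c C) s'
      (m * (4 * m + 5) + count_time m (sqsum m c) + 20) \<and>
    out_number s' = of_nat (card (bases_within \<I> c C))"
proof -
  obtain s1 where r1: "run (load_prog m) (input m c C) s1 (m * (4 * m + 5) + 1)"
    and a1: "agree {''k''} (input m c C) s1" and k1: "\<forall>i\<in>{1..m}. s1 ''k'' i = of_int (c i)"
    using run_load_prog by blast
  let ?s2 = "update s1 ''K'' 0 (of_int C)"
  have "s1 ''C'' 0 = of_int C" using a1 by (simp add: agree_def input_def)
  then have r2: "run (setv ''K'' (var ''C'')) s1 ?s2 4" by (intro run_setv) simp_all
  have k2: "\<forall>i\<in>{1..m}. ?s2 ''k'' i = of_int (c i)" using k1 by simp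
  have K2: "?s2 ''K'' 0 = of_int C" by simp
  obtain s3 where r3: "run P ?s2 s3 (count_time m (sqsum m c))"
    and N3: "s3 ''N'' 0 = of_nat (card (bases_within \<I> c C))"
    using assms[unfolded counts_def] k2 K2 by blast
  let ?s4 = "update s3 ''out'' 0 (s3 ''N'' 0)"
  have r4: "run (setv ''out'' (var ''N'')) s3 ?s4 4" by (rule run_setv) simp_all
  have "run (counting_prog m P) (input m c C) ?s4 (m * (4 * m + 5) + count_time m (sqsum m c) + 20)"
    unfolding counting_prog_def by (rule run_SeqI[OF r1 run_Seq[OF r2 run_Seq[OF r3 r4]]]) simp
  then show ?thesis using N3 by (intro exI[of _ ?s4]) (simp add: out_number_def)
qed

lemma csize_counting_prog:
  assumes "csize P \<le> count_size m"
  shows "csize (counting_prog m P) \<le> m * (4 * m + 5) + count_size m + 20"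
  using csize_load_prog[of m] assms by (simp add: counting_prog_def)

lemma run_sample_init:
  assumes Q: "Q = sqsum m c" and B: "B = 2 * int Q + 1"
  shows "\<exists>s'. run (sample_init m) (input m c C) s' (m * (4 * m + 5) + m * (4 * m + 6) + 60) \<and>
    sample_inv m c B (min C (int Q)) 0 {} s'"
proof -
  obtain s1 where r1: "run (load_prog m) (input m c C) s1 (m * (4 * m + 5) + 1)"
    and a1: "agree {''k''} (input m c C) s1" and k1: "\<forall>i\<in>{1..m}. s1 ''k'' i = of_int (c i)"
    using run_load_prog by blast
  have s1: "s1 ''C'' 0 = of_int C" "s1 ''out'' j = 0" for j
    using a1 by (simp_all add: agree_def input_def)
  let ?s2 = "update s1 ''q'' 0 (of_nat Q)"
  let ?s3 = "update ?s2 ''B'' 0 (of_int B)"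
  let ?s4 = "update ?s3 ''K'' 0 (of_int C)"
  let ?s5 = "update ?s4 ''K'' 0 (of_int (min C (int Q)))"
  have r2: "run (sq_prog m) s1 ?s2 (m * (4 * m + 6) + 3)"
    unfolding Q by (rule run_sq_prog) (use k1 in blast)
  have r3: "run (setv ''B'' (Add (Add (var ''q'') (var ''q'')) One)) ?s2 ?s3 9"
    by (rule run_setv) (simp_all add: B)
  have r4: "run (setv ''K'' (var ''C'')) ?s3 ?s4 4" by (rule run_setv) (simp_all add: s1)
  have r5: "run (Cond (Less (var ''q'') (var ''C'')) (setv ''K'' (var ''q'')) Skip) ?s4 ?s5 10"
  proof (rule run_Cond_setv)
    have "(rat_of_nat Q < of_int C) = (int Q < C)"
      using of_int_less_iff[where 'a = rat, of "int Q" C] by simp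
    then show "of_int (min C (int Q)) = (if bval (Less (var ''q'') (var ''C'')) ?s4
        then aval (var ''q'') ?s4 else ?s4 ''K'' 0)" by (simp add: s1)
  qed simp_all
  have "run (sample_init m) (input m c C) ?s5 (m * (4 * m + 5) + m * (4 * m + 6) + 60)"
    unfolding sample_init_def load_prog_def[symmetric]
    by (rule run_SeqI[OF r1 run_Seq[OF r2 run_Seq[OF r3 run_Seq[OF r4 r5]]]]) simp
  moreover have "sample_inv m c B (min C (int Q)) 0 {} ?s5"
    using k1 s1 by (simp add: sample_inv_def penalized_def)
  ultimately show ?thesis by blast
qed

definition sample_time :: "nat \<Rightarrow> nat \<Rightarrow> nat" where
  "sample_time m Q = m * (4 * m + 5) + m * (4 * m + 6) + m * (step_time m Q + 1) + 70"

lemma exec_sample_prog: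
  assumes mat: "matroid {1..m} \<I>" and P: "counts m \<I> P" and ne: "bases_within \<I> c C \<noteq> {}"
  shows "\<exists>D. exec (sample_prog m P) (input m c C) D \<and>
    map_pmf (\<lambda>(s, t). out_set m s) D = pmf_of_set (bases_within \<I> c C) \<and>
    (\<forall>(s, t)\<in>set_pmf D. t \<le> sample_time m (sqsum m c))"
proof -
  define Q where "Q = sqsum m c"
  define B where "B = 2 * int Q + 1"
  have ext: "extensions \<I> c C 0 {} = bases_within \<I> c C" by (simp add: extensions_def)
  obtain s1 where r1: "run (sample_init m) (input m c C) s1 (m * (4 * m + 5) + m * (4 * m + 6) + 60)"
    and inv: "sample_inv m c B (min C (int Q)) 0 {} s1"
    using run_sample_init[OF Q_def B_def] by blast
  obtain t1 where t1: "t1 \<le> m * (4 * m + 5) + m * (4 * m + 6) + 60"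
    and x1: "exec (sample_init m) (input m c C) (return_pmf (s1, t1))"
    using r1 unfolding run_def by blast
  obtain D where D: "exec (seqs (map (sample_step P) [Suc 0..<Suc m])) s1 D"
    "map_pmf (\<lambda>(s, t). out_set m s) D = pmf_of_set (bases_within \<I> c C)"
    "\<forall>(s, t)\<in>set_pmf D. t \<le> m * (step_time m Q + 1) + 1"
    using exec_sample_rest[OF mat P Q_def B_def, of 0 C "{}" s1] inv ne unfolding ext by auto
  have "exec (sample_prog m P) (input m c C) (tick (t1 + 1) D)"
    unfolding sample_prog_def One_nat_def[of, symmetric] using exec_Seq_return[OF x1 D(1)] by simp
  moreover have "map_pmf (\<lambda>(s, t). out_set m s) (tick (t1 + 1) D) = pmf_of_set (bases_within \<I> c C)"
    unfolding D(2)[symmetric] by (simp add: tick_def map_pmf_comp case_prod_beta')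
  moreover have "\<forall>(s, t)\<in>set_pmf (tick (t1 + 1) D). t \<le> sample_time m Q"
    using D(3) t1 by (force simp: tick_def sample_time_def)
  ultimately show ?thesis unfolding Q_def by blast
qed

definition sample_size :: "nat \<Rightarrow> nat" where
  "sample_size m = m * (4 * m + 5) + m * (4 * m + 6) + m * (2 * count_size m + 14 * m + 101) + 70"

lemma csize_sample_prog:
  assumes "csize P \<le> count_size m"
  shows "csize (sample_prog m P) \<le> sample_size m"
proof -
  have "csize (sample_init m) \<le> m * (4 * m + 5) + m * (4 * m + 6) + 60"
    using csize_load_prog[of m] sq_expr_size[of m]
    unfolding sample_init_def load_prog_def[symmetric] sq_prog_def by (simp del: upt_Suc)
  moreover have "csize (seqs (map (sample_step P) [1..<Suc m])) \<le>
      length (map (sample_step P) [1..<Suc m]) * (2 * count_size m + 14 * m + 100 + 1) + 1"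
    by (rule csize_seqs)
      (use assms in \<open>auto simp: sample_step_def sample_pre_def sample_post_def simp del: upt_Suc\<close>)
  moreover have "length (map (sample_step P) [1..<Suc m]) = m" by simp
  ultimately show ?thesis unfolding sample_prog_def sample_size_def
    by (simp add: ac_simps del: upt_Suc)
qed

section \<open>The polynomial bound in terms of the l1 norm\<close>

lemma sqsum_le_l1_norm: "sqsum m c \<le> (l1_norm m c)\<^sup>2"
proof -
  have l1: "int (l1_norm m c) = (\<Sum>i=1..m. \<bar>c i\<bar>)" by (simp add: l1_norm_def sum_nonneg)
  have "int (sqsum m c) = (\<Sum>i=1..m. \<bar>c i\<bar> * \<bar>c i\<bar>)" by (simp add: int_sqsum power2_eq_square)
  also have "\<dots> \<le> (\<Sum>i=1..m. \<bar>c i\<bar> * int (l1_norm m c))"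
  proof (rule sum_mono)
    fix i assume "i \<in> {1..m}"
    then have "\<bar>c i\<bar> \<le> int (l1_norm m c)" unfolding l1 by (intro member_le_sum) auto
    then show "\<bar>c i\<bar> * \<bar>c i\<bar> \<le> \<bar>c i\<bar> * int (l1_norm m c)" by (rule mult_left_mono) simp
  qed
  also have "\<dots> = int ((l1_norm m c)\<^sup>2)"
    unfolding sum_distrib_right[symmetric] l1[symmetric] by (simp add: power2_eq_square)
  finally show ?thesis by (simp only: of_nat_le_iff)
qed

text \<open>One polynomial has to serve both algorithms, so the sizes and times of both programs are
  simply added.\<close>

definition total_time :: "nat \<Rightarrow> nat \<Rightarrow> nat" where
  "total_time m Q = (m * (4 * m + 5) + count_size m + 20) + (m * (4 * m + 5) + count_time m Q + 20) +
    sample_size m + sample_time m Q"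

lemma total_time_mono: "Q \<le> Q' \<Longrightarrow> total_time m Q \<le> total_time m Q'"
  unfolding total_time_def sample_time_def step_time_def
  by (intro add_mono mult_le_mono order_refl count_time_mono power_mono) simp_all

lemma poly_fun_total_time: "poly_fun (\<lambda>m l. total_time m (l\<^sup>2))"
  unfolding total_time_def sample_time_def step_time_def sample_size_def
  by (intro poly_fun_intros poly_fun_count_time poly_fun_count_size)

theorem theorem6p1:
  shows "\<exists>p :: nat poly poly. \<forall>m \<I>. regular_matroid m \<I> \<longrightarrow>
    (\<exists>P. counting_algorithm m \<I> (\<lambda>c. poly2 p m (l1_norm m c)) P) \<and>
    (\<exists>Q. sampling_algorithm m \<I> (\<lambda>c. poly2 p m (l1_norm m c)) Q)"
proof -
  obtain p where p: "total_time m (l\<^sup>2) = poly2 p m l" for m l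
    using poly_fun_total_time by (auto simp: poly_fun_def)
  have "(\<exists>P. counting_algorithm m \<I> (\<lambda>c. poly2 p m (l1_norm m c)) P) \<and>
      (\<exists>Q. sampling_algorithm m \<I> (\<lambda>c. poly2 p m (l1_norm m c)) Q)"
    if reg: "regular_matroid m \<I>" for m \<I>
  proof -
    have mat: "matroid {1..m} \<I>" using reg by (simp add: regular_matroid_def)
    obtain r a where ra: "r \<le> m" "\<And>i j. a i j \<in> {-1, 0, 1 :: rat}"
      "\<And>w k. (\<And>i. i \<in> {1..m} \<Longrightarrow> w i > 0) \<Longrightarrow> k < r \<Longrightarrow> elim (gram m a w) k k k \<noteq> 0"
      "\<And>w. (\<And>i. i \<in> {1..m} \<Longrightarrow> w i > 0) \<Longrightarrow>
        (\<Prod>k<r. elim (gram m a w) k k k) = (\<Sum>S\<in>bases \<I>. \<Prod>i\<in>S. w i)"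
      using regular_matroid_representation[OF reg] by blast
    define P where "P = count_prog m r a"
    have P: "counts m \<I> P"
      unfolding counts_def P_def
    proof (intro allI impI)
      fix s \<kappa> \<K> assume k: "\<forall>i\<in>{1..m}. s ''k'' i = rat_of_int (\<kappa> i)" and K: "s ''K'' 0 = rat_of_int \<K>"
      show "\<exists>s'. run (count_prog m r a) s s' (count_time m (sqsum m \<kappa>)) \<and> agree work_vars s s' \<and>
          s' ''N'' 0 = of_nat (card (bases_within \<I> \<kappa> \<K>))"
        by (rule run_count_prog[where s = s and \<kappa> = \<kappa> and \<K> = \<K> and m = m and r = r and a = a])
          (rule mat ra bspec[OF k] K | assumption)+
    qed
    have size: "csize P \<le> count_size m" unfolding P_def by (rule csize_count_prog[OF ra(1)])
    have bound: "total_time m (sqsum m c) \<le> poly2 p m (l1_norm m c)" for c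
      unfolding p[symmetric] by (rule total_time_mono[OF sqsum_le_l1_norm])
    have "counting_algorithm m \<I> (\<lambda>c. poly2 p m (l1_norm m c)) (counting_prog m P)"
      unfolding counting_algorithm_def
    proof (intro allI)
      fix c C
      obtain s t where "exec (counting_prog m P) (input m c C) (return_pmf (s, t))"
        "t \<le> m * (4 * m + 5) + count_time m (sqsum m c) + 20"
        "out_number s = of_nat (card (bases_within \<I> c C))"
        using run_counting_prog[OF P, of c C] unfolding run_def by blast
      then show "\<exists>s t. exec (counting_prog m P) (input m c C) (return_pmf (s, t)) \<and>
          out_number s = of_nat (card (bases_within \<I> c C)) \<and>
          running_time (counting_prog m P) t \<le> poly2 p m (l1_norm m c)"
        using csize_counting_prog[OF size] bound[of c]
        by (intro exI[of _ s] exI[of _ t]) (simp add: running_time_def total_time_def)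
    qed
    moreover have "sampling_algorithm m \<I> (\<lambda>c. poly2 p m (l1_norm m c)) (sample_prog m P)"
      unfolding sampling_algorithm_def
    proof (intro allI impI)
      fix c C assume "bases_within \<I> c C \<noteq> {}"
      then obtain D where D: "exec (sample_prog m P) (input m c C) D"
        "map_pmf (\<lambda>(s, t). out_set m s) D = pmf_of_set (bases_within \<I> c C)"
        "\<forall>(s, t)\<in>set_pmf D. t \<le> sample_time m (sqsum m c)"
        using exec_sample_prog[OF mat P] by blast
      have "running_time (sample_prog m P) t \<le> poly2 p m (l1_norm m c)"
        if "t \<le> sample_time m (sqsum m c)" for t
        using that csize_sample_prog[OF size] bound[of c]
        by (simp add: running_time_def total_time_def)
      with D show "\<exists>D. exec (sample_prog m P) (input m c C) D \<and>
          map_pmf (\<lambda>(s, t). out_set m s) D = pmf_of_set (bases_within \<I> c C) \<and>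
          (\<forall>(s, t)\<in>set_pmf D. running_time (sample_prog m P) t \<le> poly2 p m (l1_norm m c))"
        by blast
    qed
    ultimately show ?thesis by blast
  qed
  then show ?thesis by blast
qed

end
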